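(* For each $n\in\mathbb{N}$ let $m=m_n$ be a positive integer with $m\le n$ and let $d=d_n$ be a positive integer. As $n\to\infty$, \[ \mathsf{TV}(W(K_{n,m},d),M(K_{n,m}))\to \begin{cases} 0 & \text{if } d\gg nm,\\ 1 & \text{if } d\ll nm. \end{cases} \]
   Context: $K_{n,m}$ is the complete bipartite graph with sides of sizes $n$ and $m$, regarded as a graph on $[n+m]$. For a graph $G$ on $[N]$ with adjacency matrix $A_G$: the masked Wishart law $W(G,d)$ is the law of $A_G\odot \bigl(d^{-1/2}(X^\top X-dI_N)\bigr)$, where $X\in\mathbb{R}^{d\times N}$ has i.i.d. standard Gaussian entries and $\odot$ is the entrywise (Schur) product; the masked GOE law $M(G)$ is the law of $A_G\odot M$, where $M$ is an $N\times N$ GOE matrix, i.e. a symmetric matrix with standard Gaussian off-diagonal entries, $\mathcal N(0,2)$ diagonal entries, and mutually independent entries on or above the diagonal. $\mathsf{TV}$ is total variation distance. Asymptotics: $f(n)\gg g(n)$ means $\lim_{n\to\infty}f(n)/g(n)=\infty$, and $f\ll g$ means $g\gg f$. *)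

theory Defs
  imports "HOL-Probability.Probability"
begin

text \<open>
  An \<open>N \<times> N\<close> real matrix is an element of the product space over the index set
  \<open>{1..N} \<times> {1..N}\<close>, that is, a function that is \<open>undefined\<close> outside this set.
  This is needed because the size depends on the sequence index.
\<close>

abbreviation mat_space :: "nat \<Rightarrow> (nat \<times> nat \<Rightarrow> real) measure" where
  "mat_space N \<equiv> \<Pi>\<^sub>M p\<in>{1..N} \<times> {1..N}. borel"

text \<open>A graph on \<open>{1..N}\<close> is given by its set of edges, which are two-element vertex sets.\<close>

definition adj_matrix :: "nat set set \<Rightarrow> nat \<Rightarrow> nat \<Rightarrow> real" where
  "adj_matrix E i j = (if i \<noteq> j \<and> {i, j} \<in> E then 1 else 0)"

definition complete_bipartite :: "nat \<Rightarrow> nat \<Rightarrow> nat set set" where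
  "complete_bipartite n m = {{i, j} | i j. i \<in> {1..n} \<and> j \<in> {n+1..n+m}}"

definition schur_mask :: "nat \<Rightarrow> nat set set \<Rightarrow> (nat \<times> nat \<Rightarrow> real) \<Rightarrow> nat \<times> nat \<Rightarrow> real" where
  "schur_mask N E Y = (\<lambda>(i, j) \<in> {1..N} \<times> {1..N}. adj_matrix E i j * Y (i, j))"

definition gaussian_matrix :: "nat \<Rightarrow> nat \<Rightarrow> (nat \<times> nat \<Rightarrow> real) measure" where
  "gaussian_matrix d N =
     (\<Pi>\<^sub>M p\<in>{1..d} \<times> {1..N}. density lborel (normal_density 0 1))"

definition wishart_matrix :: "nat \<Rightarrow> nat \<Rightarrow> (nat \<times> nat \<Rightarrow> real) \<Rightarrow> nat \<times> nat \<Rightarrow> real" where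
  "wishart_matrix N d X = (\<lambda>(i, j) \<in> {1..N} \<times> {1..N}.
     ((\<Sum>k = 1..d. X (k, i) * X (k, j)) - (if i = j then real d else 0)) / sqrt (real d))"

definition masked_wishart :: "nat \<Rightarrow> nat set set \<Rightarrow> nat \<Rightarrow> (nat \<times> nat \<Rightarrow> real) measure" where
  "masked_wishart N E d =
     distr (gaussian_matrix d N) (mat_space N) (\<lambda>X. schur_mask N E (wishart_matrix N d X))"

text \<open>
  The independent entries on and above the diagonal of a GOE matrix.  The third argument of
  \<open>normal_density\<close> is the standard deviation, so diagonal entries have variance 2.
\<close>

definition goe_entries :: "nat \<Rightarrow> (nat \<times> nat \<Rightarrow> real) measure" where
  "goe_entries N = (\<Pi>\<^sub>M p\<in>{(i, j). 1 \<le> i \<and> i \<le> j \<and> j \<le> N}.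
     density lborel (normal_density 0 (if fst p = snd p then sqrt 2 else 1)))"

definition symmetrize :: "nat \<Rightarrow> (nat \<times> nat \<Rightarrow> real) \<Rightarrow> nat \<times> nat \<Rightarrow> real" where
  "symmetrize N Z = (\<lambda>(i, j) \<in> {1..N} \<times> {1..N}. Z (min i j, max i j))"

definition goe :: "nat \<Rightarrow> (nat \<times> nat \<Rightarrow> real) measure" where
  "goe N = distr (goe_entries N) (mat_space N) (symmetrize N)"

definition masked_goe :: "nat \<Rightarrow> nat set set \<Rightarrow> (nat \<times> nat \<Rightarrow> real) measure" where
  "masked_goe N E = distr (goe N) (mat_space N) (schur_mask N E)"

text \<open>Intended for probability measures with the same \<open>\<sigma>\<close>-algebra.\<close>

definition tv_dist :: "'a measure \<Rightarrow> 'a measure \<Rightarrow> real" where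
  "tv_dist P Q = (SUP A\<in>sets P. \<bar>measure P A - measure Q A\<bar>)"

definition much_greater :: "(nat \<Rightarrow> real) \<Rightarrow> (nat \<Rightarrow> real) \<Rightarrow> bool" (infix "\<ggreater>" 50) where
  "f \<ggreater> g \<longleftrightarrow> filterlim (\<lambda>n. f n / g n) at_top sequentially"

abbreviation (input) much_less :: "(nat \<Rightarrow> real) \<Rightarrow> (nat \<Rightarrow> real) \<Rightarrow> bool" (infix "\<lless>" 50) where
  "f \<lless> g \<equiv> g \<ggreater> f"

end

theory Submission
  imports Defs
begin

text \<open>
  Both masked matrices are determined by their \<open>n \<times> m\<close> block of entries \<open>(i, n + j)\<close>. For the Wishart
  law this block is \<open>Y = A\<^sup>T B / sqrt d\<close>, where \<open>A\<close> consists of the first \<open>n\<close> and \<open>B\<close> of the last \<open>m\<close>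
  columns of a Gaussian matrix with \<open>d\<close> rows; for the GOE it is a matrix \<open>G\<close> with independent standard
  Gaussian entries.

  Let \<open>d\<close> be large compared with \<open>n m\<close>. Given \<open>B\<close>, the rows of \<open>Y\<close> are Gaussian, but their conditional
  laws are too far from the standard one: the average relative entropy has order \<open>n m\<^sup>2 / d\<close>. The
  proof exposes less. Rotating the columns of \<open>B\<close> one after the other into triangular form
  (\<open>bartlett_decomposition\<close>) does not change the law of \<open>Y\<close> and gives
  \<open>Y\<^sub>j = \<sigma>\<^sub>j a\<^sub>j + (\<Sum>l<j. u\<^sub>l\<^sub>j a\<^sub>l) / sqrt d\<close> with independent Gaussian vectors \<open>a\<^sub>l\<close> (rows of \<open>A\<close>) and
  coefficients \<open>u\<^sub>l\<^sub>j\<close>, and with \<open>d \<sigma>\<^sub>j\<^sup>2\<close> chi-square distributed. The map that replaces \<open>a\<^sub>j\<close> by \<open>Y\<^sub>j\<close> and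
  \<open>u\<^sub>l\<^sub>j\<close> by \<open>u\<^sub>l\<^sub>j - (a\<^sub>l \<bullet> Y\<^sub>j) / sqrt d\<close> is triangular, with an explicit Jacobian. So there is an
  explicit density \<open>L\<close> such that \<open>Y\<close> has exactly the law of \<open>G\<close> after reweighting by \<open>L\<close>
  (\<open>likelihood_change_of_measure\<close>). The total variation distance is then at most
  \<open>2 sqrt (E (- ln L))\<close> (\<open>change_of_measure_deviation\<close>), and computing this mean takes nothing but
  second and fourth moments. Subtracting the prediction of \<open>u\<^sub>l\<^sub>j\<close> from \<open>Y\<^sub>j\<close> makes the terms of order
  \<open>n m\<^sup>2 / d\<close> cancel, and the result is at most \<open>2 x + 2 x\<^sup>2\<close> with \<open>x = n m / d\<close>
  (\<open>expectation_log_cost\<close>, \<open>log_cost_bound\<close>).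

  Let \<open>d\<close> be small compared with \<open>n m\<close>. The test statistic is the inner product of
  \<open>\<Sum>i. y\<^sub>i y\<^sub>i\<^sup>T - 1\<close> over the first half of the rows with the same sum over the second half. For \<open>G\<close> it
  is centred with standard deviation of order \<open>n m\<close>. Given \<open>B\<close>, its mean for \<open>Y\<close> is \<open>h\<^sup>2 w\<close>, where
  \<open>h = n div 2\<close> and \<open>w\<close> is the squared Hilbert-Schmidt distance from \<open>B\<^sup>T B / d\<close> to the identity, and
  it concentrates around this mean (\<open>overlap_concentration\<close>). Typically \<open>w\<close> has order \<open>m\<^sup>2 / d\<close>, so that
  the mean has order \<open>n\<^sup>2 m\<^sup>2 / d\<close>, which is much larger than \<open>n m\<close>. It must be excluded that \<open>w\<close> is
  atypically small, uniformly in \<open>m\<close> (\<open>cov_excess_small_ball\<close>). For many columns this follows from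
  the variance of the off-diagonal part. For few columns there is no concentration, and the length
  of a single column is spread out instead: a chi-square variable does not charge short intervals
  around its mean (\<open>chi_square_anticoncentration\<close>).
\<close>

section \<open>Gaussian product measures and affine changes of variables\<close>

text \<open>
  Every space here is a finite product of real lines, and its index set varies with \<open>n\<close>. The three
  measures on it have the same measurable sets, and measurability is always stated for
  \<open>fun_space\<close>.
\<close>

abbreviation fun_space :: "'i set \<Rightarrow> ('i \<Rightarrow> real) measure" where
  "fun_space I \<equiv> PiM I (\<lambda>_. borel)"

abbreviation leb :: "'i set \<Rightarrow> ('i \<Rightarrow> real) measure" where
  "leb I \<equiv> PiM I (\<lambda>_. lborel)"

abbreviation gauss :: "'i set \<Rightarrow> ('i \<Rightarrow> real) measure" where
  "gauss I \<equiv> PiM I (\<lambda>_. std_normal_distribution)"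

lemma sets_leb [measurable_cong]: "sets (leb I) = sets (fun_space I)"
  by (intro sets_PiM_cong) auto

lemma sets_gauss [measurable_cong]: "sets (gauss I) = sets (fun_space I)"
  by (intro sets_PiM_cong) auto

lemma measurable_leb [simp]: "measurable (leb I) N = measurable (fun_space I) N"
  by (intro measurable_cong_sets sets_leb refl)

lemma measurable_gauss [simp]: "measurable (gauss I) N = measurable (fun_space I) N"
  by (intro measurable_cong_sets sets_gauss refl)

lemma prob_space_gauss: "prob_space (gauss I)"
  by (intro prob_space_PiM prob_space_normal_density) simp

interpretation leb: product_sigma_finite "\<lambda>_. lborel :: real measure"
  by unfold_locales

interpretation gauss: product_prob_space "\<lambda>_. std_normal_distribution" UNIV
proof -
  interpret N: prob_space "std_normal_distribution"
    by (rule prob_space_normal_density) simp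
  show "product_prob_space (\<lambda>_. std_normal_distribution)"
    by unfold_locales
qed

text \<open>
  Outside \<open>I\<close> the elements of the space are \<open>undefined\<close>, so that the coordinate is constant. Stating
  the fact for all \<open>p\<close> keeps index conditions out of the measurability proofs.
\<close>

lemma borel_measurable_coordinate [measurable (raw)]:
  "(\<lambda>\<omega>. \<omega> p) \<in> borel_measurable (fun_space I)"
proof (cases "p \<in> I")
  case False
  show ?thesis
    by (subst measurable_cong[where g = "\<lambda>_. undefined"])
      (use False in \<open>auto simp: space_PiM PiE_def extensional_def\<close>)
qed auto

text \<open>
  The condition ranges over all functions and not only over those in the product space; it can
  then be checked by unfolding, coordinate by coordinate.
\<close>

definition free_of :: "'i set \<Rightarrow> (('i \<Rightarrow> real) \<Rightarrow> 'b) \<Rightarrow> bool" where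
  "free_of C f \<longleftrightarrow> (\<forall>\<omega> \<omega>'. (\<forall>p. p \<notin> C \<longrightarrow> \<omega> p = \<omega>' p) \<longrightarrow> f \<omega> = f \<omega>')"

lemma free_ofD: "free_of C f \<Longrightarrow> (\<And>p. p \<notin> C \<Longrightarrow> \<omega> p = \<omega>' p) \<Longrightarrow> f \<omega> = f \<omega>'"
  unfolding free_of_def by blast

lemma free_of_subset: "free_of C f \<Longrightarrow> D \<subseteq> C \<Longrightarrow> free_of D f"
  unfolding free_of_def by blast

lemma free_of_coordinate [simp]: "p \<notin> C \<Longrightarrow> free_of C (\<lambda>\<omega>. \<omega> p)"
  unfolding free_of_def by blast

definition block_affine ::
  "'i set \<Rightarrow> ('i \<Rightarrow> ('i \<Rightarrow> real) \<Rightarrow> real) \<Rightarrow> ('i \<Rightarrow> ('i \<Rightarrow> real) \<Rightarrow> real) \<Rightarrow> ('i \<Rightarrow> real) \<Rightarrow> 'i \<Rightarrow> real" where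
  "block_affine C a b \<omega> = (\<lambda>p. if p \<in> C then a p \<omega> * \<omega> p + b p \<omega> else \<omega> p)"

lemma measurable_block_affine:
  assumes "C \<subseteq> I" and a: "\<And>p. p \<in> C \<Longrightarrow> a p \<in> borel_measurable (fun_space I)"
    and b: "\<And>p. p \<in> C \<Longrightarrow> b p \<in> borel_measurable (fun_space I)"
  shows "block_affine C a b \<in> measurable (fun_space I) (fun_space I)"
proof (rule measurable_PiM_single')
  fix i assume "i \<in> I"
  show "(\<lambda>\<omega>. block_affine C a b \<omega> i) \<in> borel_measurable (fun_space I)"
  proof (cases "i \<in> C")
    case True
    note a[OF True, measurable] b[OF True, measurable]
    show ?thesis using True unfolding block_affine_def by simp
  qed (simp add: block_affine_def)
next
  show "block_affine C a b \<in> space (fun_space I) \<rightarrow> (\<Pi>\<^sub>E i\<in>I. space borel)"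
    using assms(1) by (auto simp: block_affine_def space_PiM PiE_def extensional_def)
qed

text \<open>
  The change of variables formula itself, for nonnegative integrands. In this form it composes
  directly and applies to densities at once.
\<close>

definition jacobian :: "'i set \<Rightarrow> (('i \<Rightarrow> real) \<Rightarrow> 'i \<Rightarrow> real) \<Rightarrow> (('i \<Rightarrow> real) \<Rightarrow> real) \<Rightarrow> bool" where
  "jacobian I T J \<longleftrightarrow> T \<in> measurable (fun_space I) (fun_space I) \<and>
     J \<in> borel_measurable (fun_space I) \<and> (\<forall>\<omega>. 0 \<le> J \<omega>) \<and>
     (\<forall>F \<in> borel_measurable (fun_space I). (\<integral>\<^sup>+\<omega>. F (T \<omega>) * ennreal (J \<omega>) \<partial>leb I) = (\<integral>\<^sup>+\<omega>. F \<omega> \<partial>leb I))"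

lemma jacobianD:
  assumes "jacobian I T J" "F \<in> borel_measurable (fun_space I)"
  shows "(\<integral>\<^sup>+\<omega>. F (T \<omega>) * ennreal (J \<omega>) \<partial>leb I) = (\<integral>\<^sup>+\<omega>. F \<omega> \<partial>leb I)"
  using assms unfolding jacobian_def by blast

lemma jacobian_id: "jacobian I (\<lambda>\<omega>. \<omega>) (\<lambda>_. 1)"
  unfolding jacobian_def by auto

lemma jacobian_comp:
  assumes "jacobian I S J" "jacobian I T K"
  shows "jacobian I (\<lambda>\<omega>. S (T \<omega>)) (\<lambda>\<omega>. J (T \<omega>) * K \<omega>)"
proof -
  have [measurable]: "S \<in> measurable (fun_space I) (fun_space I)" "T \<in> measurable (fun_space I) (fun_space I)"
     "J \<in> borel_measurable (fun_space I)" "K \<in> borel_measurable (fun_space I)"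
    using assms by (auto simp: jacobian_def)
  have nn: "\<And>\<omega>. 0 \<le> J \<omega>" "\<And>\<omega>. 0 \<le> K \<omega>" using assms by (auto simp: jacobian_def)
  have "(\<integral>\<^sup>+\<omega>. F (S (T \<omega>)) * ennreal (J (T \<omega>) * K \<omega>) \<partial>leb I) = (\<integral>\<^sup>+\<omega>. F \<omega> \<partial>leb I)"
    if [measurable]: "F \<in> borel_measurable (fun_space I)" for F
  proof -
    have "(\<integral>\<^sup>+\<omega>. F (S (T \<omega>)) * ennreal (J (T \<omega>) * K \<omega>) \<partial>leb I)
        = (\<integral>\<^sup>+\<omega>. (\<lambda>\<omega>. F (S \<omega>) * ennreal (J \<omega>)) (T \<omega>) * ennreal (K \<omega>) \<partial>leb I)"
      by (intro nn_integral_cong) (simp add: ennreal_mult nn mult.assoc)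
    also have "\<dots> = (\<integral>\<^sup>+\<omega>. F (S \<omega>) * ennreal (J \<omega>) \<partial>leb I)"
    proof -
      have "(\<lambda>\<omega>. F (S \<omega>) * ennreal (J \<omega>)) \<in> borel_measurable (fun_space I)" by measurable
      from jacobianD[OF assms(2) this] show ?thesis .
    qed
    also have "\<dots> = (\<integral>\<^sup>+\<omega>. F \<omega> \<partial>leb I)"
      by (rule jacobianD[OF assms(1) that])
    finally show ?thesis .
  qed
  then show ?thesis unfolding jacobian_def using nn by auto
qed

lemma jacobian_cong:
  "jacobian I T J \<Longrightarrow> (\<And>\<omega>. T \<omega> = T' \<omega>) \<Longrightarrow> (\<And>\<omega>. J \<omega> = J' \<omega>) \<Longrightarrow> jacobian I T' J'"
  by (metis (no_types, lifting) ext)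

text \<open>
  By Fubini only the integral over coordinate \<open>q\<close> matters, and there the map is affine with
  constant coefficients, because these do not see the coordinate \<open>q\<close>.
\<close>

lemma jacobian_single:
  assumes "finite I" "q \<in> I" 
    and [measurable]: "a q \<in> borel_measurable (fun_space I)" "b q \<in> borel_measurable (fun_space I)"
    and free: "free_of {q} (a q)" "free_of {q} (b q)" and nz: "\<And>\<omega>. a q \<omega> \<noteq> 0"
  shows "jacobian I (block_affine {q} a b) (\<lambda>\<omega>. \<bar>a q \<omega>\<bar>)"
proof -
  define I' where "I' = I - {q}"
  have I: "I = insert q I'" "q \<notin> I'" "finite I'" using assms by (auto simp: I'_def)
  have m [measurable]: "block_affine {q} a b \<in> measurable (fun_space I) (fun_space I)"
    using assms by (intro measurable_block_affine) auto
  have "(\<integral>\<^sup>+\<omega>. F (block_affine {q} a b \<omega>) * ennreal \<bar>a q \<omega>\<bar> \<partial>leb I) = (\<integral>\<^sup>+\<omega>. F \<omega> \<partial>leb I)"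
    if F [measurable]: "F \<in> borel_measurable (fun_space I)" for F
  proof -
    have upd: "(\<lambda>y. x(q := y)) \<in> measurable borel (fun_space I)" if x: "x \<in> space (leb I')" for x
    proof (rule measurable_PiM_single')
      fix i assume "i \<in> I"
      show "(\<lambda>y. (x(q := y)) i) \<in> borel_measurable borel" by (cases "i = q") auto
    next
      show "(\<lambda>y. x(q := y)) \<in> space borel \<rightarrow> (\<Pi>\<^sub>E i\<in>I. space borel)"
        using x by (auto simp: I space_PiM PiE_def extensional_def)
    qed
    have inner: "(\<integral>\<^sup>+y. F (block_affine {q} a b (x(q := y))) * ennreal \<bar>a q (x(q := y))\<bar> \<partial>lborel)
           = (\<integral>\<^sup>+y. F (x(q := y)) \<partial>lborel)" if x: "x \<in> space (leb I')" for x
    proof -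
      note [measurable] = upd[OF x]
      define c e where "c = a q x" "e = b q x"
      have c: "a q (x(q := y)) = c" "b q (x(q := y)) = e" for y
        unfolding c_e_def by (rule free_ofD[OF free(1)], simp, rule free_ofD[OF free(2)], simp)
      have "block_affine {q} a b (x(q := y)) = x(q := e + c * y)" for y
        unfolding block_affine_def by (auto simp: c fun_eq_iff)
      then have "(\<integral>\<^sup>+y. F (block_affine {q} a b (x(q := y))) * ennreal \<bar>a q (x(q := y))\<bar> \<partial>lborel)
         = (\<integral>\<^sup>+y. ennreal \<bar>c\<bar> * F (x(q := e + c * y)) \<partial>lborel)"
        by (simp add: c mult.commute)
      also have "\<dots> = ennreal \<bar>c\<bar> * (\<integral>\<^sup>+y. F (x(q := e + c * y)) \<partial>lborel)"
        by (intro nn_integral_cmult) simp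
      also have "\<dots> = (\<integral>\<^sup>+y. F (x(q := y)) \<partial>lborel)"
        by (rule nn_integral_real_affine[symmetric]) (auto simp: c_e_def nz)
      finally show ?thesis .
    qed
    have "(\<integral>\<^sup>+\<omega>. F (block_affine {q} a b \<omega>) * ennreal \<bar>a q \<omega>\<bar> \<partial>leb I)
       = (\<integral>\<^sup>+x. (\<integral>\<^sup>+y. F (block_affine {q} a b (x(q := y))) * ennreal \<bar>a q (x(q := y))\<bar> \<partial>lborel) \<partial>leb I')"
      unfolding I(1) by (rule leb.product_nn_integral_insert) (use I in \<open>auto simp flip: I(1)\<close>)
    also have "\<dots> = (\<integral>\<^sup>+x. (\<integral>\<^sup>+y. F (x(q := y)) \<partial>lborel) \<partial>leb I')"
      by (intro nn_integral_cong inner)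
    also have "\<dots> = (\<integral>\<^sup>+\<omega>. F \<omega> \<partial>leb I)"
      unfolding I(1) by (rule leb.product_nn_integral_insert[symmetric]) (use I in \<open>auto simp flip: I(1)\<close>)
    finally show ?thesis .
  qed
  then show ?thesis unfolding jacobian_def by auto
qed

text \<open>
  The coefficients do not see the coordinates of the block, so that moving the coordinates one
  after the other gives the same result as moving them together.
\<close>

lemma jacobian_block_affine:
  assumes "finite I" "C \<subseteq> I"
    and "\<And>p. p \<in> C \<Longrightarrow> a p \<in> borel_measurable (fun_space I)"
    and "\<And>p. p \<in> C \<Longrightarrow> b p \<in> borel_measurable (fun_space I)"
    and "\<And>p. p \<in> C \<Longrightarrow> free_of C (a p)" "\<And>p. p \<in> C \<Longrightarrow> free_of C (b p)"
    and "\<And>p \<omega>. p \<in> C \<Longrightarrow> a p \<omega> \<noteq> 0"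
  shows "jacobian I (block_affine C a b) (\<lambda>\<omega>. \<Prod>p\<in>C. \<bar>a p \<omega>\<bar>)"
proof -
  have "finite C" using assms finite_subset by blast
  then show ?thesis using assms(2-)
  proof (induction C)
    case empty
    have "block_affine {} a b = (\<lambda>\<omega>. \<omega>)" by (auto simp: block_affine_def)
    then show ?case using jacobian_id by simp
  next
    case (insert q C)
    have 1: "jacobian I (block_affine C a b) (\<lambda>\<omega>. \<Prod>p\<in>C. \<bar>a p \<omega>\<bar>)"
      using insert.prems by (intro insert.IH) (auto intro: free_of_subset[of "insert q C"])
    have 2: "jacobian I (block_affine {q} a b) (\<lambda>\<omega>. \<bar>a q \<omega>\<bar>)"
      using insert.prems assms(1) by (intro jacobian_single) (auto intro: free_of_subset[of "insert q C"])
    have eq: "a p (block_affine {q} a b \<omega>) = a p \<omega>" "b p (block_affine {q} a b \<omega>) = b p \<omega>"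
      if "p \<in> C" for p \<omega>
    proof -
      have off: "block_affine {q} a b \<omega> r = \<omega> r" if "r \<notin> insert q C" for r
        using that by (simp add: block_affine_def)
      show "a p (block_affine {q} a b \<omega>) = a p \<omega>"
        using insert.prems(4)[of p] that off by (intro free_ofD[of "insert q C" "a p"]) auto
      show "b p (block_affine {q} a b \<omega>) = b p \<omega>"
        using insert.prems(5)[of p] that off by (intro free_ofD[of "insert q C" "b p"]) auto
    qed
    show ?case
    proof (rule jacobian_cong[OF jacobian_comp[OF 1 2]])
      fix \<omega>
      show "block_affine C a b (block_affine {q} a b \<omega>) = block_affine (insert q C) a b \<omega>"
      proof
        fix p
        have "block_affine {q} a b \<omega> p = \<omega> p" if "p \<in> C" using that insert.hyps by (auto simp: block_affine_def)
        then show "block_affine C a b (block_affine {q} a b \<omega>) p = block_affine (insert q C) a b \<omega> p"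
          using eq[of p \<omega>] insert.hyps by (cases "p \<in> C"; cases "p = q") (simp_all add: block_affine_def)
      qed
      show "(\<Prod>p\<in>C. \<bar>a p (block_affine {q} a b \<omega>)\<bar>) * \<bar>a q \<omega>\<bar> = (\<Prod>p\<in>insert q C. \<bar>a p \<omega>\<bar>)"
        using insert.hyps eq by (simp add: mult.commute)
    qed
  qed
qed

lemma gauss_eq_density:
  assumes "finite I"
  shows "gauss I = density (leb I) (\<lambda>\<omega>. ennreal (\<Prod>p\<in>I. std_normal_density (\<omega> p)))"
proof (rule gauss.PiM_eqI[symmetric])
  show "finite I" by fact
  show "sets (density (leb I) (\<lambda>\<omega>. ennreal (\<Prod>p\<in>I. std_normal_density (\<omega> p)))) = sets (gauss I)"
    by (simp add: sets_leb sets_gauss)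
  fix A :: "'a \<Rightarrow> real set" assume A: "\<And>i. i \<in> I \<Longrightarrow> A i \<in> sets (std_normal_distribution)"
  then have [measurable]: "\<And>i. i \<in> I \<Longrightarrow> A i \<in> sets borel" by auto
  have ind: "(\<Prod>p\<in>I. indicator (A p) (\<omega> p)) = (indicator (Pi\<^sub>E I A) \<omega> :: ennreal)" if "\<omega> \<in> space (leb I)" for \<omega>
    using that assms by (auto simp: indicator_def space_PiM PiE_def prod_eq_1_iff split: if_splits)
      (use assms in \<open>auto simp: Pi_iff\<close>)
  have meas: "Pi\<^sub>E I A \<in> sets (leb I)" using A assms by (intro sets_PiM_I_finite) auto
  have "emeasure (density (leb I) (\<lambda>\<omega>. ennreal (\<Prod>p\<in>I. std_normal_density (\<omega> p)))) (Pi\<^sub>E I A)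
     = (\<integral>\<^sup>+\<omega>. ennreal (\<Prod>p\<in>I. std_normal_density (\<omega> p)) * indicator (Pi\<^sub>E I A) \<omega> \<partial>leb I)"
    using meas by (subst emeasure_density) auto
  also have "\<dots> = (\<integral>\<^sup>+\<omega>. (\<Prod>p\<in>I. ennreal (std_normal_density (\<omega> p)) * indicator (A p) (\<omega> p)) \<partial>leb I)"
    by (intro nn_integral_cong) (simp add: ind prod.distrib prod_ennreal)
  also have "\<dots> = (\<Prod>p\<in>I. \<integral>\<^sup>+x. ennreal (std_normal_density x) * indicator (A p) x \<partial>lborel)"
    using assms by (subst leb.product_nn_integral_prod) auto
  also have "\<dots> = (\<Prod>p\<in>I. emeasure (std_normal_distribution) (A p))"
    using A by (intro prod.cong) (auto simp: emeasure_density)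
  finally show "emeasure (density (leb I) (\<lambda>\<omega>. ennreal (\<Prod>p\<in>I. std_normal_density (\<omega> p)))) (Pi\<^sub>E I A)
     = (\<Prod>i\<in>I. emeasure (std_normal_distribution) (A i))" .
qed

definition sq_norm :: "'i set \<Rightarrow> ('i \<Rightarrow> real) \<Rightarrow> real" where
  "sq_norm I \<omega> = (\<Sum>p\<in>I. (\<omega> p)\<^sup>2)"

lemma sq_norm_measurable [measurable]: "sq_norm I \<in> borel_measurable (fun_space J)"
  unfolding sq_norm_def by simp

lemma prod_std_normal_density:
  "finite I \<Longrightarrow> (\<Prod>p\<in>I. std_normal_density (\<omega> p)) = (1 / sqrt (2 * pi)) ^ card I * exp (- sq_norm I \<omega> / 2)"
  by (simp only: std_normal_density_def prod.distrib prod_constant sq_norm_def sum_divide_distrib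
        sum_negf[symmetric] exp_sum)

text \<open>
  The exponential is the quotient of the Gaussian densities at \<open>T \<omega>\<close> and at \<open>\<omega>\<close>. For a rotation
  the weight is 1. For the triangular map below it is the likelihood ratio of the two models, and
  for a dilation it compares the probability of a set with that of a dilated copy.
\<close>

theorem gauss_transform:
  assumes "finite I" and J: "jacobian I T J" and F [measurable]: "F \<in> borel_measurable (fun_space I)"
  shows "(\<integral>\<^sup>+\<omega>. F (T \<omega>) * ennreal (J \<omega> * exp (- (sq_norm I (T \<omega>) - sq_norm I \<omega>) / 2)) \<partial>gauss I)
       = (\<integral>\<^sup>+\<omega>. F \<omega> \<partial>gauss I)"
proof -
  have [measurable]: "T \<in> measurable (fun_space I) (fun_space I)" "J \<in> borel_measurable (fun_space I)"
    and nn: "\<And>\<omega>. 0 \<le> J \<omega>"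
    using J by (auto simp: jacobian_def)
  define c :: real where "c = (1 / sqrt (2 * pi)) ^ card I"
  have c: "c \<ge> 0" by (simp add: c_def)
  have g: "(\<integral>\<^sup>+\<omega>. G \<omega> \<partial>gauss I) = (\<integral>\<^sup>+\<omega>. ennreal (c * exp (- sq_norm I \<omega> / 2)) * G \<omega> \<partial>leb I)"
    if [measurable]: "G \<in> borel_measurable (fun_space I)" for G
    by (subst gauss_eq_density[OF assms(1)], subst nn_integral_density)
       (auto simp: prod_std_normal_density assms c_def)
  have "(\<integral>\<^sup>+\<omega>. F (T \<omega>) * ennreal (J \<omega> * exp (- (sq_norm I (T \<omega>) - sq_norm I \<omega>) / 2)) \<partial>gauss I)
     = (\<integral>\<^sup>+\<omega>. (\<lambda>\<omega>. ennreal (c * exp (- sq_norm I \<omega> / 2)) * F \<omega>) (T \<omega>) * ennreal (J \<omega>) \<partial>leb I)"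
  proof (subst g, measurable, intro nn_integral_cong)
    fix \<omega>
    have "c * exp (- sq_norm I \<omega> / 2) * (J \<omega> * exp (- (sq_norm I (T \<omega>) - sq_norm I \<omega>) / 2))
       = c * exp (- sq_norm I (T \<omega>) / 2) * J \<omega>"
      by (simp add: mult_ac exp_add[symmetric] diff_divide_distrib)
    then have "ennreal (c * exp (- sq_norm I \<omega> / 2)) * ennreal (J \<omega> * exp (- (sq_norm I (T \<omega>) - sq_norm I \<omega>) / 2))
       = ennreal (c * exp (- sq_norm I (T \<omega>) / 2)) * ennreal (J \<omega>)"
      using c nn by (simp add: ennreal_mult[symmetric])
    then show "ennreal (c * exp (- sq_norm I \<omega> / 2)) * (F (T \<omega>) * ennreal (J \<omega> * exp (- (sq_norm I (T \<omega>) - sq_norm I \<omega>) / 2)))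
       = (\<lambda>\<omega>. ennreal (c * exp (- sq_norm I \<omega> / 2)) * F \<omega>) (T \<omega>) * ennreal (J \<omega>)"
      by (simp add: mult_ac)
  qed
  also have "\<dots> = (\<integral>\<^sup>+\<omega>. ennreal (c * exp (- sq_norm I \<omega> / 2)) * F \<omega> \<partial>leb I)"
  proof -
    have "(\<lambda>\<omega>. ennreal (c * exp (- sq_norm I \<omega> / 2)) * F \<omega>) \<in> borel_measurable (fun_space I)" by measurable
    from jacobianD[OF J this] show ?thesis .
  qed
  also have "\<dots> = (\<integral>\<^sup>+\<omega>. F \<omega> \<partial>gauss I)" by (rule g[symmetric]) fact
  finally show ?thesis .
qed

section \<open>Triangular form of a product of Gaussian matrices\<close>

definition tail_norm :: "nat \<Rightarrow> nat \<Rightarrow> nat \<Rightarrow> (nat \<times> nat \<Rightarrow> real) \<Rightarrow> real" where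
  "tail_norm d j c \<omega> = sqrt (\<Sum>k = j..d. (\<omega> (k, c))\<^sup>2)"

text \<open>
  The block \<open>A\<^sup>T B\<close>, with \<open>p = (i, j)\<close>, after its first \<open>J\<close> columns have been brought to triangular
  form: a treated column \<open>j\<close> uses the rows of \<open>A\<close> up to \<open>j\<close> only, and the part of \<open>b\<^sub>j\<close> from row
  \<open>j\<close> on has been replaced by its length. For \<open>J = 0\<close> this is the block itself.
\<close>

definition bartlett :: "nat \<Rightarrow> nat \<Rightarrow> nat \<Rightarrow> (nat \<times> nat \<Rightarrow> real) \<Rightarrow> nat \<times> nat \<Rightarrow> real" where
  "bartlett n d J \<omega> p = (if snd p \<le> J
     then (\<Sum>l = 1..<snd p. \<omega> (l, fst p) * \<omega> (l, n + snd p)) + tail_norm d (snd p) (n + snd p) \<omega> * \<omega> (snd p, fst p)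
     else (\<Sum>k = 1..d. \<omega> (k, fst p) * \<omega> (k, n + snd p)))"

lemma tail_norm_measurable [measurable]: "tail_norm d j c \<in> borel_measurable (fun_space I)"
  unfolding tail_norm_def by measurable

lemma bartlett_measurable [measurable]:
  "(\<lambda>\<omega>. bartlett n d J \<omega> p) \<in> borel_measurable (fun_space I)"
  unfolding bartlett_def by measurable

lemma restrict_bartlett_measurable [measurable]:
  "(\<lambda>\<omega>. restrict (bartlett n d J \<omega>) K) \<in> measurable (fun_space I) (fun_space K)"
  by (intro measurable_restrict bartlett_measurable)

lemma gauss_AE_nonzero:
  assumes "p \<in> I" shows "AE \<omega> in gauss I. \<omega> p \<noteq> 0"
proof -
  have "AE x in std_normal_distribution. x \<noteq> 0"
    by (subst AE_density) (auto intro: AE_mp[OF AE_lborel_singleton[of 0]])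
  then show ?thesis
    by (intro AE_PiM_component[OF prob_space_normal_density assms]) auto
qed

text \<open>
  The rotation in the plane spanned by the unit vector \<open>e\<^sub>j\<close> and by the tail of column \<open>e\<close> below row
  \<open>j\<close>, which takes the part of column \<open>e\<close> from row \<open>j\<close> on to a multiple of \<open>e\<^sub>j\<close>; it acts on the
  columns in \<open>C\<close>. With cosine \<open>c\<close>, sine \<open>s\<close> and \<open>t = s / (1 + c)\<close> a plane rotation is the product of
  the shears \<open>x += t y\<close>, \<open>y -= s x\<close>, \<open>x += t y\<close>. Each shear is a block move with coefficient 1, which
  gives the invariance of Lebesgue measure at once.
\<close>

definition pivot_shear :: "nat \<Rightarrow> nat \<Rightarrow> nat set \<Rightarrow> nat \<Rightarrow> (nat \<times> nat \<Rightarrow> real) \<Rightarrow> nat \<times> nat \<Rightarrow> real" where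
  "pivot_shear d j C e = block_affine ({j} \<times> C) (\<lambda>_ _. 1)
     (\<lambda>p \<omega>. (\<Sum>k = Suc j..d. \<omega> (k, e) * \<omega> (k, snd p)) / (tail_norm d j e \<omega> + \<omega> (j, e)))"

definition tail_shear :: "nat \<Rightarrow> nat \<Rightarrow> nat set \<Rightarrow> nat \<Rightarrow> (nat \<times> nat \<Rightarrow> real) \<Rightarrow> nat \<times> nat \<Rightarrow> real" where
  "tail_shear d j C e = block_affine ({Suc j..d} \<times> C) (\<lambda>_ _. 1)
     (\<lambda>p \<omega>. - (\<omega> (fst p, e) / tail_norm d j e \<omega>) * \<omega> (j, snd p))"

definition plane_rotation :: "nat \<Rightarrow> nat \<Rightarrow> nat set \<Rightarrow> nat \<Rightarrow> (nat \<times> nat \<Rightarrow> real) \<Rightarrow> nat \<times> nat \<Rightarrow> real" where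
  "plane_rotation d j C e \<omega> = pivot_shear d j C e (tail_shear d j C e (pivot_shear d j C e \<omega>))"

lemma tail_norm_cong: "(\<And>k. k \<in> {j..d} \<Longrightarrow> \<omega> (k, c) = \<omega>' (k, c)) \<Longrightarrow> tail_norm d j c \<omega> = tail_norm d j c \<omega>'"
  unfolding tail_norm_def by simp

lemma jacobian_pivot_shear:
  assumes "finite I" "{j} \<times> C \<subseteq> I" "e \<notin> C"
  shows "jacobian I (pivot_shear d j C e) (\<lambda>_. 1)"
proof -
  have "jacobian I (pivot_shear d j C e) (\<lambda>\<omega>. \<Prod>p\<in>{j} \<times> C. \<bar>1\<bar>)"
    unfolding pivot_shear_def
  proof (rule jacobian_block_affine)
    fix p assume p: "p \<in> {j} \<times> C"
    show "free_of ({j} \<times> C) (\<lambda>\<omega>. (\<Sum>k = Suc j..d. \<omega> (k, e) * \<omega> (k, snd p)) / (tail_norm d j e \<omega> + \<omega> (j, e)))"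
      unfolding free_of_def
    proof (intro allI impI)
      fix \<omega> \<omega>' :: "nat \<times> nat \<Rightarrow> real" assume eq: "\<forall>p. p \<notin> {j} \<times> C \<longrightarrow> \<omega> p = \<omega>' p"
      have "tail_norm d j e \<omega> = tail_norm d j e \<omega>'" using eq assms(3) by (intro tail_norm_cong) auto
      moreover have "(\<Sum>k = Suc j..d. \<omega> (k, e) * \<omega> (k, snd p)) = (\<Sum>k = Suc j..d. \<omega>' (k, e) * \<omega>' (k, snd p))"
        using eq by (intro sum.cong) auto
      ultimately show "(\<Sum>k = Suc j..d. \<omega> (k, e) * \<omega> (k, snd p)) / (tail_norm d j e \<omega> + \<omega> (j, e)) =
         (\<Sum>k = Suc j..d. \<omega>' (k, e) * \<omega>' (k, snd p)) / (tail_norm d j e \<omega>' + \<omega>' (j, e))"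
        using eq assms(3) by auto
    qed
  qed (use assms in \<open>auto simp: free_of_def\<close>)
  then show ?thesis by simp
qed

lemma jacobian_tail_shear:
  assumes "finite I" "{Suc j..d} \<times> C \<subseteq> I" "e \<notin> C"
  shows "jacobian I (tail_shear d j C e) (\<lambda>_. 1)"
proof -
  have "jacobian I (tail_shear d j C e) (\<lambda>\<omega>. \<Prod>p\<in>{Suc j..d} \<times> C. \<bar>1\<bar>)"
    unfolding tail_shear_def
  proof (rule jacobian_block_affine)
    fix p assume p: "p \<in> {Suc j..d} \<times> C"
    show "free_of ({Suc j..d} \<times> C) (\<lambda>\<omega>. - (\<omega> (fst p, e) / tail_norm d j e \<omega>) * \<omega> (j, snd p))"
      unfolding free_of_def
    proof (intro allI impI)
      fix \<omega> \<omega>' :: "nat \<times> nat \<Rightarrow> real" assume eq: "\<forall>p. p \<notin> {Suc j..d} \<times> C \<longrightarrow> \<omega> p = \<omega>' p"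
      have "tail_norm d j e \<omega> = tail_norm d j e \<omega>'" using eq assms(3) by (intro tail_norm_cong) auto
      then show "- (\<omega> (fst p, e) / tail_norm d j e \<omega>) * \<omega> (j, snd p) =
         - (\<omega>' (fst p, e) / tail_norm d j e \<omega>') * \<omega>' (j, snd p)"
        using eq assms(3) by auto
    qed
  qed (use assms in \<open>auto simp: free_of_def\<close>)
  then show ?thesis by simp
qed

lemma jacobian_plane_rotation:
  assumes "finite I" "{j..d} \<times> C \<subseteq> I" "e \<notin> C" "j \<le> d"
  shows "jacobian I (plane_rotation d j C e) (\<lambda>_. 1)"
proof -
  have 1: "jacobian I (pivot_shear d j C e) (\<lambda>_. 1)" "jacobian I (tail_shear d j C e) (\<lambda>_. 1)"
    using assms by (auto intro!: jacobian_pivot_shear jacobian_tail_shear)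
  from jacobian_comp[OF 1(1) jacobian_comp[OF 1(2) 1(1)]] show ?thesis
    by (simp add: plane_rotation_def[abs_def])
qed

lemma plane_rotation_other: "c \<notin> C \<or> k < j \<or> k > d \<Longrightarrow> j \<le> d \<Longrightarrow> plane_rotation d j C e \<omega> (k, c) = \<omega> (k, c)"
  unfolding plane_rotation_def pivot_shear_def tail_shear_def block_affine_def by auto

text \<open>
  In the rotated frame column \<open>e\<close> is \<open>r\<close> times the \<open>j\<close>-th unit vector, so that its inner product
  with column \<open>c\<close> can be read off from entry \<open>j\<close>. A nonzero last entry excludes the case that
  column \<open>e\<close> is already a negative multiple of the unit vector, where \<open>r + \<omega> (j, e)\<close> vanishes.
\<close>

lemma plane_rotation_pivot:
  assumes "c \<in> C" "e \<notin> C" "j \<le> d" "\<omega> (d, e) \<noteq> 0" "j < d"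
  defines "r \<equiv> tail_norm d j e \<omega>"
  defines "s \<equiv> \<omega> (j, c) + (\<Sum>k = Suc j..d. \<omega> (k, e) * \<omega> (k, c)) / (r + \<omega> (j, e))"
  shows "\<And>k. k \<in> {Suc j..d} \<Longrightarrow> plane_rotation d j C e \<omega> (k, c) = \<omega> (k, c) - \<omega> (k, e) / r * s"
    and "r * plane_rotation d j C e \<omega> (j, c) = (\<Sum>k = j..d. \<omega> (k, e) * \<omega> (k, c))"
    and "0 < r" and "0 < r + \<omega> (j, e)" and "r\<^sup>2 = (\<omega> (j, e))\<^sup>2 + (\<Sum>k = Suc j..d. (\<omega> (k, e))\<^sup>2)"
proof -
  define X where "X = (\<Sum>k = Suc j..d. \<omega> (k, e) * \<omega> (k, c))"
  define b where "b = \<omega> (j, e)"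
  define B where "B = (\<Sum>k = Suc j..d. (\<omega> (k, e))\<^sup>2)"
  have B: "0 < B" unfolding B_def using assms by (intro sum_pos2[of _ d]) auto
  have r2: "r\<^sup>2 = b\<^sup>2 + B"
    unfolding r_def tail_norm_def b_def B_def using assms(3)
    by (subst real_sqrt_pow2) (auto simp: sum.atLeast_Suc_atMost intro!: sum_nonneg add_nonneg_nonneg)
  then show "r\<^sup>2 = (\<omega> (j, e))\<^sup>2 + (\<Sum>k = Suc j..d. (\<omega> (k, e))\<^sup>2)" by (simp add: b_def B_def)
  have "r \<ge> 0" unfolding r_def tail_norm_def by (simp add: sum_nonneg)
  have "\<bar>b\<bar> < r" using r2 B \<open>r \<ge> 0\<close> by (intro power2_less_imp_less[of "\<bar>b\<bar>"]) auto
  then have rp: "0 < r" "0 < r + b" by auto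
  then show "0 < r" "0 < r + \<omega> (j, e)" by (auto simp: b_def)
  have tn1: "tail_norm d j e (pivot_shear d j C e \<omega>) = r"
    unfolding r_def using assms by (intro tail_norm_cong) (auto simp: pivot_shear_def block_affine_def)
  have tn2: "tail_norm d j e (tail_shear d j C e (pivot_shear d j C e \<omega>)) = r"
    unfolding tn1[symmetric] using assms by (intro tail_norm_cong) (auto simp: tail_shear_def block_affine_def)
  have p1: "pivot_shear d j C e \<omega> (j, c) = s" "\<And>k. k \<noteq> j \<Longrightarrow> pivot_shear d j C e \<omega> (k, c) = \<omega> (k, c)"
     "\<And>k. pivot_shear d j C e \<omega> (k, e) = \<omega> (k, e)"
    using assms by (auto simp: pivot_shear_def block_affine_def)
  define \<omega>2 where "\<omega>2 = tail_shear d j C e (pivot_shear d j C e \<omega>)"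
  have p2: "\<omega>2 (j, c) = s" "\<And>k. k \<in> {Suc j..d} \<Longrightarrow> \<omega>2 (k, c) = \<omega> (k, c) - \<omega> (k, e) / r * s"
     "\<And>k. \<omega>2 (k, e) = \<omega> (k, e)"
    using assms(1,2) p1 tn1 by (auto simp: tail_shear_def block_affine_def \<omega>2_def)
  have p3: "plane_rotation d j C e \<omega> (k, c) = \<omega>2 (k, c)" if "k \<noteq> j" for k
    using that by (auto simp: plane_rotation_def \<omega>2_def pivot_shear_def block_affine_def)
  show "\<And>k. k \<in> {Suc j..d} \<Longrightarrow> plane_rotation d j C e \<omega> (k, c) = \<omega> (k, c) - \<omega> (k, e) / r * s"
    by (subst p3) (auto simp: p2)
  have "(\<Sum>k = Suc j..d. \<omega>2 (k, e) * \<omega>2 (k, c)) = (\<Sum>k = Suc j..d. \<omega> (k, e) * \<omega> (k, c) - (\<omega> (k, e))\<^sup>2 * (s / r))"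
    by (intro sum.cong) (auto simp: p2 power2_eq_square algebra_simps)
  also have "\<dots> = X - B * (s / r)"
    by (simp only: sum_subtractf X_def B_def sum_distrib_right)
  finally have X': "(\<Sum>k = Suc j..d. \<omega>2 (k, e) * \<omega>2 (k, c)) = X - B * (s / r)" .
  have tn2': "tail_norm d j e \<omega>2 = r" using tn2 by (simp add: \<omega>2_def)
  have "plane_rotation d j C e \<omega> (j, c) = \<omega>2 (j, c) + (\<Sum>k = Suc j..d. \<omega>2 (k, e) * \<omega>2 (k, c)) / (tail_norm d j e \<omega>2 + \<omega>2 (j, e))"
    using assms(1) by (simp add: plane_rotation_def \<omega>2_def pivot_shear_def block_affine_def)
  also have "\<dots> = s + (X - B * (s / r)) / (r + b)"
    using X' by (simp add: p2 tn2' b_def)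
  finally have rj: "plane_rotation d j C e \<omega> (j, c) = s + (X - B * (s / r)) / (r + b)" .
  have s: "s = \<omega> (j, c) + X / (r + b)" by (simp add: s_def X_def b_def)
  have "r * (s + (X - B * (s / r)) / (r + b)) = b * \<omega> (j, c) + X"
  proof -
    have "B = (r - b) * (r + b)" using r2 by (simp add: power2_eq_square algebra_simps)
    then have "(X - B * (s / r)) / (r + b) = X / (r + b) - (r - b) * (s / r)"
      using rp by (simp add: diff_divide_distrib)
    then have "r * (s + (X - B * (s / r)) / (r + b)) = r * s + r * X / (r + b) - (r - b) * s"
      using rp by (simp add: distrib_left right_diff_distrib)
    also have "\<dots> = b * s + r * X / (r + b)" by (simp add: algebra_simps)
    also have "\<dots> = b * \<omega> (j, c) + (b + r) * X / (r + b)"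
      by (simp add: s distrib_left distrib_right add_divide_distrib)
    finally show ?thesis using rp by (simp add: add.commute)
  qed
  then show "r * plane_rotation d j C e \<omega> (j, c) = (\<Sum>k = j..d. \<omega> (k, e) * \<omega> (k, c))"
    using assms(3) rj by (simp add: sum.atLeast_Suc_atMost X_def b_def)
qed

text \<open>
  Orthogonality of the rotation. Splitting off the rows below the pivot reduces it to a rational
  identity between the two pivot entries, the inner products with the tail of column \<open>e\<close>, and the
  squared length of this tail, which is \<open>(r - b) (r + b)\<close>.
\<close>

lemma plane_rotation_inner:
  assumes c: "c \<in> C" "c' \<in> C" and h: "e \<notin> C" "1 \<le> j" "j < d" "\<omega> (d, e) \<noteq> 0"
  shows "(\<Sum>k = 1..d. plane_rotation d j C e \<omega> (k, c) * plane_rotation d j C e \<omega> (k, c')) = (\<Sum>k = 1..d. \<omega> (k, c) * \<omega> (k, c'))"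
proof -
  define r where "r = tail_norm d j e \<omega>"
  define b where "b = \<omega> (j, e)"
  define X where "X = (\<Sum>k = Suc j..d. \<omega> (k, e) * \<omega> (k, c))"
  define X' where "X' = (\<Sum>k = Suc j..d. \<omega> (k, e) * \<omega> (k, c'))"
  define B where "B = (\<Sum>k = Suc j..d. (\<omega> (k, e))\<^sup>2)"
  define x where "x = \<omega> (j, c)"
  define x' where "x' = \<omega> (j, c')"
  define s where "s = x + X / (r + b)"
  define s' where "s' = x' + X' / (r + b)"
  have jd: "j \<le> d" using h by simp
  note f = plane_rotation_pivot[where \<omega> = \<omega>, OF c(1) h(1) jd h(4) h(3), folded r_def, folded b_def X_def x_def B_def, folded s_def]
  note f' = plane_rotation_pivot[where \<omega> = \<omega>, OF c(2) h(1) jd h(4) h(3), folded r_def, folded b_def X'_def x'_def B_def, folded s'_def]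
  have split: "(\<Sum>k = 1..d. g k) = (\<Sum>k = 1..<j. g k) + g j + (\<Sum>k = Suc j..d. g k)" for g :: "nat \<Rightarrow> real"
  proof -
    have "{1..d} = {1..<j} \<union> {j} \<union> {Suc j..d}" using h by auto
    then have "sum g {1..d} = sum g ({1..<j} \<union> {j}) + sum g {Suc j..d}"
      by (simp only:) (subst sum.union_disjoint, auto)
    then show ?thesis by (simp add: sum.union_disjoint)
  qed
  have rp: "r > 0" "r + b > 0" and r2: "r\<^sup>2 = b\<^sup>2 + B" using f by auto
  have B: "B = (r - b) * (r + b)" using r2 by (simp add: power2_eq_square algebra_simps)
  have y: "plane_rotation d j C e \<omega> (j, c) = (b * x + X) / r"
    using f(2) rp jd by (simp add: field_simps sum.atLeast_Suc_atMost X_def x_def b_def)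
  have y': "plane_rotation d j C e \<omega> (j, c') = (b * x' + X') / r"
    using f'(2) rp jd by (simp add: field_simps sum.atLeast_Suc_atMost X'_def x'_def b_def)
  have "(\<Sum>k = Suc j..d. plane_rotation d j C e \<omega> (k, c) * plane_rotation d j C e \<omega> (k, c'))
      = (\<Sum>k = Suc j..d. \<omega> (k, c) * \<omega> (k, c') - \<omega> (k, e) * \<omega> (k, c) * (s' / r) - \<omega> (k, e) * \<omega> (k, c') * (s / r)
           + (\<omega> (k, e))\<^sup>2 * (s * s' / r\<^sup>2))"
    by (intro sum.cong) (auto simp: f f' power2_eq_square algebra_simps)
  also have "\<dots> = (\<Sum>k = Suc j..d. \<omega> (k, c) * \<omega> (k, c')) - X * (s' / r) - X' * (s / r) + B * (s * s' / r\<^sup>2)"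
    by (simp only: sum.distrib sum_subtractf X_def X'_def B_def sum_distrib_right)
  finally have tail: "(\<Sum>k = Suc j..d. plane_rotation d j C e \<omega> (k, c) * plane_rotation d j C e \<omega> (k, c')) = \<dots>" .
  have scal: "(b * x + X) / r * ((b * x' + X') / r) - X * (s' / r) - X' * (s / r) + B * (s * s' / r\<^sup>2) = x * x'"
  proof -
    define u where "u = r + b"
    have u: "u > 0" "b = u - r" using rp by (auto simp: u_def)
    have X: "X = (s - x) * u" "X' = (s' - x') * u" using u by (auto simp: s_def s'_def u_def[symmetric])
    have B': "B = (2 * r - u) * u" using B u by simp
    show ?thesis unfolding X B' u(2) using rp(1) by (simp add: field_simps power2_eq_square)
  qed
  have head: "(\<Sum>k = 1..<j. plane_rotation d j C e \<omega> (k, c) * plane_rotation d j C e \<omega> (k, c')) = (\<Sum>k = 1..<j. \<omega> (k, c) * \<omega> (k, c'))"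
    using jd by (intro sum.cong) (auto simp: plane_rotation_other)
  show ?thesis unfolding split tail y y' head using scal by (simp add: x_def x'_def)
qed

text \<open>
  The rotation is determined by column \<open>n + j\<close> and acts on the columns that are independent of it and
  still needed: those of \<open>A\<close> and the later columns of \<open>B\<close>. Their inner products are preserved, the
  rows above \<open>j\<close> are not touched, and column \<open>j\<close> of the block becomes triangular.
\<close>

lemma bartlett_step:
  assumes j: "1 \<le> j" "j \<le> m" "j < d" and [measurable]: "F \<in> borel_measurable (fun_space ({1..n} \<times> {1..m}))"
  shows "(\<integral>\<^sup>+\<omega>. F (restrict (bartlett n d (j - 1) \<omega>) ({1..n} \<times> {1..m})) \<partial>gauss ({1..d} \<times> {1..n+m}))
       = (\<integral>\<^sup>+\<omega>. F (restrict (bartlett n d j \<omega>) ({1..n} \<times> {1..m})) \<partial>gauss ({1..d} \<times> {1..n+m}))"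
proof -
  define I where "I = {1..d} \<times> {1..n+m}"
  define K where "K = {1..n} \<times> {1..m}"
  define C where "C = {1..n} \<union> {n+j+1..n+m}"
  define e where "e = n + j"
  have I: "finite I" "{j..d} \<times> C \<subseteq> I" "e \<notin> C" "(d, e) \<in> I" using j by (auto simp: I_def C_def e_def)
  have J: "jacobian I (plane_rotation d j C e) (\<lambda>_. 1)" using I j by (intro jacobian_plane_rotation) auto
  have norm: "sq_norm I (plane_rotation d j C e \<omega>) = sq_norm I \<omega>" if nz: "\<omega> (d, e) \<noteq> 0" for \<omega>
  proof -
    have s: "sq_norm I \<omega>' = (\<Sum>c = 1..n+m. \<Sum>k = 1..d. \<omega>' (k, c) * \<omega>' (k, c))" for \<omega>' :: "nat \<times> nat \<Rightarrow> real"
      unfolding sq_norm_def I_def power2_eq_square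
      by (subst sum.swap) (simp add: sum.cartesian_product case_prod_beta)
    have "(\<Sum>k = 1..d. plane_rotation d j C e \<omega> (k, c) * plane_rotation d j C e \<omega> (k, c)) = (\<Sum>k = 1..d. \<omega> (k, c) * \<omega> (k, c))" for c
    proof (cases "c \<in> C")
      case True
      show ?thesis by (rule plane_rotation_inner) (use True I j nz in auto)
    next
      case False
      then show ?thesis using j by (intro sum.cong) (auto simp: plane_rotation_other)
    qed
    then show ?thesis unfolding s by simp
  qed
  have bart: "restrict (bartlett n d j (plane_rotation d j C e \<omega>)) K = restrict (bartlett n d (j - 1) \<omega>) K"
    if nz: "\<omega> (d, e) \<noteq> 0" for \<omega>
  proof (rule restrict_ext)
    fix p assume p: "p \<in> K"
    obtain i q where [simp]: "p = (i, q)" by (cases p)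
    have iq: "1 \<le> i" "i \<le> n" "1 \<le> q" "q \<le> m" using p by (auto simp: K_def)
    have iC: "i \<in> C" using iq by (auto simp: C_def)
    have row: "plane_rotation d j C e \<omega> (l, c) = \<omega> (l, c)" if "l < j" for l c
      using that j by (auto simp: plane_rotation_other)
    consider "q < j" | "q = j" | "j < q" by linarith
    then show "bartlett n d j (plane_rotation d j C e \<omega>) p = bartlett n d (j - 1) \<omega> p"
    proof cases
      case 1
      have "tail_norm d q (n + q) (plane_rotation d j C e \<omega>) = tail_norm d q (n + q) \<omega>"
        using 1 j iq by (intro tail_norm_cong plane_rotation_other) (auto simp: C_def)
      then show ?thesis using 1 row by (auto simp: bartlett_def)
    next
      case 2
      have tn: "tail_norm d j e (plane_rotation d j C e \<omega>) = tail_norm d j e \<omega>"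
        using I j by (intro tail_norm_cong plane_rotation_other) auto
      have "bartlett n d j (plane_rotation d j C e \<omega>) p =
         (\<Sum>l = 1..<j. \<omega> (l, i) * \<omega> (l, e)) + tail_norm d j e \<omega> * plane_rotation d j C e \<omega> (j, i)"
        using 2 row tn by (simp add: bartlett_def e_def)
      also have "tail_norm d j e \<omega> * plane_rotation d j C e \<omega> (j, i) = (\<Sum>k = j..d. \<omega> (k, i) * \<omega> (k, e))"
        using plane_rotation_pivot(2)[where \<omega> = \<omega>, OF iC I(3) _ nz j(3)] j(3) by (simp add: mult.commute)
      also have "(\<Sum>l = 1..<j. \<omega> (l, i) * \<omega> (l, e)) + \<dots> = (\<Sum>k = 1..d. \<omega> (k, i) * \<omega> (k, e))"
      proof -
        have "{1..d} = {1..<j} \<union> {j..d}" using j by auto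
        then show ?thesis by (simp only:) (subst sum.union_disjoint, auto)
      qed
      finally show ?thesis using 2 j by (simp add: bartlett_def e_def)
    next
      case 3
      have "n + q \<in> C" using 3 iq by (auto simp: C_def)
      then show ?thesis using 3 plane_rotation_inner[where \<omega> = \<omega>, OF iC _ I(3) j(1,3) nz] by (simp add: bartlett_def)
    qed
  qed
  have AE: "AE \<omega> in gauss I. \<omega> (d, e) \<noteq> 0" by (rule gauss_AE_nonzero[OF I(4)])
  have "(\<integral>\<^sup>+\<omega>. F (restrict (bartlett n d j \<omega>) K) \<partial>gauss I)
     = (\<integral>\<^sup>+\<omega>. F (restrict (bartlett n d j (plane_rotation d j C e \<omega>)) K) *
          ennreal (1 * exp (- (sq_norm I (plane_rotation d j C e \<omega>) - sq_norm I \<omega>) / 2)) \<partial>gauss I)"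
    by (rule gauss_transform[OF I(1) J, symmetric])
      (rule measurable_compose[OF restrict_bartlett_measurable assms(4)[folded K_def]])
  also have "\<dots> = (\<integral>\<^sup>+\<omega>. F (restrict (bartlett n d (j - 1) \<omega>) K) \<partial>gauss I)"
    using AE by (intro nn_integral_cong_AE) (auto elim!: AE_mp simp: norm bart)
  finally show ?thesis by (simp add: K_def I_def)
qed

theorem bartlett_decomposition:
  assumes "J \<le> m" "m < d" "F \<in> borel_measurable (fun_space ({1..n} \<times> {1..m}))"
  shows "(\<integral>\<^sup>+\<omega>. F (restrict (bartlett n d 0 \<omega>) ({1..n} \<times> {1..m})) \<partial>gauss ({1..d} \<times> {1..n+m}))
       = (\<integral>\<^sup>+\<omega>. F (restrict (bartlett n d J \<omega>) ({1..n} \<times> {1..m})) \<partial>gauss ({1..d} \<times> {1..n+m}))"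
  using assms(1)
proof (induction J)
  case (Suc J)
  from Suc.prems assms(2) have "J \<le> m" "1 \<le> Suc J" "Suc J \<le> m" "Suc J < d" by auto
  from Suc.IH[OF this(1)] bartlett_step[OF this(2-4) assms(3)] show ?case by (simp only: diff_Suc_1)
qed (rule refl)

section \<open>A change of measure that decouples the block\<close>

text \<open>
  The length of the tail of \<open>b\<^sub>j\<close> in units of \<open>sqrt d\<close>. The value 1 on the null set where the tail
  vanishes makes \<open>scale\<close> positive everywhere, as required of the coefficient of an affine move.
\<close>

definition scale :: "nat \<Rightarrow> nat \<Rightarrow> nat \<Rightarrow> (nat \<times> nat \<Rightarrow> real) \<Rightarrow> real" where
  "scale n d j \<omega> = (if tail_norm d j (n + j) \<omega> = 0 then 1 else tail_norm d j (n + j) \<omega> / sqrt (real d))"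

text \<open>
  An entry of the block in triangular form. Given the rows \<open>l < j\<close> of \<open>A\<close>, column \<open>j\<close> is a scaled
  Gaussian vector plus a random Gaussian combination of these rows.
\<close>

definition entry :: "nat \<Rightarrow> nat \<Rightarrow> nat \<Rightarrow> nat \<Rightarrow> (nat \<times> nat \<Rightarrow> real) \<Rightarrow> real" where
  "entry n d i j \<omega> = scale n d j \<omega> * \<omega> (j, i) + (\<Sum>l = 1..<j. \<omega> (l, i) / sqrt (real d) * \<omega> (l, n + j))"

text \<open>
  What remains of the coefficient of row \<open>l\<close> after subtracting its first-order prediction from column
  \<open>j\<close> of the block. Given the rows and the column, the coefficients are Gaussian with mean close to
  this prediction and covariance close to the identity. Treating the residuals as standard Gaussian
  is therefore accurate enough to make the leading error terms cancel.
\<close>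

definition residual :: "nat \<Rightarrow> nat \<Rightarrow> nat \<Rightarrow> nat \<Rightarrow> (nat \<times> nat \<Rightarrow> real) \<Rightarrow> real" where
  "residual n d l j \<omega> = \<omega> (l, n + j) - (\<Sum>i = 1..n. \<omega> (l, i) * entry n d i j \<omega>) / sqrt (real d)"

definition to_independent :: "nat \<Rightarrow> nat \<Rightarrow> nat \<Rightarrow> (nat \<times> nat \<Rightarrow> real) \<Rightarrow> nat \<times> nat \<Rightarrow> real" where
  "to_independent n d J \<omega> p =
     (if snd p \<in> {1..n} \<and> fst p \<in> {1..J} then entry n d (snd p) (fst p) \<omega>
      else if snd p \<in> {n+1..n+J} \<and> fst p \<in> {1..<snd p - n} then residual n d (fst p) (snd p - n) \<omega>
      else \<omega> p)"

lemma scale_measurable [measurable]: "scale n d j \<in> borel_measurable (fun_space I)"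
  unfolding scale_def by measurable

lemma entry_measurable [measurable]: "entry n d i j \<in> borel_measurable (fun_space I)"
  unfolding entry_def by measurable

lemma residual_measurable [measurable]: "residual n d l j \<in> borel_measurable (fun_space I)"
  unfolding residual_def by measurable

lemma scale_pos: "1 \<le> d \<Longrightarrow> 0 < scale n d j \<omega>"
  unfolding scale_def tail_norm_def by (auto simp: sum_nonneg intro!: divide_pos_pos order.not_eq_order_implies_strict)

definition scale_move :: "nat \<Rightarrow> nat \<Rightarrow> nat \<Rightarrow> (nat \<times> nat \<Rightarrow> real) \<Rightarrow> nat \<times> nat \<Rightarrow> real" where
  "scale_move n d j = block_affine ({j} \<times> {1..n}) (\<lambda>_. scale n d j)
     (\<lambda>p \<omega>. \<Sum>l = 1..<j. \<omega> (l, snd p) / sqrt (real d) * \<omega> (l, n + j))"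

definition shift_move :: "nat \<Rightarrow> nat \<Rightarrow> nat \<Rightarrow> (nat \<times> nat \<Rightarrow> real) \<Rightarrow> nat \<times> nat \<Rightarrow> real" where
  "shift_move n d j = block_affine ({1..<j} \<times> {n + j}) (\<lambda>_ _. 1)
     (\<lambda>p \<omega>. - (\<Sum>i = 1..n. \<omega> (fst p, i) * \<omega> (j, i)) / sqrt (real d))"

lemma scale_cong: "(\<And>k. k \<in> {j..d} \<Longrightarrow> \<omega> (k, n + j) = \<omega>' (k, n + j)) \<Longrightarrow> scale n d j \<omega> = scale n d j \<omega>'"
  unfolding scale_def using tail_norm_cong[of j d \<omega> "n + j" \<omega>'] by simp

lemma jacobian_moves:
  fixes n m d j :: nat
  assumes "1 \<le> j" "j \<le> m" "m \<le> d"
  defines "I \<equiv> {1..d} \<times> {1..n+m}"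
  shows "jacobian I (\<lambda>\<omega>. shift_move n d j (scale_move n d j \<omega>)) (\<lambda>\<omega>. scale n d j \<omega> ^ n)"
proof -
  have d: "1 \<le> d" using assms by simp
  have "jacobian I (scale_move n d j) (\<lambda>\<omega>. \<Prod>p\<in>{j} \<times> {1..n}. \<bar>scale n d j \<omega>\<bar>)"
    unfolding scale_move_def
  proof (rule jacobian_block_affine)
    fix p assume "p \<in> {j} \<times> {1..n}"
    show "free_of ({j} \<times> {1..n}) (scale n d j)"
      using assms unfolding free_of_def by (intro allI impI scale_cong) auto
    show "free_of ({j} \<times> {1..n}) (\<lambda>\<omega>. \<Sum>l = 1..<j. \<omega> (l, snd p) / sqrt (real d) * \<omega> (l, n + j))"
      unfolding free_of_def by (intro allI impI sum.cong) auto
  next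
    fix \<omega> show "scale n d j \<omega> \<noteq> 0" using scale_pos[OF d, of n j \<omega>] by simp
  qed (use assms in auto)
  then have 1: "jacobian I (scale_move n d j) (\<lambda>\<omega>. scale n d j \<omega> ^ n)"
    by (rule jacobian_cong) (auto simp: card_cartesian_product scale_pos[OF d] less_imp_le)
  have "jacobian I (shift_move n d j) (\<lambda>\<omega>. \<Prod>p\<in>{1..<j} \<times> {n + j}. \<bar>1\<bar>)"
    unfolding shift_move_def
  proof (rule jacobian_block_affine)
    fix p assume "p \<in> {1..<j} \<times> {n + j}"
    show "free_of ({1..<j} \<times> {n + j}) (\<lambda>\<omega>. - (\<Sum>i = 1..n. \<omega> (fst p, i) * \<omega> (j, i)) / sqrt (real d))"
      unfolding free_of_def by (intro allI impI arg_cong2[where f = "(/)"] arg_cong[where f = uminus] sum.cong) auto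
  qed (use assms in \<open>auto simp: free_of_def\<close>)
  then have 2: "jacobian I (shift_move n d j) (\<lambda>_. 1)" by simp
  from jacobian_comp[OF 2 1] show ?thesis by simp
qed

lemma entry_cong:
  assumes "scale n d j \<omega> = scale n d j \<omega>'" "\<And>l. l \<in> {1..j} \<Longrightarrow> \<omega> (l, i) = \<omega>' (l, i)"
    "\<And>l. l \<in> {1..<j} \<Longrightarrow> \<omega> (l, n + j) = \<omega>' (l, n + j)" "1 \<le> j"
  shows "entry n d i j \<omega> = entry n d i j \<omega>'"
  unfolding entry_def using assms by (intro arg_cong2[where f = "(+)"] sum.cong) auto

text \<open>
  Column \<open>J\<close> is moved before the columns with smaller index, because its move reads the rows
  \<open>l < J\<close> of \<open>A\<close> in their original state. The later moves read nothing that it has changed.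
\<close>

lemma jacobian_to_independent:
  fixes n m d J :: nat
  assumes "J \<le> m" "m \<le> d"
  defines "I \<equiv> {1..d} \<times> {1..n+m}"
  shows "jacobian I (to_independent n d J) (\<lambda>\<omega>. \<Prod>j = 1..J. scale n d j \<omega> ^ n)"
  using assms(1)
proof (induction J)
  case 0
  show ?case by (rule jacobian_cong[OF jacobian_id]) (auto simp: to_independent_def fun_eq_iff)
next
  case (Suc J)
  define j where "j = Suc J"
  have j: "1 \<le> j" "j \<le> m" "J < j" using Suc.prems by (auto simp: j_def)
  let ?T = "\<lambda>\<omega>. shift_move n d j (scale_move n d j \<omega>)"
  have other: "?T \<omega> (k, c) = \<omega> (k, c)" if "\<not> (k = j \<and> 1 \<le> c \<and> c \<le> n)" "\<not> (c = n + j \<and> 1 \<le> k \<and> k < j)" for \<omega> k c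
    using that by (auto simp: shift_move_def scale_move_def block_affine_def)
  have sc: "scale n d l (?T \<omega>) = scale n d l \<omega>" if "1 \<le> l" for l \<omega>
    using j that by (intro scale_cong other) auto
  have row: "scale_move n d j \<omega> (j, i) = entry n d i j \<omega>" if "i \<in> {1..n}" for \<omega> i
    using that by (simp add: scale_move_def block_affine_def entry_def)
  have row': "?T \<omega> (j, i) = entry n d i j \<omega>" if "i \<in> {1..n}" for \<omega> i
  proof -
    have "?T \<omega> (j, i) = scale_move n d j \<omega> (j, i)" using that by (auto simp: shift_move_def block_affine_def)
    then show ?thesis using row[OF that] by simp
  qed
  have col: "?T \<omega> (l, n + j) = residual n d l j \<omega>" if "l \<in> {1..<j}" for \<omega> l
  proof -
    have "?T \<omega> (l, n + j) = scale_move n d j \<omega> (l, n + j)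
        - (\<Sum>i = 1..n. scale_move n d j \<omega> (l, i) * scale_move n d j \<omega> (j, i)) / sqrt (real d)"
      using that by (simp add: shift_move_def block_affine_def)
    also have "scale_move n d j \<omega> (l, n + j) = \<omega> (l, n + j)"
      using that by (simp add: scale_move_def block_affine_def)
    also have "(\<Sum>i = 1..n. scale_move n d j \<omega> (l, i) * scale_move n d j \<omega> (j, i))
        = (\<Sum>i = 1..n. \<omega> (l, i) * entry n d i j \<omega>)"
      using that row by (intro sum.cong) (auto simp: scale_move_def block_affine_def)
    finally show ?thesis by (simp add: residual_def)
  qed
  have ent: "entry n d i l (?T \<omega>) = entry n d i l \<omega>" if "l \<in> {1..J}" "i \<le> n" for i l \<omega>
    using that j by (intro entry_cong sc other) auto
  have res: "residual n d k l (?T \<omega>) = residual n d k l \<omega>" if "l \<in> {1..J}" "k < l" for k l \<omega>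
  proof -
    have "(\<Sum>i = 1..n. ?T \<omega> (k, i) * entry n d i l (?T \<omega>)) = (\<Sum>i = 1..n. \<omega> (k, i) * entry n d i l \<omega>)"
      using that j by (intro sum.cong refl arg_cong2[where f = "(*)"] ent other) auto
    moreover have "?T \<omega> (k, n + l) = \<omega> (k, n + l)" using that j by (intro other) auto
    ultimately show ?thesis unfolding residual_def by simp
  qed
  show ?case
  proof (rule jacobian_cong[OF jacobian_comp[OF Suc.IH]])
    show "J \<le> m" using Suc.prems by simp
    show "jacobian I ?T (\<lambda>\<omega>. scale n d j \<omega> ^ n)"
      unfolding I_def using j assms by (intro jacobian_moves) auto
    fix \<omega>
    show "to_independent n d J (?T \<omega>) = to_independent n d (Suc J) \<omega>"
    proof
      fix p :: "nat \<times> nat"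
      obtain k c where [simp]: "p = (k, c)" by (cases p)
      consider "c \<in> {1..n}" "k \<in> {1..J}" | "c \<in> {1..n}" "k = j"
        | "c \<in> {n+1..n+J}" "k \<in> {1..<c-n}" | "c = n + j" "k \<in> {1..<j}"
        | "\<not> (c \<in> {1..n} \<and> k \<in> {1..Suc J})" "\<not> (c \<in> {n+1..n+Suc J} \<and> k \<in> {1..<c-n})"
      proof -
        have "k \<in> {1..Suc J} \<longleftrightarrow> k \<in> {1..J} \<or> k = j" by (auto simp: j_def)
        moreover have "c \<in> {n+1..n+Suc J} \<longleftrightarrow> c \<in> {n+1..n+J} \<or> c = n + j" by (auto simp: j_def)
        ultimately show ?thesis using that by (cases "c = n + j") auto
      qed
      then show "to_independent n d J (?T \<omega>) p = to_independent n d (Suc J) \<omega> p"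
      proof cases
        case 1 then show ?thesis by (simp add: to_independent_def ent)
      next
        case 2 then show ?thesis using row'[of c \<omega>] by (simp add: to_independent_def j_def)
      next
        case 3
        then have "residual n d k (c - n) (?T \<omega>) = residual n d k (c - n) \<omega>" by (intro res) auto
        with 3 show ?thesis by (simp add: to_independent_def)
      next
        case 4 then show ?thesis using col[of k \<omega>] by (simp add: to_independent_def j_def)
      next
        case 5
        then have "?T \<omega> (k, c) = \<omega> (k, c)" by (intro other) (auto simp: j_def)
        with 5 show ?thesis by (auto simp: to_independent_def)
      qed
    qed
    show "(\<Prod>l = 1..J. scale n d l (?T \<omega>) ^ n) * scale n d j \<omega> ^ n = (\<Prod>l = 1..Suc J. scale n d l \<omega> ^ n)"
    proof -
      have "(\<Prod>l = 1..J. scale n d l (?T \<omega>) ^ n) = (\<Prod>l = 1..J. scale n d l \<omega> ^ n)"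
        by (intro prod.cong) (auto simp: sc)
      then show ?thesis by (simp add: j_def)
    qed
  qed
qed

text \<open>
  The density, relative to the Gaussian measure, of the measure that \<open>to_independent\<close> maps to the
  Gaussian measure.
\<close>

definition likelihood :: "nat \<Rightarrow> nat \<Rightarrow> nat \<Rightarrow> (nat \<times> nat \<Rightarrow> real) \<Rightarrow> real" where
  "likelihood n m d \<omega> = (\<Prod>j = 1..m. scale n d j \<omega> ^ n) *
     exp (- (sq_norm ({1..d} \<times> {1..n+m}) (to_independent n d m \<omega>) - sq_norm ({1..d} \<times> {1..n+m}) \<omega>) / 2)"

lemma to_independent_measurable:
  assumes "J \<le> m" "m \<le> d"
  shows "to_independent n d J \<in> measurable (fun_space ({1..d} \<times> {1..n+m})) (fun_space ({1..d} \<times> {1..n+m}))"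
  using jacobian_to_independent[OF assms] unfolding jacobian_def by blast

lemma likelihood_measurable [measurable]:
  assumes "m \<le> d"
  shows "likelihood n m d \<in> borel_measurable (fun_space ({1..d} \<times> {1..n+m}))"
proof -
  note to_independent_measurable[OF order_refl assms, measurable]
  show ?thesis unfolding likelihood_def by measurable
qed

text \<open>
  Reweighted by \<open>likelihood\<close>, the variables \<open>to_independent\<close> are independent standard Gaussians; among
  them are the entries of the block. The weight makes the triangular block exactly equal in law to
  a Gaussian matrix, and only the size of the weight has to be controlled.
\<close>

theorem likelihood_change_of_measure:
  assumes "m \<le> d" and F: "F \<in> borel_measurable (fun_space ({1..n} \<times> {1..m}))"
  shows "(\<integral>\<^sup>+\<omega>. F (\<lambda>p\<in>{1..n} \<times> {1..m}. entry n d (fst p) (snd p) \<omega>) * ennreal (likelihood n m d \<omega>)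
            \<partial>gauss ({1..d} \<times> {1..n+m}))
       = (\<integral>\<^sup>+\<omega>. F (\<lambda>p\<in>{1..n} \<times> {1..m}. \<omega> (snd p, fst p)) \<partial>gauss ({1..d} \<times> {1..n+m}))"
proof -
  define I where "I = {1..d} \<times> {1..n+m}"
  define K where "K = {1..n} \<times> {1..m}"
  let ?G = "\<lambda>\<omega> :: nat \<times> nat \<Rightarrow> real. F (\<lambda>p\<in>K. \<omega> (snd p, fst p))"
  have "(\<lambda>\<omega>. \<lambda>p\<in>K. \<omega> (snd p, fst p)) \<in> measurable (fun_space I) (fun_space K)"
    by (intro measurable_restrict borel_measurable_coordinate)
  then have G: "?G \<in> borel_measurable (fun_space I)"
    using F unfolding K_def by (rule measurable_compose)
  have "(\<lambda>p\<in>K. to_independent n d m \<omega> (snd p, fst p)) = (\<lambda>p\<in>K. entry n d (fst p) (snd p) \<omega>)" for \<omega>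
    by (intro restrict_ext) (auto simp: to_independent_def K_def)
  then show ?thesis
    using gauss_transform[OF _ jacobian_to_independent[OF order_refl assms(1), of n] G[unfolded I_def]]
    by (simp only: likelihood_def K_def) simp
qed

section \<open>Moments of Gaussian product measures\<close>

lemma std_normal_quadratic:
  fixes r c s :: real
  assumes "0 \<le> s"
  shows "(\<integral>\<^sup>+y. ennreal ((r + c * y)\<^sup>2 + s) \<partial>std_normal_distribution) = ennreal (r\<^sup>2 + c\<^sup>2 + s)"
proof -
  have m0: "has_bochner_integral lborel std_normal_density 1" using std_normal_moment_even[of 0] by simp
  have m1: "has_bochner_integral lborel (\<lambda>y. std_normal_density y * y) 0" using std_normal_moment_odd[of 0] by simp
  have m2: "has_bochner_integral lborel (\<lambda>y. std_normal_density y * y\<^sup>2) 1" using std_normal_moment_even[of 1] by simp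
  have "has_bochner_integral lborel (\<lambda>y. (r\<^sup>2 + s) * std_normal_density y + 2 * r * c * (std_normal_density y * y)
          + c\<^sup>2 * (std_normal_density y * y\<^sup>2)) ((r\<^sup>2 + s) * 1 + 2 * r * c * 0 + c\<^sup>2 * 1)"
    by (intro has_bochner_integral_add has_bochner_integral_mult_right m0 m1 m2)
  moreover have "(\<lambda>y. (r\<^sup>2 + s) * std_normal_density y + 2 * r * c * (std_normal_density y * y)
          + c\<^sup>2 * (std_normal_density y * y\<^sup>2)) = (\<lambda>y. std_normal_density y * ((r + c * y)\<^sup>2 + s))"
    by (rule ext) (simp add: power2_eq_square algebra_simps)
  ultimately have b: "has_bochner_integral lborel (\<lambda>y. std_normal_density y * ((r + c * y)\<^sup>2 + s)) (r\<^sup>2 + c\<^sup>2 + s)"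
    by (simp add: algebra_simps)
  have "(\<integral>\<^sup>+y. ennreal ((r + c * y)\<^sup>2 + s) \<partial>std_normal_distribution)
      = (\<integral>\<^sup>+y. ennreal (std_normal_density y * ((r + c * y)\<^sup>2 + s)) \<partial>lborel)"
    using assms by (subst nn_integral_density) (auto simp: ennreal_mult)
  also have "\<dots> = ennreal (r\<^sup>2 + c\<^sup>2 + s)"
    using b assms by (subst nn_integral_eq_integral) (auto simp: has_bochner_integral_iff)
  finally show ?thesis .
qed

lemma free_of_binary: "free_of C f \<Longrightarrow> free_of C g \<Longrightarrow> free_of C (\<lambda>\<omega>. h (f \<omega>) (g \<omega>))"
  unfolding free_of_def by metis

lemma emeasure_std_normal_UNIV [simp]: "emeasure std_normal_distribution UNIV = 1"
  using prob_space.emeasure_space_1[OF prob_space_normal_density, of 1 0] by simp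

lemma gauss_integrate_out:
  assumes "finite I" "q \<in> I" and [measurable]: "F \<in> borel_measurable (fun_space I)"
  shows "(\<integral>\<^sup>+\<omega>. F \<omega> \<partial>gauss I) = (\<integral>\<^sup>+x. (\<integral>\<^sup>+y. F (x(q := y)) \<partial>std_normal_distribution) \<partial>gauss (I - {q}))"
proof -
  have I: "I = insert q (I - {q})" using assms by auto
  show ?thesis
    by (subst I, rule gauss.product_nn_integral_insert) (use assms in \<open>auto simp: insert_absorb\<close>)
qed

lemma nn_integral_gauss_free:
  assumes "finite I" "q \<in> I" and [measurable]: "F \<in> borel_measurable (fun_space I)" and "free_of {q} F"
  shows "(\<integral>\<^sup>+\<omega>. F \<omega> \<partial>gauss I) = (\<integral>\<^sup>+x. F x \<partial>gauss (I - {q}))"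
proof -
  have "F (x(q := y)) = F x" for x y by (rule free_ofD[OF assms(4)]) simp
  then show ?thesis
    by (simp add: gauss_integrate_out[OF assms(1-3)])
qed

text \<open>
  The coordinates in \<open>C\<close> are integrated out one at a time, and each contributes the square of its
  coefficient, which may itself be random. The summand \<open>s\<close> collects these squares in the induction.
  Nonnegative integrals avoid integrability conditions.
\<close>

lemma nn_integral_gauss_linear_sq:
  assumes "finite I" "C \<subseteq> I"
    and "\<And>p. p \<in> C \<Longrightarrow> c p \<in> borel_measurable (fun_space I)" "\<And>p. p \<in> C \<Longrightarrow> free_of C (c p)"
    and "r \<in> borel_measurable (fun_space I)" "free_of C r"
    and "s \<in> borel_measurable (fun_space I)" "free_of C s" "\<And>\<omega>. 0 \<le> s \<omega>"
  shows "(\<integral>\<^sup>+\<omega>. ennreal ((r \<omega> + (\<Sum>p\<in>C. c p \<omega> * \<omega> p))\<^sup>2 + s \<omega>) \<partial>gauss I)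
       = (\<integral>\<^sup>+\<omega>. ennreal ((r \<omega>)\<^sup>2 + (\<Sum>p\<in>C. (c p \<omega>)\<^sup>2) + s \<omega>) \<partial>gauss I)"
proof -
  have "finite C" using assms finite_subset by blast
  then show ?thesis using assms(2-)
  proof (induction C arbitrary: s)
    case empty
    show ?case by (simp only: sum.empty add_0_right)
  next
    case (insert q C)
    have cq [measurable]: "c q \<in> borel_measurable (fun_space I)" using insert.prems(2) by simp
    note [measurable] = insert.prems(4,6)
    have [measurable]: "(\<lambda>\<omega>. \<Sum>p\<in>C. c p \<omega> * \<omega> p) \<in> borel_measurable (fun_space I)"
      "(\<lambda>\<omega>. \<Sum>p\<in>C. (c p \<omega>)\<^sup>2) \<in> borel_measurable (fun_space I)"
      using insert.prems(2) by (auto intro!: borel_measurable_sum borel_measurable_times borel_measurable_power)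
    \<comment> \<open>The part of the linear form that is constant in the coordinate \<open>q\<close>.\<close>
    define R where "R = (\<lambda>\<omega>. r \<omega> + (\<Sum>p\<in>C. c p \<omega> * \<omega> p))"
    have [measurable]: "R \<in> borel_measurable (fun_space I)" unfolding R_def by measurable
    have Rf: "R (x(q := y)) = R x" "c q (x(q := y)) = c q x" "s (x(q := y)) = s x" for x y
    proof -
      have "r (x(q := y)) = r x" by (rule free_ofD[OF insert.prems(5)]) auto
      moreover have "(\<Sum>p\<in>C. c p (x(q := y)) * (x(q := y)) p) = (\<Sum>p\<in>C. c p x * x p)"
      proof (intro sum.cong refl)
        fix p assume p: "p \<in> C"
        have "c p (x(q := y)) = c p x" by (rule free_ofD[OF insert.prems(3)]) (use p in auto)
        then show "c p (x(q := y)) * (x(q := y)) p = c p x * x p" using p insert.hyps by auto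
      qed
      ultimately show "R (x(q := y)) = R x" by (simp add: R_def)
      show "c q (x(q := y)) = c q x" by (rule free_ofD[OF insert.prems(3)]) auto
      show "s (x(q := y)) = s x" by (rule free_ofD[OF insert.prems(7)]) auto
    qed
    have q: "q \<in> I" using insert.prems by auto
    have "(\<integral>\<^sup>+\<omega>. ennreal ((r \<omega> + (\<Sum>p\<in>insert q C. c p \<omega> * \<omega> p))\<^sup>2 + s \<omega>) \<partial>gauss I)
        = (\<integral>\<^sup>+\<omega>. ennreal ((R \<omega> + c q \<omega> * \<omega> q)\<^sup>2 + s \<omega>) \<partial>gauss I)"
      using insert.hyps by (simp add: R_def algebra_simps)
    also have "\<dots> = (\<integral>\<^sup>+x. (\<integral>\<^sup>+y. ennreal ((R x + c q x * y)\<^sup>2 + s x) \<partial>std_normal_distribution) \<partial>gauss (I - {q}))"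
      by (subst gauss_integrate_out[OF assms(1) q]) (measurable, simp_all add: Rf insert.prems)
    also have "\<dots> = (\<integral>\<^sup>+x. ennreal ((R x)\<^sup>2 + (c q x)\<^sup>2 + s x) \<partial>gauss (I - {q}))"
      by (intro nn_integral_cong std_normal_quadratic) (simp add: insert.prems)
    also have "\<dots> = (\<integral>\<^sup>+\<omega>. ennreal ((R \<omega>)\<^sup>2 + (c q \<omega>)\<^sup>2 + s \<omega>) \<partial>gauss I)"
    proof (rule nn_integral_gauss_free[OF assms(1) q, symmetric])
      show "(\<lambda>\<omega>. ennreal ((R \<omega>)\<^sup>2 + (c q \<omega>)\<^sup>2 + s \<omega>)) \<in> borel_measurable (fun_space I)"
        by measurable
      show "free_of {q} (\<lambda>\<omega>. ennreal ((R \<omega>)\<^sup>2 + (c q \<omega>)\<^sup>2 + s \<omega>))"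
        unfolding free_of_def
      proof (intro allI impI)
        fix \<omega> \<omega>' :: "'a \<Rightarrow> real" assume "\<forall>p. p \<notin> {q} \<longrightarrow> \<omega> p = \<omega>' p"
        then have "\<omega>' = fun_upd \<omega> q (\<omega>' q)" by (auto simp: fun_eq_iff)
        then have "\<exists>y. \<omega>' = fun_upd \<omega> q y" by (rule exI)
        then obtain y where y: "\<omega>' = fun_upd \<omega> q y" by (elim exE)
        show "ennreal ((R \<omega>)\<^sup>2 + (c q \<omega>)\<^sup>2 + s \<omega>) = ennreal ((R \<omega>')\<^sup>2 + (c q \<omega>')\<^sup>2 + s \<omega>')" unfolding y Rf by (rule refl)
      qed
    qed
    also have "\<dots> = (\<integral>\<^sup>+\<omega>. ennreal ((r \<omega> + (\<Sum>p\<in>C. c p \<omega> * \<omega> p))\<^sup>2 + ((c q \<omega>)\<^sup>2 + s \<omega>)) \<partial>gauss I)"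
      by (simp add: R_def add.assoc)
    also have "\<dots> = (\<integral>\<^sup>+\<omega>. ennreal ((r \<omega>)\<^sup>2 + (\<Sum>p\<in>C. (c p \<omega>)\<^sup>2) + ((c q \<omega>)\<^sup>2 + s \<omega>)) \<partial>gauss I)"
    proof (rule insert.IH)
      show "C \<subseteq> I" using insert.prems(1) by simp
      show "c p \<in> borel_measurable (fun_space I)" if "p \<in> C" for p using insert.prems(2) that by simp
      show "free_of C (c p)" if "p \<in> C" for p
        by (rule free_of_subset[OF insert.prems(3)]) (use that in auto)
      show "r \<in> borel_measurable (fun_space I)" by fact
      show "free_of C r" by (rule free_of_subset[OF insert.prems(5)]) auto
      show "(\<lambda>\<omega>. (c q \<omega>)\<^sup>2 + s \<omega>) \<in> borel_measurable (fun_space I)" by measurable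
      show "0 \<le> (c q \<omega>)\<^sup>2 + s \<omega>" for \<omega> using insert.prems(8) by simp
      have "free_of (insert q C) (c q)" using insert.prems(3) by simp
      then show "free_of C (\<lambda>\<omega>. (c q \<omega>)\<^sup>2 + s \<omega>)"
      proof -
        have "free_of C (c q)" "free_of C s"
          by (rule free_of_subset[OF \<open>free_of (insert q C) (c q)\<close>], blast)
            (rule free_of_subset[OF insert.prems(7)], blast)
        then show ?thesis by (rule free_of_binary)
      qed
    qed
    also have "\<dots> = (\<integral>\<^sup>+\<omega>. ennreal ((r \<omega>)\<^sup>2 + (\<Sum>p\<in>insert q C. (c p \<omega>)\<^sup>2) + s \<omega>) \<partial>gauss I)"
      using insert.hyps by (simp add: algebra_simps)
    finally show ?case .
  qed
qed

lemma gauss_linear_sq: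
  assumes "finite I" "C \<subseteq> I"
    and "\<And>p. p \<in> C \<Longrightarrow> c p \<in> borel_measurable (fun_space I)" "\<And>p. p \<in> C \<Longrightarrow> free_of C (c p)"
    and v: "has_bochner_integral (gauss I) (\<lambda>\<omega>. \<Sum>p\<in>C. (c p \<omega>)\<^sup>2) v"
  shows "has_bochner_integral (gauss I) (\<lambda>\<omega>. (\<Sum>p\<in>C. c p \<omega> * \<omega> p)\<^sup>2) v"
proof (rule has_bochner_integral_nn_integral)
  show "(\<lambda>\<omega>. (\<Sum>p\<in>C. c p \<omega> * \<omega> p)\<^sup>2) \<in> borel_measurable (gauss I)"
    using assms(3) by (auto intro!: borel_measurable_sum borel_measurable_times borel_measurable_power)
  show "0 \<le> v" using v by (auto simp: has_bochner_integral_iff sum_nonneg)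
  have "(\<integral>\<^sup>+\<omega>. ennreal ((\<Sum>p\<in>C. c p \<omega> * \<omega> p)\<^sup>2) \<partial>gauss I) = (\<integral>\<^sup>+\<omega>. ennreal (\<Sum>p\<in>C. (c p \<omega>)\<^sup>2) \<partial>gauss I)"
    using nn_integral_gauss_linear_sq[of I C c "\<lambda>_. 0" "\<lambda>_. 0"] assms by (simp add: free_of_def)
  also have "\<dots> = ennreal v"
    using v by (subst nn_integral_eq_integral) (auto simp: has_bochner_integral_iff sum_nonneg)
  finally show "(\<integral>\<^sup>+\<omega>. ennreal ((\<Sum>p\<in>C. c p \<omega> * \<omega> p)\<^sup>2) \<partial>gauss I) = ennreal v" .
qed simp

lemma gauss_const: "has_bochner_integral (gauss I) (\<lambda>_. c :: real) c"
proof -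
  interpret prob_space "gauss I" by (rule prob_space_gauss)
  show ?thesis by (simp add: has_bochner_integral_iff prob_space)
qed

lemma gauss_mult_sq:
  assumes "finite I" "p \<in> I" "g \<in> borel_measurable (fun_space I)" "free_of {p} g"
    and "has_bochner_integral (gauss I) (\<lambda>\<omega>. (g \<omega>)\<^sup>2) v"
  shows "has_bochner_integral (gauss I) (\<lambda>\<omega>. (g \<omega> * \<omega> p)\<^sup>2) v"
  using gauss_linear_sq[of I "{p}" "\<lambda>_. g" v] assms by simp

lemma gauss_sq:
  assumes "finite I" "p \<in> I"
  shows "has_bochner_integral (gauss I) (\<lambda>\<omega>. (\<omega> p)\<^sup>2) 1"
proof -
  have "has_bochner_integral (gauss I) (\<lambda>\<omega>. (1 * \<omega> p)\<^sup>2) 1"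
  proof (rule gauss_mult_sq[OF assms])
    show "has_bochner_integral (gauss I) (\<lambda>\<omega>. (1::real)\<^sup>2) 1" unfolding one_power2 by (rule gauss_const)
  qed (simp_all add: free_of_def)
  then show ?thesis by simp
qed

lemma gauss_sq_sq:
  assumes "finite I" "p \<in> I" "q \<in> I" "p \<noteq> q"
  shows "has_bochner_integral (gauss I) (\<lambda>\<omega>. (\<omega> p * \<omega> q)\<^sup>2) 1"
  using assms by (intro gauss_mult_sq gauss_sq) auto

lemma gauss_fourth:
  assumes "finite I" "p \<in> I"
  shows "has_bochner_integral (gauss I) (\<lambda>\<omega>. \<omega> p ^ 4) 3"
proof (rule has_bochner_integral_nn_integral)
  have b: "has_bochner_integral lborel (\<lambda>y. std_normal_density y * y ^ 4) 3"
    using std_normal_moment_even[of 2] by (simp add: fact_numeral)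
  have "(\<integral>\<^sup>+\<omega>. ennreal (\<omega> p ^ 4) \<partial>gauss I)
     = (\<integral>\<^sup>+x. (\<integral>\<^sup>+y. ennreal (y ^ 4) \<partial>std_normal_distribution) \<partial>gauss (I - {p}))"
    by (subst gauss_integrate_out[OF assms]) auto
  also have "(\<integral>\<^sup>+y. ennreal (y ^ 4) \<partial>std_normal_distribution) = (\<integral>\<^sup>+y. ennreal (std_normal_density y * y ^ 4) \<partial>lborel)"
    by (subst nn_integral_density) (auto simp: ennreal_mult)
  also have "\<dots> = 3"
    using b by (subst nn_integral_eq_integral) (auto simp: has_bochner_integral_iff)
  finally show "(\<integral>\<^sup>+\<omega>. ennreal (\<omega> p ^ 4) \<partial>gauss I) = ennreal 3"
    by (simp add: prob_space.emeasure_space_1[OF prob_space_gauss])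
qed auto

text \<open>
  Integrating over coordinate \<open>q\<close> first gives zero, by symmetry.
\<close>

lemma gauss_odd:
  fixes g :: "('i \<Rightarrow> real) \<Rightarrow> real"
  assumes "finite I" "q \<in> I" "free_of {q} g" "integrable (gauss I) (\<lambda>\<omega>. g \<omega> * \<omega> q)"
  shows "has_bochner_integral (gauss I) (\<lambda>\<omega>. g \<omega> * \<omega> q) 0"
proof -
  have I: "I = insert q (I - {q})" using assms by auto
  have g: "g (x(q := y)) = g x" for x y by (rule free_ofD[OF assms(3)]) simp
  have m: "(\<integral>y. y \<partial>std_normal_distribution) = 0"
    using std_normal_moment_odd[of 0] by (subst integral_density) (auto simp: has_bochner_integral_iff mult.left_commute)
  have "(\<integral>\<omega>. g \<omega> * \<omega> q \<partial>gauss I) = (\<integral>x. (\<integral>y. g (x(q := y)) * (x(q := y)) q \<partial>std_normal_distribution) \<partial>gauss (I - {q}))"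
    by (subst I, rule gauss.product_integral_insert) (use assms in \<open>auto simp: insert_absorb\<close>)
  also have "\<dots> = 0" by (simp add: g m)
  finally show ?thesis using assms(4) by (simp add: has_bochner_integral_iff)
qed

lemma integrable_gauss_product4:
  assumes "finite I" "a \<in> I" "b \<in> I" "c \<in> I" "e \<in> I"
  shows "integrable (gauss I) (\<lambda>\<omega>. \<omega> a * \<omega> b * \<omega> c * \<omega> e)"
proof (rule Bochner_Integration.integrable_bound)
  show "integrable (gauss I) (\<lambda>\<omega>. \<omega> a ^ 4 + \<omega> b ^ 4 + \<omega> c ^ 4 + \<omega> e ^ 4)"
    using gauss_fourth[OF assms(1)] assms by (intro Bochner_Integration.integrable_add) (auto simp: has_bochner_integral_iff)
  show "AE \<omega> in gauss I. norm (\<omega> a * \<omega> b * \<omega> c * \<omega> e) \<le> norm (\<omega> a ^ 4 + \<omega> b ^ 4 + \<omega> c ^ 4 + \<omega> e ^ 4)"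
  proof (intro AE_I2)
    fix \<omega> :: "'a \<Rightarrow> real"
    have am: "\<bar>x * y\<bar> \<le> (x\<^sup>2 + y\<^sup>2) / 2" for x y :: real
      using sum_squares_bound[of "\<bar>x\<bar>" "\<bar>y\<bar>"] by (simp add: abs_mult)
    have "\<bar>(\<omega> a * \<omega> b) * (\<omega> c * \<omega> e)\<bar> \<le> ((\<omega> a * \<omega> b)\<^sup>2 + (\<omega> c * \<omega> e)\<^sup>2) / 2" by (rule am)
    also have "(\<omega> a * \<omega> b)\<^sup>2 \<le> ((\<omega> a)^4 + (\<omega> b)^4) / 2"
      using am[of "(\<omega> a)\<^sup>2" "(\<omega> b)\<^sup>2"] by (simp add: power_mult_distrib flip: power_mult)
    also have "(\<omega> c * \<omega> e)\<^sup>2 \<le> ((\<omega> c)^4 + (\<omega> e)^4) / 2"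
      using am[of "(\<omega> c)\<^sup>2" "(\<omega> e)\<^sup>2"] by (simp add: power_mult_distrib flip: power_mult)
    finally have "\<bar>\<omega> a * \<omega> b * \<omega> c * \<omega> e\<bar> \<le> ((\<omega> a ^ 4 + \<omega> b ^ 4) / 2 + (\<omega> c ^ 4 + \<omega> e ^ 4) / 2) / 2"
      by (simp add: mult.assoc)
    moreover have "0 \<le> \<omega> a ^ 4" "0 \<le> \<omega> b ^ 4" "0 \<le> \<omega> c ^ 4" "0 \<le> \<omega> e ^ 4" by simp_all
    ultimately show "norm (\<omega> a * \<omega> b * \<omega> c * \<omega> e) \<le> norm (\<omega> a ^ 4 + \<omega> b ^ 4 + \<omega> c ^ 4 + \<omega> e ^ 4)"
      unfolding real_norm_def by argo
  qed
qed simp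

abbreviation kron :: "'i \<Rightarrow> 'i \<Rightarrow> real" where
  "kron a b \<equiv> (if a = b then 1 else 0)"

text \<open>
  Both sides vanish if some index differs from the other three. Otherwise the indices form two
  equal pairs; if all four coincide, the fourth moment 3 counts the three pairings.
\<close>

lemma gauss_isserlis_coordinates:
  assumes "finite I" "a \<in> I" "b \<in> I" "c \<in> I" "e \<in> I"
  shows "has_bochner_integral (gauss I) (\<lambda>\<omega>. \<omega> a * \<omega> b * \<omega> c * \<omega> e)
           (kron a b * kron c e + kron a c * kron b e + kron a e * kron b c)"
proof -
  have lone: "has_bochner_integral (gauss I) (\<lambda>\<omega>. \<omega> x * \<omega> y * \<omega> z * \<omega> w) 0"
    if "w \<in> I" "x \<in> I" "y \<in> I" "z \<in> I" "w \<noteq> x" "w \<noteq> y" "w \<noteq> z" for x y z w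
    using that assms(1) by (intro gauss_odd integrable_gauss_product4) (auto simp: free_of_def)
  have pair: "has_bochner_integral (gauss I) (\<lambda>\<omega>. \<omega> x * \<omega> x * \<omega> y * \<omega> y) (1 + 2 * kron x y)"
    if "x \<in> I" "y \<in> I" for x y
    using gauss_sq_sq[OF assms(1) that] gauss_fourth[OF assms(1) that(1)]
    by (auto simp: power2_eq_square power4_eq_xxxx mult_ac)
  show ?thesis
  proof (cases "a = b")
    case ab: True
    show ?thesis
    proof (cases "c = e")
      case True
      then show ?thesis using pair[of a c] ab assms by (auto simp: mult_ac)
    next
      case False
      then have "has_bochner_integral (gauss I) (\<lambda>\<omega>. \<omega> a * \<omega> b * \<omega> c * \<omega> e) 0"
        using lone[of c a b e] lone[of e a b c] ab assms by (cases "c = a") (auto simp: mult_ac)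
      then show ?thesis using False ab by auto
    qed
  next
    case ab: False
    show ?thesis
    proof (cases "a = c")
      case ac: True
      show ?thesis
      proof (cases "b = e")
        case True
        then show ?thesis using pair[of a b] ab ac assms by (auto simp: mult_ac)
      next
        case False
        then have "has_bochner_integral (gauss I) (\<lambda>\<omega>. \<omega> a * \<omega> b * \<omega> c * \<omega> e) 0"
          using lone[of b a c e] ab ac assms by (auto simp: mult_ac)
        then show ?thesis using False ab ac by auto
      qed
    next
      case ac: False
      show ?thesis
      proof (cases "a = e")
        case ae: True
        show ?thesis
        proof (cases "b = c")
          case True
          then show ?thesis using pair[of a b] ab ac ae assms by (auto simp: mult_ac)
        next
          case False
          then have "has_bochner_integral (gauss I) (\<lambda>\<omega>. \<omega> a * \<omega> b * \<omega> c * \<omega> e) 0"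
            using lone[of b a c e] ab ae assms by (auto simp: mult_ac)
          then show ?thesis using False ab ac ae by auto
        qed
      next
        case False
        then show ?thesis using lone[of a b c e] ab ac assms by (simp add: mult_ac)
      qed
    qed
  qed
qed

definition cov :: "'i set \<Rightarrow> ('i \<Rightarrow> real) \<Rightarrow> ('i \<Rightarrow> real) \<Rightarrow> real" where
  "cov I x y = (\<Sum>p\<in>I. x p * y p)"

lemma sum_product4:
  fixes f g h k :: "'i \<Rightarrow> real"
  shows "(\<Sum>a\<in>I. \<Sum>b\<in>I. \<Sum>c\<in>I. \<Sum>e\<in>I. f a * g b * h c * k e) = sum f I * sum g I * sum h I * sum k I"
  by (simp only: sum_distrib_left[symmetric] sum_distrib_right[symmetric])

lemma sum_kron: "finite I \<Longrightarrow> c \<in> I \<Longrightarrow> (\<Sum>e\<in>I. u e * kron c e) = u c"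
  by (simp add: mult_delta_right)

lemma sum_isserlis:
  fixes x y z w :: "'i \<Rightarrow> real"
  assumes I: "finite I"
  shows "(\<Sum>a\<in>I. \<Sum>b\<in>I. \<Sum>c\<in>I. \<Sum>e\<in>I. x a * y b * z c * w e * (kron a b * kron c e + kron a c * kron b e + kron a e * kron b c))
     = cov I x y * cov I z w + cov I x z * cov I y w + cov I x w * cov I y z"
proof -
  note k = sum_kron[OF I]
  have 1: "(\<Sum>e\<in>I. x a * y b * z c * w e * (kron a b * kron c e + kron a c * kron b e + kron a e * kron b c))
      = x a * y b * z c * (kron a b * w c + kron a c * w b + kron b c * w a)"
    if "a \<in> I" "b \<in> I" "c \<in> I" for a b c
  proof -
    have "(\<Sum>e\<in>I. x a * y b * z c * w e * (kron a b * kron c e + kron a c * kron b e + kron a e * kron b c))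
      = x a * y b * z c * (kron a b * (\<Sum>e\<in>I. w e * kron c e) + kron a c * (\<Sum>e\<in>I. w e * kron b e) + kron b c * (\<Sum>e\<in>I. w e * kron a e))"
      by (simp only: sum_distrib_left sum.distrib[symmetric]) (simp add: algebra_simps)
    then show ?thesis using that by (simp only: k)
  qed
  have 2: "(\<Sum>c\<in>I. x a * y b * z c * (kron a b * w c + kron a c * w b + kron b c * w a))
      = x a * y b * (kron a b * cov I z w + z a * w b + z b * w a)" if "a \<in> I" "b \<in> I" for a b
  proof -
    have "(\<Sum>c\<in>I. x a * y b * z c * (kron a b * w c + kron a c * w b + kron b c * w a))
      = x a * y b * (kron a b * (\<Sum>c\<in>I. z c * w c) + w b * (\<Sum>c\<in>I. z c * kron a c) + w a * (\<Sum>c\<in>I. z c * kron b c))"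
      by (simp only: sum_distrib_left sum.distrib[symmetric]) (simp add: algebra_simps)
    then show ?thesis using that by (simp only: k cov_def mult.commute)
  qed
  have 3: "(\<Sum>b\<in>I. x a * y b * (kron a b * cov I z w + z a * w b + z b * w a))
      = x a * y a * cov I z w + x a * z a * cov I y w + x a * w a * cov I y z" if "a \<in> I" for a
  proof -
    have "(\<Sum>b\<in>I. x a * y b * (kron a b * cov I z w + z a * w b + z b * w a))
      = x a * (\<Sum>b\<in>I. y b * kron a b) * cov I z w + x a * z a * (\<Sum>b\<in>I. y b * w b) + x a * w a * (\<Sum>b\<in>I. y b * z b)"
      by (simp only: sum_distrib_left sum_distrib_right sum.distrib[symmetric]) (simp add: algebra_simps)
    then show ?thesis using that by (simp only: k cov_def)
  qed
  have "(\<Sum>a\<in>I. \<Sum>b\<in>I. \<Sum>c\<in>I. \<Sum>e\<in>I. x a * y b * z c * w e * (kron a b * kron c e + kron a c * kron b e + kron a e * kron b c))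
      = (\<Sum>a\<in>I. x a * y a * cov I z w + x a * z a * cov I y w + x a * w a * cov I y z)"
    by (simp only: 1 2 3 cong: sum.cong)
  also have "\<dots> = cov I x y * cov I z w + cov I x z * cov I y w + cov I x w * cov I y z"
    by (simp only: sum.distrib sum_distrib_right[symmetric] cov_def)
  finally show ?thesis .
qed

lemma gauss_isserlis:
  assumes "finite I"
  shows "has_bochner_integral (gauss I) (\<lambda>\<omega>. cov I x \<omega> * cov I y \<omega> * cov I z \<omega> * cov I w \<omega>)
           (cov I x y * cov I z w + cov I x z * cov I y w + cov I x w * cov I y z)"
proof -
  have "has_bochner_integral (gauss I)
      (\<lambda>\<omega>. \<Sum>a\<in>I. \<Sum>b\<in>I. \<Sum>c\<in>I. \<Sum>e\<in>I. x a * y b * z c * w e * (\<omega> a * \<omega> b * \<omega> c * \<omega> e))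
      (\<Sum>a\<in>I. \<Sum>b\<in>I. \<Sum>c\<in>I. \<Sum>e\<in>I. x a * y b * z c * w e * (kron a b * kron c e + kron a c * kron b e + kron a e * kron b c))"
    using assms by (intro has_bochner_integral_sum has_bochner_integral_mult_right gauss_isserlis_coordinates)
  moreover have "(\<Sum>a\<in>I. \<Sum>b\<in>I. \<Sum>c\<in>I. \<Sum>e\<in>I. x a * y b * z c * w e * (\<omega> a * \<omega> b * \<omega> c * \<omega> e))
      = cov I x \<omega> * cov I y \<omega> * cov I z \<omega> * cov I w \<omega>" for \<omega>
    unfolding cov_def sum_product4[symmetric] by (simp add: mult_ac)
  ultimately show ?thesis using sum_isserlis[OF assms, of x y z w] by simp
qed

lemma gauss_covariance:
  assumes "finite I"
  shows "has_bochner_integral (gauss I) (\<lambda>\<omega>. cov I x \<omega> * cov I y \<omega>) (cov I x y)"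
proof -
  have p: "has_bochner_integral (gauss I) (\<lambda>\<omega>. \<omega> a * \<omega> b) (kron a b)" if "a \<in> I" "b \<in> I" for a b
  proof (cases "a = b")
    case True
    then show ?thesis using gauss_sq[OF assms that(1)] by (simp add: power2_eq_square)
  next
    case False
    have "integrable (gauss I) (\<lambda>\<omega>. \<omega> a * \<omega> b)"
    proof (rule Bochner_Integration.integrable_bound)
      show "integrable (gauss I) (\<lambda>\<omega>. (\<omega> a)\<^sup>2 + (\<omega> b)\<^sup>2)"
        using gauss_sq[OF assms] that by (auto simp: has_bochner_integral_iff)
      have "norm (x * y) \<le> norm (x\<^sup>2 + y\<^sup>2)" for x y :: real
      proof -
        have "2 * \<bar>x * y\<bar> \<le> x\<^sup>2 + y\<^sup>2" using sum_squares_bound[of "\<bar>x\<bar>" "\<bar>y\<bar>"] by (simp add: abs_mult)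
        moreover have "0 \<le> \<bar>x * y\<bar>" by simp
        ultimately show ?thesis unfolding real_norm_def by linarith
      qed
      then show "AE \<omega> in gauss I. norm (\<omega> a * \<omega> b) \<le> norm ((\<omega> a)\<^sup>2 + (\<omega> b)\<^sup>2)" by auto
    qed simp
    then have "has_bochner_integral (gauss I) (\<lambda>\<omega>. \<omega> a * \<omega> b) 0"
      using False by (intro gauss_odd[OF assms that(2)]) (auto simp: free_of_def)
    then show ?thesis using False by simp
  qed
  have "has_bochner_integral (gauss I) (\<lambda>\<omega>. \<Sum>a\<in>I. \<Sum>b\<in>I. x a * y b * (\<omega> a * \<omega> b)) (\<Sum>a\<in>I. \<Sum>b\<in>I. x a * y b * kron a b)"
    by (intro has_bochner_integral_sum has_bochner_integral_mult_right p)
  moreover have "(\<Sum>a\<in>I. \<Sum>b\<in>I. x a * y b * (\<omega> a * \<omega> b)) = cov I x \<omega> * cov I y \<omega>" for \<omega>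
    by (simp add: cov_def sum_product mult_ac)
  moreover have "(\<Sum>a\<in>I. \<Sum>b\<in>I. x a * y b * kron a b) = cov I x y"
    by (simp add: cov_def sum_kron[OF assms] cong: sum.cong)
  ultimately show ?thesis by simp
qed

lemma nn_integral_powr_tail:
  fixes a :: real
  assumes "1 < a"
  shows "(\<integral>\<^sup>+t. ennreal ((1 + 2 * t) powr (- a)) * indicator {0..} t \<partial>lborel) = ennreal (1 / (2 * (a - 1)))"
proof -
  let ?F = "\<lambda>t :: real. - ((1 + 2 * t) powr (1 - a)) / (2 * (a - 1))"
  have "(\<integral>\<^sup>+t. ennreal ((1 + 2 * t) powr (- a)) * indicator {0..} t \<partial>lborel) = ennreal (0 - ?F 0)"
  proof (rule nn_integral_FTC_atLeast)
    have "filterlim (\<lambda>t :: real. 1 + 2 * t) at_top at_top"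
      by (intro filterlim_tendsto_add_at_top[OF tendsto_const] filterlim_tendsto_pos_mult_at_top[OF tendsto_const] filterlim_ident) simp
    then have "((\<lambda>t :: real. (1 + 2 * t) powr (1 - a)) \<longlongrightarrow> 0) at_top"
      using assms by (intro tendsto_neg_powr) auto
    from tendsto_divide[OF tendsto_minus[OF this] tendsto_const[of "2 * (a - 1)"]]
    show "(?F \<longlongrightarrow> 0) at_top" using assms by simp
    fix t :: real assume "0 \<le> t"
    then have "((\<lambda>t. (1 + 2 * t) powr (1 - a)) has_real_derivative
        (1 - a) * (1 + 2 * t) powr (1 - a - of_nat 1) * 2) (at t)"
      by (intro DERIV_fun_powr) (auto intro!: derivative_eq_intros)
    from DERIV_cdivide[OF DERIV_minus[OF this], of "2 * (a - 1)"]
    have "(?F has_real_derivative - ((1 - a) * (1 + 2 * t) powr (1 - a - of_nat 1) * 2) / (2 * (a - 1))) (at t)" .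
    moreover have "- ((1 - a) * (1 + 2 * t) powr (1 - a - of_nat 1) * 2) / (2 * (a - 1)) = (1 + 2 * t) powr (- a)"
      using assms by (simp add: divide_eq_eq algebra_simps)
    ultimately show "(?F has_real_derivative (1 + 2 * t) powr (- a)) (at t)" by simp
  qed auto
  then show ?thesis by simp
qed

lemma std_normal_exp_square:
  assumes "0 \<le> (t :: real)"
  shows "(\<integral>\<^sup>+x. ennreal (exp (- t * x\<^sup>2)) \<partial>std_normal_distribution) = ennreal ((1 + 2 * t) powr (-1/2))"
proof -
  define s where "s = 1 / sqrt (1 + 2 * t)"
  have s: "0 < s" "s\<^sup>2 = 1 / (1 + 2 * t)" using assms by (auto simp: s_def power_divide)
  have eq: "std_normal_density x * exp (- t * x\<^sup>2) = s * normal_density 0 s x" for x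
  proof -
    have "- (x\<^sup>2) / 2 + - t * x\<^sup>2 = - ((x - 0)\<^sup>2) / (2 * s\<^sup>2)"
      using assms unfolding s(2) by (simp add: field_simps)
    then have "exp (- (x\<^sup>2) / 2) * exp (- t * x\<^sup>2) = exp (- ((x - 0)\<^sup>2) / (2 * s\<^sup>2))"
      by (simp only: exp_add[symmetric])
    moreover have "sqrt (2 * pi * s\<^sup>2) = sqrt (2 * pi) * s" using s(1) by (simp add: real_sqrt_mult)
    ultimately show ?thesis using s(1) unfolding normal_density_def[of 0 s] std_normal_density_def by simp
  qed
  have "(\<integral>\<^sup>+x. ennreal (exp (- t * x\<^sup>2)) \<partial>std_normal_distribution)
      = (\<integral>\<^sup>+x. ennreal (std_normal_density x) * ennreal (exp (- t * x\<^sup>2)) \<partial>lborel)"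
    by (subst nn_integral_density) simp_all
  also have "\<dots> = (\<integral>\<^sup>+x. ennreal s * ennreal (normal_density 0 s x) \<partial>lborel)"
  proof (intro nn_integral_cong)
    fix x
    have "ennreal (std_normal_density x) * ennreal (exp (- t * x\<^sup>2)) = ennreal (std_normal_density x * exp (- t * x\<^sup>2))"
      by (rule ennreal_mult[symmetric]) simp_all
    also have "\<dots> = ennreal s * ennreal (normal_density 0 s x)"
      unfolding eq using s(1) by (intro ennreal_mult) simp_all
    finally show "ennreal (std_normal_density x) * ennreal (exp (- t * x\<^sup>2)) = ennreal s * ennreal (normal_density 0 s x)" .
  qed
  also have "\<dots> = ennreal s * (\<integral>\<^sup>+x. ennreal (normal_density 0 s x) \<partial>lborel)"
    by (rule nn_integral_cmult) measurable
  also have "(\<integral>\<^sup>+x. ennreal (normal_density 0 s x) \<partial>lborel) = 1"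
    using s(1) by (subst nn_integral_eq_integral) auto
  also have "s = (1 + 2 * t) powr (-1/2)"
  proof -
    have "(1 + 2 * t) powr (- (1/2)) = 1 / (1 + 2 * t) powr (1/2)" by (rule powr_minus_divide)
    also have "(1 + 2 * t) powr (1/2) = sqrt (1 + 2 * t)" using assms by (intro powr_half_sqrt) simp
    finally show ?thesis by (simp add: s_def)
  qed
  finally show ?thesis by simp
qed

text \<open>
  Write \<open>1 / s\<close> as the integral of \<open>exp (- t s)\<close> over \<open>t \<ge> 0\<close>. After exchanging the integrals the
  Gaussian integral factorizes into Laplace transforms of squares.
\<close>

lemma gauss_inverse_chi_square:
  assumes "finite I" "A \<subseteq> I" "3 \<le> card A"
  shows "(\<integral>\<^sup>+\<omega>. ennreal (1 / (\<Sum>p\<in>A. (\<omega> p)\<^sup>2)) \<partial>gauss I) = ennreal (1 / (real (card A) - 2))"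
proof -
  define S where "S = (\<lambda>\<omega> :: 'a \<Rightarrow> real. \<Sum>p\<in>A. (\<omega> p)\<^sup>2)"
  have fin: "finite A" using assms finite_subset by blast
  have [measurable]: "S \<in> borel_measurable (fun_space I)" unfolding S_def by measurable
  obtain a where a: "a \<in> A" using assms(3) by fastforce
  have "AE \<omega> in gauss I. \<omega> a \<noteq> 0" using a assms by (intro gauss_AE_nonzero) auto
  then have pos: "AE \<omega> in gauss I. 0 < S \<omega>"
    by eventually_elim (use a fin in \<open>auto simp: S_def intro!: sum_pos2\<close>)
  have lap: "ennreal (1 / s) = (\<integral>\<^sup>+t. ennreal (exp (- t * s)) * indicator {0..} t \<partial>lborel)" if "0 < s" for s :: real
  proof -
    have "(\<integral>\<^sup>+t. ennreal (exp (- t * s)) * indicator {0..} t \<partial>lborel) = ennreal (0 - - (exp (- 0 * s)) / s)"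
    proof (rule nn_integral_FTC_atLeast)
      have "filterlim (\<lambda>t. - s * t) at_bot at_top"
        using that by (intro filterlim_tendsto_neg_mult_at_bot[OF tendsto_const] filterlim_ident) auto
      then have "((\<lambda>t. exp (- t * s)) \<longlongrightarrow> 0) at_top"
        by (intro filterlim_compose[OF exp_at_bot]) (simp add: mult.commute)
      from tendsto_divide[OF tendsto_minus[OF this] tendsto_const[of s]]
      show "((\<lambda>t. - (exp (- t * s)) / s) \<longlongrightarrow> 0) at_top" using that by simp
      show "((\<lambda>t. - (exp (- t * s)) / s) has_real_derivative exp (- t * s)) (at t)" for t
        using that by (auto intro!: derivative_eq_intros)
    qed auto
    then show ?thesis by simp
  qed
  interpret G: prob_space "gauss I" by (rule prob_space_gauss)
  interpret P: pair_sigma_finite "gauss I" "lborel :: real measure" ..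
  have "(\<integral>\<^sup>+\<omega>. ennreal (1 / S \<omega>) \<partial>gauss I)
      = (\<integral>\<^sup>+\<omega>. (\<integral>\<^sup>+t. ennreal (exp (- t * S \<omega>)) * indicator {0..} t \<partial>lborel) \<partial>gauss I)"
    using pos by (intro nn_integral_cong_AE) (auto elim!: eventually_mono simp: lap)
  also have "\<dots> = (\<integral>\<^sup>+t. (\<integral>\<^sup>+\<omega>. ennreal (exp (- t * S \<omega>)) * indicator {0..} t \<partial>gauss I) \<partial>lborel)"
    by (rule P.Fubini'[symmetric]) measurable
  also have "\<dots> = (\<integral>\<^sup>+t. ennreal ((1 + 2 * t) powr (- (real (card A) / 2))) * indicator {0..} t \<partial>lborel)"
  proof (intro nn_integral_cong)
    fix t :: real
    show "(\<integral>\<^sup>+\<omega>. ennreal (exp (- t * S \<omega>)) * indicator {0..} t \<partial>gauss I)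
        = ennreal ((1 + 2 * t) powr (- (real (card A) / 2))) * indicator {0..} t"
    proof (cases "0 \<le> t")
      case True
      have "(\<integral>\<^sup>+\<omega>. ennreal (exp (- t * S \<omega>)) \<partial>gauss I)
         = (\<integral>\<^sup>+\<omega>. (\<Prod>p\<in>I. ennreal (if p \<in> A then exp (- t * (\<omega> p)\<^sup>2) else 1)) \<partial>gauss I)"
      proof (intro nn_integral_cong)
        fix \<omega> :: "'a \<Rightarrow> real"
        have "exp (- t * S \<omega>) = (\<Prod>p\<in>A. exp (- t * (\<omega> p)\<^sup>2))"
          unfolding S_def sum_distrib_left by (rule exp_sum[OF fin])
        also have "\<dots> = (\<Prod>p\<in>I. if p \<in> A then exp (- t * (\<omega> p)\<^sup>2) else 1)"
          using assms(1,2) by (simp add: prod.If_cases Int_absorb1)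
        finally show "ennreal (exp (- t * S \<omega>)) = (\<Prod>p\<in>I. ennreal (if p \<in> A then exp (- t * (\<omega> p)\<^sup>2) else 1))"
          by (subst prod_ennreal) auto
      qed
      also have "\<dots> = (\<Prod>p\<in>I. \<integral>\<^sup>+x. ennreal (if p \<in> A then exp (- t * x\<^sup>2) else 1) \<partial>std_normal_distribution)"
        using assms(1) by (intro gauss.product_nn_integral_prod) auto
      also have "\<dots> = (\<Prod>p\<in>I. if p \<in> A then ennreal ((1 + 2 * t) powr (-1/2)) else 1)"
        using True std_normal_exp_square[of t]
        by (intro prod.cong) auto
      also have "\<dots> = ennreal ((1 + 2 * t) powr (- (real (card A) / 2)))"
        using assms(1,2) True
        by (simp add: prod.If_cases Int_absorb1 ennreal_power powr_realpow[symmetric] powr_powr del: powr_realpow)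
      finally show ?thesis using True by simp
    qed simp
  qed
  also have "\<dots> = ennreal (1 / (real (card A) - 2))"
    using assms(3) by (subst nn_integral_powr_tail) (auto simp: field_simps)
  finally show ?thesis by (simp add: S_def)
qed

section \<open>From relative entropy to total variation\<close>

text \<open>
  From \<open>ln w = 2 ln (sqrt w) \<le> 2 (sqrt w - 1)\<close> the right-hand side is at least
  \<open>4 (1 - sqrt w)\<^sup>2\<close>, and \<open>1 + sqrt w \<le> 2\<close> for \<open>w \<le> 1\<close>.
\<close>

lemma square_deficit_le:
  fixes w :: real
  assumes "0 < w"
  shows "(max 0 (1 - w))\<^sup>2 \<le> 4 * (w - 1 - ln w)"
proof -
  define s where "s = sqrt w"
  have s: "0 < s" "w = s\<^sup>2" using assms by (auto simp: s_def)
  have "ln w = 2 * ln s" using s by (simp add: ln_realpow)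
  also have "\<dots> \<le> 2 * (s - 1)" using s(1) ln_le_minus_one[of s] by simp
  finally have b: "(1 - s)\<^sup>2 \<le> w - 1 - ln w" using s(2) by (simp add: power2_eq_square algebra_simps)
  show ?thesis
  proof (cases "w \<le> 1")
    case True
    then have "s \<le> 1" using s by (simp add: power2_le_imp_le[of s 1])
    have "(max 0 (1 - w))\<^sup>2 = (1 - s)\<^sup>2 * (1 + s)\<^sup>2" using True s(2)
      by (simp add: power_mult_distrib[symmetric] algebra_simps power2_eq_square)
    also have "\<dots> \<le> (1 - s)\<^sup>2 * 2\<^sup>2"
      using \<open>s \<le> 1\<close> s(1) by (intro mult_left_mono power_mono) auto
    finally show ?thesis using b by simp
  next
    case False
    have "0 \<le> (1 - s)\<^sup>2" by simp
    with b have "0 \<le> w - 1 - ln w" by linarith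
    with False show ?thesis by simp
  qed
qed

text \<open>
  A form of Pinsker's inequality. The deviation on any event is at most the integral of the deficit
  \<open>max 0 (1 - W)\<close>, and the second moment of the deficit is controlled by the relative entropy through
  \<open>square_deficit_le\<close>. The entropy enters through an integrable upper bound \<open>\<Phi>\<close> of
  \<open>- ln W\<close>.
\<close>

lemma (in prob_space) change_of_measure_deviation:
  fixes W \<Phi> :: "'a \<Rightarrow> real"
  assumes W [measurable]: "W \<in> borel_measurable M" and pos: "\<And>\<omega>. 0 < W \<omega>"
    and one: "(\<integral>\<^sup>+\<omega>. ennreal (W \<omega>) \<partial>M) = 1"
    and \<Phi>: "integrable M \<Phi>" "\<And>\<omega>. - ln (W \<omega>) \<le> \<Phi> \<omega>"
    and A [measurable]: "A \<in> events"
  shows "\<bar>prob A - (\<integral>\<omega>. indicator A \<omega> * W \<omega> \<partial>M)\<bar> \<le> 2 * sqrt (expectation \<Phi>)"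
proof -
  have WI: "has_bochner_integral M W 1"
    using one pos by (intro has_bochner_integral_nn_integral) (auto simp: less_imp_le)
  then have iW: "integrable M W" "expectation W = 1" by (auto simp: has_bochner_integral_iff)
  \<comment> \<open>Under the reweighted measure an event can lose at most the integral of this deficit.\<close>
  define D where "D = (\<lambda>\<omega>. max 0 (1 - W \<omega>))"
  have Dm [measurable]: "D \<in> borel_measurable M" unfolding D_def by measurable
  have Db: "0 \<le> D \<omega>" "D \<omega> \<le> 1" for \<omega> using pos[of \<omega>] by (auto simp: D_def)
  have iD: "integrable M D" using Db by (intro integrable_const_bound[of _ 1]) auto
  have iD2: "integrable M (\<lambda>\<omega>. (D \<omega>)\<^sup>2)"
    using Db by (intro integrable_const_bound[of _ 1]) (auto simp: power_le_one)
  have "expectation (\<lambda>\<omega>. (D \<omega>)\<^sup>2) \<le> expectation (\<lambda>\<omega>. 4 * (W \<omega> - 1 + \<Phi> \<omega>))"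
  proof (rule integral_mono[OF iD2])
    show "integrable M (\<lambda>\<omega>. 4 * (W \<omega> - 1 + \<Phi> \<omega>))" using iW \<Phi> by auto
    show "(D \<omega>)\<^sup>2 \<le> 4 * (W \<omega> - 1 + \<Phi> \<omega>)" for \<omega>
      using square_deficit_le[OF pos[of \<omega>]] \<Phi>(2)[of \<omega>] by (simp add: D_def)
  qed
  also have "\<dots> = 4 * expectation \<Phi>" using iW \<Phi> by (simp add: prob_space)
  finally have D2: "expectation (\<lambda>\<omega>. (D \<omega>)\<^sup>2) \<le> 4 * expectation \<Phi>" .
  have "0 \<le> variance D" by simp
  then have "(expectation D)\<^sup>2 \<le> 4 * expectation \<Phi>"
    using D2 iD iD2 by (simp add: variance_eq)
  then have "expectation D \<le> sqrt (4 * expectation \<Phi>)" by (rule real_le_rsqrt)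
  then have ED: "expectation D \<le> 2 * sqrt (expectation \<Phi>)" by (simp add: real_sqrt_mult)
  have key: "prob B - (\<integral>\<omega>. indicator B \<omega> * W \<omega> \<partial>M) \<le> expectation D" if [measurable]: "B \<in> events" for B
  proof -
    have iB: "integrable M (\<lambda>\<omega>. indicator B \<omega> * W \<omega>)" using iW integrable_real_mult_indicator[OF that iW(1)] by (simp add: mult.commute)
    have i1: "integrable M (indicator B :: 'a \<Rightarrow> real)"
      by (intro integrable_const_bound[of _ 1]) (auto simp: indicator_def)
    have "prob B - (\<integral>\<omega>. indicator B \<omega> * W \<omega> \<partial>M) = (\<integral>\<omega>. indicator B \<omega> - indicator B \<omega> * W \<omega> \<partial>M)"
      using iB i1 by (subst Bochner_Integration.integral_diff) auto
    also have "\<dots> \<le> expectation D"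
    proof (rule integral_mono)
      show "integrable M (\<lambda>\<omega>. indicator B \<omega> - indicator B \<omega> * W \<omega>)"
        using i1 iB by (rule Bochner_Integration.integrable_diff)
      show "indicator B \<omega> - indicator B \<omega> * W \<omega> \<le> D \<omega>" for \<omega>
        by (auto simp: D_def indicator_def)
    qed (rule iD)
    finally show ?thesis .
  qed
  have iA: "integrable M (\<lambda>\<omega>. indicator A \<omega> * W \<omega>)" using integrable_real_mult_indicator[OF A iW(1)] by (simp add: mult.commute)
  \<comment> \<open>The other direction is the same bound for the complement.\<close>
  have "(\<integral>\<omega>. indicator (space M - A) \<omega> * W \<omega> \<partial>M) = (\<integral>\<omega>. W \<omega> - indicator A \<omega> * W \<omega> \<partial>M)"
    by (intro Bochner_Integration.integral_cong) (auto simp: indicator_def)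
  also have "\<dots> = 1 - (\<integral>\<omega>. indicator A \<omega> * W \<omega> \<partial>M)" using iA iW by simp
  finally have "prob (space M - A) - (\<integral>\<omega>. indicator (space M - A) \<omega> * W \<omega> \<partial>M)
      = - (prob A - (\<integral>\<omega>. indicator A \<omega> * W \<omega> \<partial>M))" by (simp add: prob_compl)
  then show ?thesis using key[OF A] key[of "space M - A"] ED by auto
qed

section \<open>The expected cost of decoupling\<close>

text \<open>
  Rows \<open>1..d\<close>; the columns \<open>1..n\<close> belong to \<open>A\<close> and the columns \<open>n+1..n+m\<close> to \<open>B\<close>.
\<close>

abbreviation idx :: "nat \<Rightarrow> nat \<Rightarrow> nat \<Rightarrow> (nat \<times> nat) set" where
  "idx n m d \<equiv> {1..d} \<times> {1..n+m}"

lemma tail_norm_nonzero: "\<omega> (d, c) \<noteq> 0 \<Longrightarrow> j \<le> d \<Longrightarrow> tail_norm d j c \<omega> \<noteq> 0"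
proof
  assume h: "\<omega> (d, c) \<noteq> 0" "j \<le> d" "tail_norm d j c \<omega> = 0"
  then have "(\<Sum>k = j..d. (\<omega> (k, c))\<^sup>2) = 0" by (simp add: tail_norm_def)
  then show False using h by (subst (asm) sum_nonneg_eq_0_iff) auto
qed

lemma scale_AE:
  assumes "1 \<le> j" "j \<le> m" "j \<le> d"
  shows "AE \<omega> in gauss (idx n m d). scale n d j \<omega> = tail_norm d j (n + j) \<omega> / sqrt (real d) \<and>
           (scale n d j \<omega>)\<^sup>2 = (\<Sum>k = j..d. (\<omega> (k, n + j))\<^sup>2) / real d"
proof -
  have "AE \<omega> in gauss (idx n m d). \<omega> (d, n + j) \<noteq> 0" using assms by (intro gauss_AE_nonzero) auto
  then show ?thesis
  proof eventually_elim
    case (elim \<omega>)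
    then have "tail_norm d j (n + j) \<omega> \<noteq> 0" using assms by (intro tail_norm_nonzero)
    then show ?case by (simp add: scale_def power_divide) (simp add: tail_norm_def sum_nonneg)
  qed
qed

lemma expectation_scale_sq:
  assumes "1 \<le> j" "j \<le> m" "j \<le> d"
  shows "has_bochner_integral (gauss (idx n m d)) (\<lambda>\<omega>. (scale n d j \<omega>)\<^sup>2) (real (d + 1 - j) / real d)"
proof -
  have "has_bochner_integral (gauss (idx n m d)) (\<lambda>\<omega>. (\<Sum>k = j..d. (\<omega> (k, n + j))\<^sup>2) / real d)
      ((\<Sum>k = j..d. 1) / real d)"
    using assms by (intro has_bochner_integral_divide has_bochner_integral_sum gauss_sq) auto
  moreover have "AE \<omega> in gauss (idx n m d). (scale n d j \<omega>)\<^sup>2 = (\<Sum>k = j..d. (\<omega> (k, n + j))\<^sup>2) / real d"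
    using scale_AE[OF assms, of n] by (auto elim!: eventually_mono)
  ultimately show ?thesis
    using assms by (subst has_bochner_integral_cong_AE[where g = "\<lambda>\<omega>. (\<Sum>k = j..d. (\<omega> (k, n + j))\<^sup>2) / real d"])
      (auto simp: Suc_diff_le)
qed

lemma expectation_inverse_scale_sq:
  assumes "1 \<le> j" "j \<le> m" "j + 2 \<le> d"
  shows "has_bochner_integral (gauss (idx n m d)) (\<lambda>\<omega>. 1 / (scale n d j \<omega>)\<^sup>2) (real d / (real d - real j - 1))"
proof (rule has_bochner_integral_nn_integral)
  let ?A = "{j..d} \<times> {n + j}"
  have A: "?A \<subseteq> idx n m d" "3 \<le> card ?A" "finite (idx n m d)" using assms by auto
  have sumA: "(\<Sum>p\<in>?A. (\<omega> p)\<^sup>2) = (\<Sum>k = j..d. (\<omega> (k, n + j))\<^sup>2)" for \<omega> :: "nat \<times> nat \<Rightarrow> real"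
    by (simp add: sum.cartesian_product')
  have "AE \<omega> in gauss (idx n m d). (scale n d j \<omega>)\<^sup>2 = (\<Sum>k = j..d. (\<omega> (k, n + j))\<^sup>2) / real d"
    using scale_AE[of j m d n] assms by (auto elim!: eventually_mono)
  then have "(\<integral>\<^sup>+\<omega>. ennreal (1 / (scale n d j \<omega>)\<^sup>2) \<partial>gauss (idx n m d))
     = (\<integral>\<^sup>+\<omega>. ennreal (real d) * ennreal (1 / (\<Sum>p\<in>?A. (\<omega> p)\<^sup>2)) \<partial>gauss (idx n m d))"
    by (intro nn_integral_cong_AE) (auto elim!: eventually_mono simp: sumA ennreal_mult[symmetric] sum_nonneg)
  also have "\<dots> = ennreal (real d) * ennreal (1 / (real (card ?A) - 2))"
    by (subst nn_integral_cmult) (measurable, simp only: gauss_inverse_chi_square[OF A(3,1,2)])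
  also have "\<dots> = ennreal (real d / (real d - real j - 1))"
    using assms by (simp add: ennreal_mult[symmetric] card_cartesian_product of_nat_diff algebra_simps)
  finally show "(\<integral>\<^sup>+\<omega>. ennreal (1 / (scale n d j \<omega>)\<^sup>2) \<partial>gauss (idx n m d)) = ennreal (real d / (real d - real j - 1))" .
qed (use assms in auto)

lemma scale_free: "(\<And>k. k \<in> {j..d} \<Longrightarrow> (k, n + j) \<notin> C) \<Longrightarrow> free_of C (scale n d j)"
  unfolding free_of_def by (intro allI impI scale_cong) auto

text \<open>
  The entry is linear in \<open>\<omega> (j, i)\<close> and in the coefficients \<open>\<omega> (l, n + j)\<close> with \<open>l < j\<close>. The squared
  length of the tail has mean \<open>d + 1 - j\<close>, and the \<open>j - 1\<close> other terms supply the rest of \<open>d\<close>.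
\<close>

lemma expectation_entry_sq:
  assumes ij: "1 \<le> i" "i \<le> n" "1 \<le> j" "j \<le> m" "j \<le> d"
  shows "has_bochner_integral (gauss (idx n m d)) (\<lambda>\<omega>. (entry n d i j \<omega>)\<^sup>2) 1"
proof -
  define B where "B = {1..<j} \<times> {n + j}"
  define c where "c = (\<lambda>p \<omega>. if p = (j, i) then scale n d j \<omega> else \<omega> (fst p, i) / sqrt (real d))"
  have B: "(j, i) \<notin> B" "finite B" using ij by (auto simp: B_def)
  have cB: "c p = (\<lambda>\<omega>. \<omega> (fst p, i) / sqrt (real d))" if "p \<in> B" for p
    using that ij by (auto simp: c_def B_def)
  have eq: "(\<Sum>p\<in>insert (j, i) B. c p \<omega> * \<omega> p) = entry n d i j \<omega>" for \<omega>
  proof -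
    have "(\<Sum>p\<in>B. c p \<omega> * \<omega> p) = (\<Sum>p\<in>B. \<omega> (fst p, i) / sqrt (real d) * \<omega> p)"
      by (intro sum.cong) (auto simp: cB)
    then show ?thesis using B by (simp add: entry_def c_def B_def sum.cartesian_product')
  qed
  have "has_bochner_integral (gauss (idx n m d)) (\<lambda>\<omega>. (scale n d j \<omega>)\<^sup>2 + (\<Sum>l = 1..<j. (\<omega> (l, i))\<^sup>2 / real d))
      (real (d + 1 - j) / real d + (\<Sum>l = 1..<j. 1 / real d))"
    using ij by (intro has_bochner_integral_add expectation_scale_sq has_bochner_integral_sum
        has_bochner_integral_divide gauss_sq) auto
  moreover have "real (d + 1 - j) / real d + (\<Sum>l = 1..<j. 1 / real d) = 1"
    using ij by (simp add: field_simps of_nat_diff)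
  moreover have "(scale n d j \<omega>)\<^sup>2 + (\<Sum>l = 1..<j. (\<omega> (l, i))\<^sup>2 / real d) = (\<Sum>p\<in>insert (j, i) B. (c p \<omega>)\<^sup>2)" for \<omega>
  proof -
    have "(\<Sum>p\<in>B. (c p \<omega>)\<^sup>2) = (\<Sum>p\<in>B. (\<omega> (fst p, i))\<^sup>2 / real d)"
      by (intro sum.cong) (auto simp: cB power_divide)
    then show ?thesis using B by (simp add: c_def B_def sum.cartesian_product')
  qed
  ultimately have v: "has_bochner_integral (gauss (idx n m d)) (\<lambda>\<omega>. \<Sum>p\<in>insert (j, i) B. (c p \<omega>)\<^sup>2) 1" by simp
  have "has_bochner_integral (gauss (idx n m d)) (\<lambda>\<omega>. (\<Sum>p\<in>insert (j, i) B. c p \<omega> * \<omega> p)\<^sup>2) 1"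
  proof (rule gauss_linear_sq[OF _ _ _ _ v])
    show "insert (j, i) B \<subseteq> idx n m d" using ij by (auto simp: B_def)
    fix p assume p: "p \<in> insert (j, i) B"
    show "c p \<in> borel_measurable (fun_space (idx n m d))"
      unfolding c_def by (cases "p = (j, i)") simp_all
    show "free_of (insert (j, i) B) (c p)"
    proof (cases "p = (j, i)")
      case True
      then show ?thesis using ij by (auto simp: c_def B_def intro!: scale_free)
    next
      case False
      then show ?thesis using p ij unfolding c_def by (auto simp: free_of_def B_def)
    qed
  qed simp
  then show ?thesis by (simp only: eq)
qed

lemma expectation_row_inner_sq:
  assumes "1 \<le> l" "l \<le> d" "1 \<le> k" "k \<le> d" "k \<noteq> l"
  shows "has_bochner_integral (gauss (idx n m d)) (\<lambda>\<omega>. (\<Sum>i = 1..n. \<omega> (l, i) * \<omega> (k, i))\<^sup>2) (real n)"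
proof -
  have "has_bochner_integral (gauss (idx n m d)) (\<lambda>\<omega>. (\<Sum>p\<in>{k} \<times> {1..n}. \<omega> (l, snd p) * \<omega> p)\<^sup>2) (real n)"
  proof (rule gauss_linear_sq)
    have "has_bochner_integral (gauss (idx n m d)) (\<lambda>\<omega>. \<Sum>p\<in>{k} \<times> {1..n}. (\<omega> (l, snd p))\<^sup>2) (\<Sum>p\<in>{k} \<times> {1..n}. 1)"
      using assms by (intro has_bochner_integral_sum gauss_sq) auto
    then show "has_bochner_integral (gauss (idx n m d)) (\<lambda>\<omega>. \<Sum>p\<in>{k} \<times> {1..n}. (\<omega> (l, snd p))\<^sup>2) (real n)"
      by simp
  qed (use assms in auto)
  then show ?thesis by (simp add: sum.cartesian_product')
qed

lemma expectation_row_norm_deviation: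
  assumes "1 \<le> l" "l \<le> d"
  shows "has_bochner_integral (gauss (idx n m d)) (\<lambda>\<omega>. (1 - (\<Sum>i = 1..n. \<omega> (l, i) * \<omega> (l, i)) / real d)\<^sup>2)
    (1 - 2 * real n / real d + (real n ^ 2 + 2 * real n) / (real d)\<^sup>2)"
proof -
  have 1: "has_bochner_integral (gauss (idx n m d)) (\<lambda>\<omega>. \<Sum>i = 1..n. \<omega> (l, i) * \<omega> (l, i)) (\<Sum>i = 1..n. 1)"
    using assms gauss_sq[of "idx n m d"] by (intro has_bochner_integral_sum) (auto simp: power2_eq_square)
  have 2: "has_bochner_integral (gauss (idx n m d))
      (\<lambda>\<omega>. \<Sum>i = 1..n. \<Sum>i' = 1..n. \<omega> (l, i) * \<omega> (l, i) * \<omega> (l, i') * \<omega> (l, i'))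
      (\<Sum>i = 1..n. \<Sum>i' = 1..n. 1 + 2 * kron i i')"
  proof (intro has_bochner_integral_sum)
    fix i i' assume "i \<in> {1..n}" "i' \<in> {1..n}"
    then show "has_bochner_integral (gauss (idx n m d)) (\<lambda>\<omega>. \<omega> (l, i) * \<omega> (l, i) * \<omega> (l, i') * \<omega> (l, i')) (1 + 2 * kron i i')"
      using gauss_isserlis_coordinates[of "idx n m d" "(l, i)" "(l, i)" "(l, i')" "(l, i')"] assms
      by (cases "i = i'") auto
  qed
  have s2: "(\<Sum>i = 1..n. \<Sum>i' = 1..n. 1 + 2 * kron i i') = real n ^ 2 + 2 * real n"
  proof -
    have "(\<Sum>i = 1..n. \<Sum>i' = 1..n. 1 + 2 * kron i i') = (\<Sum>i = 1..n. real n + 2)"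
    proof (intro sum.cong refl)
      fix i assume "i \<in> {1..n}"
      then show "(\<Sum>i' = 1..n. 1 + 2 * kron i i') = real n + 2"
        using sum_kron[of "{1..n}" i "\<lambda>_. 2"] by (simp add: sum.distrib)
    qed
    then show ?thesis by (simp add: power2_eq_square algebra_simps)
  qed
  have "has_bochner_integral (gauss (idx n m d)) (\<lambda>\<omega>. 1 - (\<Sum>i = 1..n. \<omega> (l, i) * \<omega> (l, i)) * (2 / real d)
      + (\<Sum>i = 1..n. \<Sum>i' = 1..n. \<omega> (l, i) * \<omega> (l, i) * \<omega> (l, i') * \<omega> (l, i')) * (1 / (real d)\<^sup>2))
      (1 - (\<Sum>i = 1..n. 1) * (2 / real d) + (real n ^ 2 + 2 * real n) * (1 / (real d)\<^sup>2))"
    using 2 unfolding s2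
    by (intro has_bochner_integral_add has_bochner_integral_diff has_bochner_integral_mult_left 1 gauss_const)
  moreover have "1 - (\<Sum>i = 1..n. \<omega> (l, i) * \<omega> (l, i)) * (2 / real d)
      + (\<Sum>i = 1..n. \<Sum>i' = 1..n. \<omega> (l, i) * \<omega> (l, i) * \<omega> (l, i') * \<omega> (l, i')) * (1 / (real d)\<^sup>2)
      = (1 - (\<Sum>i = 1..n. \<omega> (l, i) * \<omega> (l, i)) / real d)\<^sup>2" for \<omega> :: "nat \<times> nat \<Rightarrow> real"
  proof -
    have "(\<Sum>i = 1..n. \<Sum>i' = 1..n. \<omega> (l, i) * \<omega> (l, i) * \<omega> (l, i') * \<omega> (l, i')) = (\<Sum>i = 1..n. \<omega> (l, i) * \<omega> (l, i))\<^sup>2"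
      by (simp add: power2_eq_square sum_product mult.assoc)
    then show ?thesis by (simp add: power2_diff power_divide)
  qed
  ultimately show ?thesis by (simp add: mult.commute)
qed

text \<open>
  The residual is linear in row \<open>j\<close> of \<open>A\<close> and in the coefficients of column \<open>j\<close>; the other rows of \<open>A\<close>
  enter through their inner products. The gain \<open>n / d\<close> compared with the variance 1 of the
  coefficient itself is what pays for the mean deficit of the scale factors.
\<close>

lemma expectation_residual_sq:
  assumes lj: "1 \<le> l" "l < j" "j \<le> m" "j \<le> d"
  shows "has_bochner_integral (gauss (idx n m d)) (\<lambda>\<omega>. (residual n d l j \<omega>)\<^sup>2)
    (1 - real n / real d + (real n ^ 2 + real n) / (real d)\<^sup>2)"
proof -
  define A where "A = {j} \<times> {1..n}"
  define B where "B = {1..<j} \<times> {n + j}"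
  define g where "g = (\<lambda>(k::nat) (\<omega> :: nat \<times> nat \<Rightarrow> real). \<Sum>i = 1..n. \<omega> (l, i) * \<omega> (k, i))"
  define c where "c = (\<lambda>p \<omega>. if fst p = j then - (scale n d j \<omega> * \<omega> (l, snd p) / sqrt (real d)) else kron l (fst p) - g (fst p) \<omega> / real d)"
  have fin: "finite A" "finite B" "A \<inter> B = {}" by (auto simp: A_def B_def)
  have d: "0 < real d" using lj by simp
  have gm [measurable]: "g k \<in> borel_measurable (fun_space I)" for k I unfolding g_def by measurable
  have split: "(\<Sum>p\<in>A \<union> B. f p) = (\<Sum>i = 1..n. f (j, i)) + (\<Sum>k = 1..<j. f (k, n + j))" for f :: "nat \<times> nat \<Rightarrow> real"
    using fin by (simp add: sum.union_disjoint) (simp add: A_def B_def sum.cartesian_product')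
  have eq: "(\<Sum>p\<in>A \<union> B. c p \<omega> * \<omega> p) = residual n d l j \<omega>" for \<omega>
  proof -
    have "(\<Sum>k = 1..<j. c (k, n + j) \<omega> * \<omega> (k, n + j))
        = (\<Sum>k = 1..<j. \<omega> (k, n + j) * kron l k - g k \<omega> * \<omega> (k, n + j) / real d)"
      by (intro sum.cong) (auto simp: c_def algebra_simps)
    also have "\<dots> = \<omega> (l, n + j) - (\<Sum>k = 1..<j. g k \<omega> * \<omega> (k, n + j) / real d)"
      using lj sum_kron[of "{1..<j}" l "\<lambda>k. \<omega> (k, n + j)"] by (simp only: sum_subtractf) simp
    also have "(\<Sum>k = 1..<j. g k \<omega> * \<omega> (k, n + j) / real d)
        = (\<Sum>i = 1..n. \<Sum>k = 1..<j. \<omega> (l, i) * \<omega> (k, i) * \<omega> (k, n + j) / real d)"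
      unfolding g_def sum_distrib_right sum_divide_distrib by (rule sum.swap)
    finally have 1: "(\<Sum>k = 1..<j. c (k, n + j) \<omega> * \<omega> (k, n + j)) = \<omega> (l, n + j)
        - (\<Sum>i = 1..n. \<Sum>k = 1..<j. \<omega> (l, i) * \<omega> (k, i) * \<omega> (k, n + j) / real d)" .
    have 2: "\<omega> (l, i) * entry n d i j \<omega> / sqrt (real d) = scale n d j \<omega> * \<omega> (l, i) / sqrt (real d) * \<omega> (j, i)
        + (\<Sum>k = 1..<j. \<omega> (l, i) * \<omega> (k, i) * \<omega> (k, n + j) / real d)" for i
    proof -
      have "\<omega> (l, i) * (\<omega> (k, i) / sqrt (real d) * \<omega> (k, n + j)) / sqrt (real d)
          = \<omega> (l, i) * \<omega> (k, i) * \<omega> (k, n + j) / (sqrt (real d) * sqrt (real d))" for k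
        by simp
      then have h: "\<omega> (l, i) * (\<omega> (k, i) / sqrt (real d) * \<omega> (k, n + j)) / sqrt (real d)
          = \<omega> (l, i) * \<omega> (k, i) * \<omega> (k, n + j) / real d" for k
        by (simp only: real_sqrt_mult_self abs_of_nat)
      show ?thesis
        by (simp only: entry_def distrib_left add_divide_distrib sum_distrib_left sum_divide_distrib h) (simp add: mult_ac)
    qed
    have "residual n d l j \<omega> = \<omega> (l, n + j) - (\<Sum>i = 1..n. \<omega> (l, i) * entry n d i j \<omega> / sqrt (real d))"
      by (simp add: residual_def sum_divide_distrib)
    also have "\<dots> = \<omega> (l, n + j) - ((\<Sum>i = 1..n. scale n d j \<omega> * \<omega> (l, i) / sqrt (real d) * \<omega> (j, i))
       + (\<Sum>i = 1..n. \<Sum>k = 1..<j. \<omega> (l, i) * \<omega> (k, i) * \<omega> (k, n + j) / real d))"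
      unfolding 2 sum.distrib ..
    finally show ?thesis unfolding split 1 by (simp add: c_def sum_negf)
  qed
  have sA: "has_bochner_integral (gauss (idx n m d)) (\<lambda>\<omega>. \<Sum>i = 1..n. (scale n d j \<omega> * \<omega> (l, i))\<^sup>2 / real d)
      (\<Sum>i = 1..n. real (d + 1 - j) / real d / real d)"
    using lj by (intro has_bochner_integral_sum has_bochner_integral_divide gauss_mult_sq expectation_scale_sq scale_free) auto
  have sB: "has_bochner_integral (gauss (idx n m d)) (\<lambda>\<omega>. \<Sum>k\<in>{1..<j} - {l}. (g k \<omega>)\<^sup>2 / (real d)\<^sup>2)
      (\<Sum>k\<in>{1..<j} - {l}. real n / (real d)\<^sup>2)"
    unfolding g_def using lj
    by (intro has_bochner_integral_sum has_bochner_integral_divide expectation_row_inner_sq) auto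
  have sl: "has_bochner_integral (gauss (idx n m d)) (\<lambda>\<omega>. (1 - g l \<omega> / real d)\<^sup>2)
      (1 - 2 * real n / real d + (real n ^ 2 + 2 * real n) / (real d)\<^sup>2)"
    unfolding g_def using lj by (intro expectation_row_norm_deviation) auto
  have val: "(\<Sum>i = 1..n. real (d + 1 - j) / real d / real d) + ((1 - 2 * real n / real d + (real n ^ 2 + 2 * real n) / (real d)\<^sup>2)
      + (\<Sum>k\<in>{1..<j} - {l}. real n / (real d)\<^sup>2)) = 1 - real n / real d + (real n ^ 2 + real n) / (real d)\<^sup>2"
  proof -
    have "card ({1..<j} - {l}) = j - 2" using lj by (subst card_Diff_singleton) auto
    then have 1: "(\<Sum>k\<in>{1..<j} - {l}. real n / (real d)\<^sup>2) = (real j - 2) * real n / (real d)\<^sup>2"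
      using lj by (simp add: of_nat_diff)
    have 2: "(\<Sum>i = 1..n. real (d + 1 - j) / real d / real d) = real n * (real d + 1 - real j) / (real d)\<^sup>2"
      using lj by (simp add: of_nat_diff power2_eq_square)
    show ?thesis unfolding 1 2 using d by (simp add: field_simps power2_eq_square)
  qed
  have sq: "(\<Sum>p\<in>A \<union> B. (c p \<omega>)\<^sup>2) = (\<Sum>i = 1..n. (scale n d j \<omega> * \<omega> (l, i))\<^sup>2 / real d)
      + ((1 - g l \<omega> / real d)\<^sup>2 + (\<Sum>k\<in>{1..<j} - {l}. (g k \<omega>)\<^sup>2 / (real d)\<^sup>2))" for \<omega>
  proof -
    have "(\<Sum>k = 1..<j. (c (k, n + j) \<omega>)\<^sup>2) = (c (l, n + j) \<omega>)\<^sup>2 + (\<Sum>k\<in>{1..<j} - {l}. (c (k, n + j) \<omega>)\<^sup>2)"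
      using lj by (intro sum.remove) auto
    moreover have "(\<Sum>k\<in>{1..<j} - {l}. (c (k, n + j) \<omega>)\<^sup>2) = (\<Sum>k\<in>{1..<j} - {l}. (g k \<omega>)\<^sup>2 / (real d)\<^sup>2)"
      by (intro sum.cong) (auto simp: c_def power_divide)
    moreover have "(c (l, n + j) \<omega>)\<^sup>2 = (1 - g l \<omega> / real d)\<^sup>2" using lj by (simp add: c_def)
    moreover have "(\<Sum>i = 1..n. (c (j, i) \<omega>)\<^sup>2) = (\<Sum>i = 1..n. (scale n d j \<omega> * \<omega> (l, i))\<^sup>2 / real d)"
      by (intro sum.cong) (auto simp: c_def power_divide)
    ultimately show ?thesis unfolding split by simp
  qed
  have v: "has_bochner_integral (gauss (idx n m d)) (\<lambda>\<omega>. \<Sum>p\<in>A \<union> B. (c p \<omega>)\<^sup>2)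
      (1 - real n / real d + (real n ^ 2 + real n) / (real d)\<^sup>2)"
    unfolding sq val[symmetric] by (intro has_bochner_integral_add sA sB sl)
  have "has_bochner_integral (gauss (idx n m d)) (\<lambda>\<omega>. (\<Sum>p\<in>A \<union> B. c p \<omega> * \<omega> p)\<^sup>2)
      (1 - real n / real d + (real n ^ 2 + real n) / (real d)\<^sup>2)"
  proof (rule gauss_linear_sq[OF _ _ _ _ v])
    show "A \<union> B \<subseteq> idx n m d" using lj by (auto simp: A_def B_def)
    fix p assume p: "p \<in> A \<union> B"
    show "c p \<in> borel_measurable (fun_space (idx n m d))"
      unfolding c_def by (cases "fst p = j") simp_all
    show "free_of (A \<union> B) (c p)"
      unfolding free_of_def
    proof (intro allI impI)
      fix \<omega> \<omega>' :: "nat \<times> nat \<Rightarrow> real" assume h: "\<forall>q. q \<notin> A \<union> B \<longrightarrow> \<omega> q = \<omega>' q"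
      have "scale n d j \<omega> = scale n d j \<omega>'" using h lj by (intro scale_cong) (auto simp: A_def B_def)
      moreover have "\<omega> (l, i) = \<omega>' (l, i)" if "i \<le> n" for i using h that lj by (auto simp: A_def B_def)
      moreover have "g k \<omega> = g k \<omega>'" if "k \<noteq> j" for k
        unfolding g_def using h that lj by (intro sum.cong arg_cong2[where f = "(*)"]) (auto simp: A_def B_def)
      ultimately show "c p \<omega> = c p \<omega>'" using p by (auto simp: c_def A_def B_def)
    qed
  qed simp
  then show ?thesis by (simp only: eq)
qed

text \<open>
  An upper bound for \<open>- ln likelihood\<close> in which the logarithms of the scale factors are replaced by
  inverse squares; its mean is explicit.
\<close>

definition log_cost :: "nat \<Rightarrow> nat \<Rightarrow> nat \<Rightarrow> (nat \<times> nat \<Rightarrow> real) \<Rightarrow> real" where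
  "log_cost n m d \<omega> = (sq_norm (idx n m d) (to_independent n d m \<omega>) - sq_norm (idx n m d) \<omega>) / 2
     + (\<Sum>j = 1..m. real n / 2 * (1 / (scale n d j \<omega>)\<^sup>2 - 1))"

lemma neg_ln_likelihood_le:
  assumes "1 \<le> d"
  shows "- ln (likelihood n m d \<omega>) \<le> log_cost n m d \<omega>" "0 < likelihood n m d \<omega>"
proof -
  define D where "D = (sq_norm (idx n m d) (to_independent n d m \<omega>) - sq_norm (idx n m d) \<omega>) / 2"
  have sp: "0 < scale n d j \<omega>" for j by (rule scale_pos[OF assms])
  have L: "likelihood n m d \<omega> = (\<Prod>j = 1..m. scale n d j \<omega> ^ n) * exp (- D)"
  proof -
    have "- (sq_norm (idx n m d) (to_independent n d m \<omega>) - sq_norm (idx n m d) \<omega>) / 2 = - D"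
      unfolding D_def by (rule minus_divide_left[symmetric])
    then show ?thesis unfolding likelihood_def by (simp only:)
  qed
  have P: "0 < (\<Prod>j = 1..m. scale n d j \<omega> ^ n)" using sp by (intro prod_pos) simp
  then show "0 < likelihood n m d \<omega>" by (simp add: L)
  have "ln (likelihood n m d \<omega>) = (\<Sum>j = 1..m. real n * ln (scale n d j \<omega>)) - D"
  proof -
    have "ln (\<Prod>j = 1..m. scale n d j \<omega> ^ n) = (\<Sum>j = 1..m. ln (scale n d j \<omega> ^ n))"
      using sp[THEN less_imp_neq, symmetric] sp by (intro ln_prod) auto
    also have "\<dots> = (\<Sum>j = 1..m. real n * ln (scale n d j \<omega>))"
      using sp by (simp add: ln_realpow)
    finally have "ln (\<Prod>j = 1..m. scale n d j \<omega> ^ n) = (\<Sum>j = 1..m. real n * ln (scale n d j \<omega>))" .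
    moreover have "ln (likelihood n m d \<omega>) = ln (\<Prod>j = 1..m. scale n d j \<omega> ^ n) + ln (exp (- D))"
      unfolding L by (rule ln_mult_pos[OF P]) simp
    ultimately show ?thesis by (simp only: ln_exp)
  qed
  moreover have "- (\<Sum>j = 1..m. real n * ln (scale n d j \<omega>)) \<le> (\<Sum>j = 1..m. real n / 2 * (1 / (scale n d j \<omega>)\<^sup>2 - 1))"
    unfolding sum_negf[symmetric]
  proof (rule sum_mono)
    fix j
    have "ln (1 / (scale n d j \<omega>)\<^sup>2) \<le> 1 / (scale n d j \<omega>)\<^sup>2 - 1"
      using sp[of j] by (intro ln_le_minus_one) simp
    moreover have "ln (1 / (scale n d j \<omega>)\<^sup>2) = - 2 * ln (scale n d j \<omega>)"
      using sp[of j] by (simp add: ln_div ln_realpow)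
    ultimately have "- ln (scale n d j \<omega>) \<le> (1 / (scale n d j \<omega>)\<^sup>2 - 1) / 2" by simp
    from mult_left_mono[OF this, of "real n"]
    show "- (real n * ln (scale n d j \<omega>)) \<le> real n / 2 * (1 / (scale n d j \<omega>)\<^sup>2 - 1)" by simp
  qed
  ultimately show "- ln (likelihood n m d \<omega>) \<le> log_cost n m d \<omega>" by (simp add: log_cost_def D_def)
qed

lemma expectation_log_cost:
  assumes "m + 2 \<le> d"
  shows "has_bochner_integral (gauss (idx n m d)) (log_cost n m d)
    (\<Sum>j = 1..m. real (j - 1) * (- real n / real d + (real n ^ 2 + real n) / (real d)\<^sup>2) / 2
        + real n / 2 * (real d / (real d - real j - 1) - 1))"
proof -
  define I where "I = idx n m d"
  define \<delta> where "\<delta> = - real n / real d + (real n ^ 2 + real n) / (real d)\<^sup>2"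
  \<comment> \<open>The positions that hold residuals; elsewhere the second moment is 1.\<close>
  define S where "S = (\<lambda>p. snd p \<in> {n+1..n+m} \<and> fst p \<in> {1..<snd p - n})"
  have fin: "finite I" by (simp add: I_def)
  have one: "has_bochner_integral (gauss I) (\<lambda>\<omega>. (to_independent n d m \<omega> p)\<^sup>2) (1 + (if S p then \<delta> else 0))"
    if p: "p \<in> I" for p
  proof -
    have p': "1 \<le> fst p" "fst p \<le> d" "1 \<le> snd p" "snd p \<le> n + m" using p by (auto simp: I_def)
    consider "snd p \<in> {1..n} \<and> fst p \<in> {1..m}" | "\<not> (snd p \<in> {1..n} \<and> fst p \<in> {1..m})" "S p"
      | "\<not> (snd p \<in> {1..n} \<and> fst p \<in> {1..m})" "\<not> S p" by blast
    then show ?thesis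
    proof cases
      case 1
      then have "\<not> S p" by (auto simp: S_def)
      then show ?thesis using 1 p' assms expectation_entry_sq[of "snd p" n "fst p" m d]
        by (simp add: to_independent_def I_def)
    next
      case 2
      have "has_bochner_integral (gauss I) (\<lambda>\<omega>. (residual n d (fst p) (snd p - n) \<omega>)\<^sup>2) (1 + \<delta>)"
      proof -
        have eq: "1 + \<delta> = 1 - real n / real d + (real n ^ 2 + real n) / (real d)\<^sup>2" by (simp add: \<delta>_def)
        have "1 \<le> fst p" "fst p < snd p - n" "snd p - n \<le> m" "snd p - n \<le> d"
          using 2(2) assms by (auto simp: S_def)
        then show ?thesis unfolding eq I_def by (rule expectation_residual_sq)
      qed
      then show ?thesis using 2 by (simp add: to_independent_def S_def)
    next
      case 3
      then show ?thesis using gauss_sq[OF fin p] by (auto simp: to_independent_def S_def)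
    qed
  qed
  have 1: "has_bochner_integral (gauss I) (\<lambda>\<omega>. (sq_norm I (to_independent n d m \<omega>) - sq_norm I \<omega>) / 2)
     (((\<Sum>p\<in>I. 1 + (if S p then \<delta> else 0)) - (\<Sum>p\<in>I. 1)) / 2)"
    unfolding sq_norm_def
    by (intro has_bochner_integral_divide has_bochner_integral_diff has_bochner_integral_sum one gauss_sq fin)
  have 2: "has_bochner_integral (gauss I) (\<lambda>\<omega>. \<Sum>j = 1..m. real n / 2 * (1 / (scale n d j \<omega>)\<^sup>2 - 1))
     (\<Sum>j = 1..m. real n / 2 * (real d / (real d - real j - 1) - 1))"
    unfolding I_def using assms
    by (intro has_bochner_integral_sum has_bochner_integral_mult_right has_bochner_integral_diff
        expectation_inverse_scale_sq gauss_const) auto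
  have "(\<Sum>p\<in>I. if S p then \<delta> else 0) = (\<Sum>c = 1..n+m. \<Sum>k = 1..d. if S (k, c) then \<delta> else 0)"
    unfolding I_def by (subst sum.swap) (simp add: sum.cartesian_product')
  also have "\<dots> = (\<Sum>c\<in>{1..n} \<union> {n+1..n+m}. \<Sum>k = 1..d. if S (k, c) then \<delta> else 0)"
    by (intro sum.cong) auto
  also have "\<dots> = (\<Sum>c = 1..n. \<Sum>k = 1..d. if S (k, c) then \<delta> else 0) + (\<Sum>c = n+1..n+m. \<Sum>k = 1..d. if S (k, c) then \<delta> else 0)"
    by (intro sum.union_disjoint) auto
  also have "(\<Sum>c = 1..n. \<Sum>k = 1..d. if S (k, c) then \<delta> else 0) = 0"
    by (intro sum.neutral ballI) (auto simp: S_def)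
  also have "(\<Sum>c = n+1..n+m. \<Sum>k = 1..d. if S (k, c) then \<delta> else 0) = (\<Sum>j = 1..m. \<Sum>k = 1..d. if S (k, j + n) then \<delta> else 0)"
    using sum.shift_bounds_cl_nat_ivl[of "\<lambda>c. \<Sum>k = 1..d. if S (k, c) then \<delta> else 0" 1 n m] by (simp add: add.commute)
  also have "\<dots> = (\<Sum>j = 1..m. real (j - 1) * \<delta>)"
  proof (intro sum.cong refl)
    fix j assume j: "j \<in> {1..m}"
    have "{1..d} \<inter> {k. S (k, j + n)} = {1..<j}" using j assms by (auto simp: S_def)
    then have "(\<Sum>k\<in>{1..d} \<inter> {k. S (k, j + n)}. \<delta>) = real (j - 1) * \<delta>" by simp
    then show "(\<Sum>k = 1..d. if S (k, j + n) then \<delta> else 0) = real (j - 1) * \<delta>"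
      by (subst (asm) sum.inter_restrict) simp_all
  qed
  finally have S: "(\<Sum>p\<in>I. if S p then \<delta> else 0) = (\<Sum>j = 1..m. real (j - 1) * \<delta>)" by simp
  have "has_bochner_integral (gauss I) (log_cost n m d)
     (((\<Sum>p\<in>I. 1 + (if S p then \<delta> else 0)) - (\<Sum>p\<in>I. 1)) / 2 + (\<Sum>j = 1..m. real n / 2 * (real d / (real d - real j - 1) - 1)))"
    unfolding log_cost_def[abs_def] I_def[symmetric] by (intro has_bochner_integral_add 1 2)
  moreover have "((\<Sum>p\<in>I. 1 + (if S p then \<delta> else 0)) - (\<Sum>p\<in>I. 1)) / 2 = (\<Sum>j = 1..m. real (j - 1) * \<delta> / 2)"
    by (simp only: sum.distrib S sum_divide_distrib add_diff_cancel_left')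
  ultimately show ?thesis unfolding I_def \<delta>_def by (simp only: sum.distrib)
qed

text \<open>
  In column \<open>j\<close> the inverse square of the scale costs about \<open>n j / (2 d)\<close>, and the residuals give
  \<open>n (j - 1) / (2 d)\<close> back. Summed over \<open>j\<close> either term would be of order \<open>n m\<^sup>2 / d\<close>, which need not be
  small. The difference is of order \<open>n / d\<close> per column up to quadratic errors.
\<close>

lemma log_cost_bound:
  assumes "1 \<le> m" "m \<le> n" "4 * m \<le> d"
  defines "x \<equiv> real (n * m) / real d"
  shows "(\<Sum>j = 1..m. real (j - 1) * (- real n / real d + (real n ^ 2 + real n) / (real d)\<^sup>2) / 2
        + real n / 2 * (real d / (real d - real j - 1) - 1)) \<le> 2 * x + 2 * x\<^sup>2"
proof -
  have "(\<Sum>j = 1..m. real (j - 1) * (- real n / real d + (real n ^ 2 + real n) / (real d)\<^sup>2) / 2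
        + real n / 2 * (real d / (real d - real j - 1) - 1))
     \<le> (\<Sum>j = 1..m. 2 * real n / real d + 2 * real m * real n ^ 2 / (real d)\<^sup>2)"
  proof (rule sum_mono)
    fix j assume j: "j \<in> {1..m}"
    define N M D k where "N = real n" "M = real m" "D = real d" "k = real j"
    have h: "1 \<le> k" "k \<le> M" "M \<le> N" "4 * M \<le> D" "real (j - 1) = k - 1"
      using j assms by (auto simp: N_M_D_k_def of_nat_diff simp flip: of_nat_mult)
    define E where "E = D - k - 1"
    have E: "0 < D" "D / 2 \<le> E" "0 < E" "D = E + k + 1" using h by (auto simp: E_def)
    \<comment> \<open>Here the two terms of order \<open>k / D\<close> cancel.\<close>
    have "D / E - 1 - (k - 1) / D = (2 * D + (k - 1) * (k + 1)) / (D * E)"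
      using E(1,3) unfolding E(4) by (simp add: field_simps)
    also have "\<dots> \<le> (2 * D + (k - 1) * (k + 1)) / (D * (D / 2))"
      using h E by (intro divide_left_mono mult_left_mono mult_pos_pos add_nonneg_nonneg) auto
    also have "\<dots> = 4 / D + 2 * (k\<^sup>2 - 1) / D\<^sup>2"
      using E(1) by (simp add: field_simps power2_eq_square)
    also have "\<dots> \<le> 4 / D + 2 * k\<^sup>2 / D\<^sup>2" by (intro add_left_mono divide_right_mono) auto
    finally have 1: "D / E - 1 - (k - 1) / D \<le> 4 / D + 2 * k\<^sup>2 / D\<^sup>2" .
    have "(k - 1) * (- N / D + t / q) / 2 + N / 2 * (r - 1)
      = N / 2 * (r - 1 - (k - 1) / D) + (k - 1) * t / (2 * q)" for r t q :: real
      by (simp add: algebra_simps diff_divide_distrib add_divide_distrib)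
    then have "(k - 1) * (- N / D + (N ^ 2 + N) / D\<^sup>2) / 2 + N / 2 * (D / E - 1)
      = N / 2 * (D / E - 1 - (k - 1) / D) + (k - 1) * (N\<^sup>2 + N) / (2 * D\<^sup>2)" .
    also have "\<dots> \<le> N / 2 * (4 / D + 2 * k\<^sup>2 / D\<^sup>2) + (k - 1) * (N\<^sup>2 + N) / (2 * D\<^sup>2)"
      using 1 h by (intro add_right_mono mult_left_mono) auto
    also have "\<dots> = 2 * N / D + (N * k\<^sup>2 + (k - 1) * (N\<^sup>2 + N) / 2) / D\<^sup>2"
      by (simp add: distrib_left add_divide_distrib)
    also have "\<dots> \<le> 2 * N / D + (2 * M * N\<^sup>2) / D\<^sup>2"
    proof (intro add_left_mono divide_right_mono)
      have "N * k\<^sup>2 \<le> M * N\<^sup>2"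
      proof -
        have "k * k \<le> M * N" using h by (intro mult_mono) auto
        then have "N * (k * k) \<le> N * (M * N)" using h by (intro mult_left_mono) auto
        then show ?thesis by (simp add: power2_eq_square mult_ac)
      qed
      moreover have "(k - 1) * (N\<^sup>2 + N) \<le> M * (2 * N\<^sup>2)"
      proof (rule mult_mono)
        show "N\<^sup>2 + N \<le> 2 * N\<^sup>2" using h by (simp add: power2_eq_square)
      qed (use h in auto)
      ultimately show "N * k\<^sup>2 + (k - 1) * (N\<^sup>2 + N) / 2 \<le> 2 * M * N\<^sup>2" by simp
    qed simp
    finally show "real (j - 1) * (- real n / real d + (real n ^ 2 + real n) / (real d)\<^sup>2) / 2
        + real n / 2 * (real d / (real d - real j - 1) - 1) \<le> 2 * real n / real d + 2 * real m * real n ^ 2 / (real d)\<^sup>2"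
      unfolding h(5) unfolding E_def N_M_D_k_def .
  qed
  also have "\<dots> = 2 * x + 2 * x\<^sup>2"
    by (simp add: x_def power2_eq_square algebra_simps add_divide_distrib)
  finally show ?thesis .
qed

section \<open>The masked matrices as images of a block\<close>

text \<open>
  Both masked matrices arise from their \<open>n \<times> m\<close> block through this fixed map, and the block can be
  recovered from the image. Total variation can thus be studied on the block.
\<close>

definition embed :: "nat \<Rightarrow> nat \<Rightarrow> (nat \<times> nat \<Rightarrow> real) \<Rightarrow> nat \<times> nat \<Rightarrow> real" where
  "embed n m y = (\<lambda>(i, j) \<in> {1..n+m} \<times> {1..n+m}.
     if i \<le> n \<and> n < j then y (i, j - n) else if j \<le> n \<and> n < i then y (j, i - n) else 0)"

lemma embed_measurable [measurable]:
  "embed n m \<in> measurable (fun_space ({1..n} \<times> {1..m})) (mat_space (n + m))"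
  unfolding embed_def[abs_def]
  by (intro measurable_restrict) (auto split: prod.split)

lemma adj_matrix_complete_bipartite:
  assumes "i \<in> {1..n+m}" "j \<in> {1..n+m}"
  shows "adj_matrix (complete_bipartite n m) i j = (if i \<le> n \<and> n < j \<or> j \<le> n \<and> n < i then 1 else 0)"
proof -
  have "{i, j} \<in> complete_bipartite n m \<longleftrightarrow>
      i \<in> {1..n} \<and> j \<in> {n+1..n+m} \<or> j \<in> {1..n} \<and> i \<in> {n+1..n+m}"
    unfolding complete_bipartite_def mem_Collect_eq doubleton_eq_iff by blast
  also have "\<dots> \<longleftrightarrow> i \<le> n \<and> n < j \<or> j \<le> n \<and> n < i"
    using assms by auto
  finally show ?thesis by (auto simp: adj_matrix_def)
qed

definition gram_block :: "nat \<Rightarrow> nat \<Rightarrow> nat \<Rightarrow> (nat \<times> nat \<Rightarrow> real) \<Rightarrow> nat \<times> nat \<Rightarrow> real" where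
  "gram_block n m d X = (\<lambda>p\<in>{1..n} \<times> {1..m}. (\<Sum>k = 1..d. X (k, fst p) * X (k, n + snd p)) / sqrt (real d))"

lemma gram_block_measurable [measurable]:
  "gram_block n m d \<in> measurable (fun_space I) (fun_space ({1..n} \<times> {1..m}))"
  unfolding gram_block_def[abs_def] by (intro measurable_restrict) measurable

lemma masked_wishart_eq:
  "masked_wishart (n + m) (complete_bipartite n m) d
     = distr (gauss (idx n m d)) (mat_space (n + m)) (\<lambda>X. embed n m (gram_block n m d X))"
proof -
  have "schur_mask (n + m) (complete_bipartite n m) (wishart_matrix (n + m) d X) = embed n m (gram_block n m d X)" for X
    unfolding schur_mask_def embed_def
    by (rule restrict_ext)
       (auto simp: adj_matrix_complete_bipartite wishart_matrix_def gram_block_def mult.commute)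
  then show ?thesis unfolding masked_wishart_def gaussian_matrix_def by simp
qed

text \<open>
  Of the independent entries on and above the diagonal the mask keeps those at \<open>(i, n + j)\<close>, which
  lie strictly above it and have variance 1.
\<close>

lemma masked_goe_eq:
  "masked_goe (n + m) (complete_bipartite n m)
     = distr (gauss ({1..n} \<times> {1..m})) (mat_space (n + m)) (embed n m)"
proof -
  define U where "U = {(i, j). 1 \<le> i \<and> i \<le> j \<and> j \<le> n + m}"
  define K where "K = {1..n} \<times> {1..m}"
  define sd :: "nat \<times> nat \<Rightarrow> real" where "sd p = (if fst p = snd p then sqrt 2 else 1)" for p
  define f where "f = (\<lambda>p :: nat \<times> nat. (fst p, n + snd p))"
  define r where "r = (\<lambda>Z :: nat \<times> nat \<Rightarrow> real. \<lambda>p\<in>K. Z (f p))"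
  define G where "G = (\<Pi>\<^sub>M p\<in>U. density lborel (normal_density 0 (sd p)))"
  have goe: "goe_entries (n + m) = G" by (simp add: goe_entries_def G_def U_def sd_def)
  have setsG [measurable_cong]: "sets G = sets (fun_space U)" unfolding G_def by (intro sets_PiM_cong) auto
  have sym [measurable]: "symmetrize (n + m) \<in> measurable G (mat_space (n + m))"
    unfolding symmetrize_def[abs_def] by (intro measurable_restrict) (auto split: prod.split)
  have r [measurable]: "r \<in> measurable G (fun_space K)"
    unfolding r_def by (intro measurable_restrict) measurable
  have mask [measurable]: "schur_mask (n + m) (complete_bipartite n m) \<in> measurable (mat_space (n + m)) (mat_space (n + m))"
    unfolding schur_mask_def[abs_def] by (intro measurable_restrict) (auto split: prod.split)
  have Keq: "(\<Pi>\<^sub>M p\<in>K. density lborel (normal_density 0 (sd (f p)))) = gauss K"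
    by (intro PiM_cong refl) (auto simp: sd_def f_def K_def)
  have "distr G (\<Pi>\<^sub>M p\<in>K. density lborel (normal_density 0 (sd (f p)))) (\<lambda>Z. \<lambda>p\<in>K. Z (f p))
      = (\<Pi>\<^sub>M p\<in>K. density lborel (normal_density 0 (sd (f p))))"
    unfolding G_def
  proof (rule distr_PiM_reindex)
    show "prob_space (density lborel (\<lambda>x. ennreal (normal_density 0 (sd p) x)))" for p
      by (rule prob_space_normal_density) (simp add: sd_def)
    show "inj_on f K" by (auto simp: inj_on_def f_def)
    show "f \<in> K \<rightarrow> U" by (auto simp: f_def K_def U_def)
  qed
  then have "distr G (gauss K) r = gauss K" unfolding r_def Keq .
  then have gK: "distr G (fun_space K) r = gauss K"
    using distr_cong[OF refl sets_gauss refl, of G K r] by simp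
  have eq: "schur_mask (n + m) (complete_bipartite n m) (symmetrize (n + m) Z) = embed n m (r Z)" for Z
    unfolding schur_mask_def embed_def
    by (rule restrict_ext)
      (auto simp: adj_matrix_complete_bipartite symmetrize_def r_def f_def K_def min_def max_def)
  have "masked_goe (n + m) (complete_bipartite n m) = distr G (mat_space (n + m)) (\<lambda>Z. embed n m (r Z))"
    unfolding masked_goe_def goe_def goe distr_distr[OF mask sym] by (simp only: comp_def eq)
  also have "\<dots> = distr (distr G (fun_space K) r) (mat_space (n + m)) (embed n m)"
    unfolding distr_distr[OF embed_measurable[of n m, folded K_def] r] by (simp only: comp_def)
  finally show ?thesis unfolding gK unfolding K_def .
qed

lemma emeasure_distr_nn_integral:
  assumes f: "f \<in> measurable M N" and A: "A \<in> sets N"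
  shows "emeasure (distr M N f) A = (\<integral>\<^sup>+x. indicator A (f x) \<partial>M)"
proof -
  have "emeasure (distr M N f) A = (\<integral>\<^sup>+y. indicator A y \<partial>distr M N f)" using A by simp
  also have "\<dots> = (\<integral>\<^sup>+x. indicator A (f x) \<partial>M)"
    using A by (intro nn_integral_distr[OF f]) simp
  finally show ?thesis .
qed

lemma tv_dist_bounds:
  assumes "prob_space P" "prob_space Q"
  shows "0 \<le> tv_dist P Q" "\<And>A. A \<in> sets P \<Longrightarrow> \<bar>measure P A - measure Q A\<bar> \<le> tv_dist P Q" "tv_dist P Q \<le> 1"
proof -
  have b: "\<bar>measure P A - measure Q A\<bar> \<le> 1" for A
    using prob_space.prob_le_1[OF assms(1), of A] prob_space.prob_le_1[OF assms(2), of A]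
      measure_nonneg[of P A] measure_nonneg[of Q A] by linarith
  then have bdd: "bdd_above ((\<lambda>A. \<bar>measure P A - measure Q A\<bar>) ` sets P)" by (intro bdd_aboveI2)
  show le: "\<bar>measure P A - measure Q A\<bar> \<le> tv_dist P Q" if "A \<in> sets P" for A
    unfolding tv_dist_def using that bdd by (rule cSUP_upper)
  show "0 \<le> tv_dist P Q" using le[OF sets.empty_sets] by simp
  show "tv_dist P Q \<le> 1" unfolding tv_dist_def using b by (intro cSUP_least) auto
qed

lemma prob_space_masked:
  "prob_space (masked_wishart (n + m) (complete_bipartite n m) d)"
  "prob_space (masked_goe (n + m) (complete_bipartite n m))"
proof -
  have 1: "(\<lambda>X. embed n m (gram_block n m d X)) \<in> measurable (gauss (idx n m d)) (mat_space (n + m))"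
    unfolding measurable_gauss by (rule measurable_compose[OF gram_block_measurable embed_measurable])
  have 2: "embed n m \<in> measurable (gauss ({1..n} \<times> {1..m})) (mat_space (n + m))"
    unfolding measurable_gauss by (rule embed_measurable)
  show "prob_space (masked_wishart (n + m) (complete_bipartite n m) d)"
    unfolding masked_wishart_eq by (rule prob_space.prob_space_distr[OF prob_space_gauss 1])
  show "prob_space (masked_goe (n + m) (complete_bipartite n m))"
    unfolding masked_goe_eq by (rule prob_space.prob_space_distr[OF prob_space_gauss 2])
qed

section \<open>Total variation for large dimension\<close>

text \<open>
  Both laws are represented on the same Gaussian space: the Wishart block as the triangular
  \<open>entry\<close> matrix, and the GOE block as the same matrix under the measure with density
  \<open>likelihood\<close>.
\<close>

lemma tv_dist_masked_le:
  assumes m: "1 \<le> m" "m \<le> n" "4 * m \<le> d"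
  defines "x \<equiv> real (n * m) / real d"
  shows "tv_dist (masked_wishart (n + m) (complete_bipartite n m) d) (masked_goe (n + m) (complete_bipartite n m))
      \<le> 2 * sqrt (2 * x + 2 * x\<^sup>2)"
  unfolding tv_dist_def
proof (rule cSUP_least)
  let ?W = "masked_wishart (n + m) (complete_bipartite n m) d"
  let ?M = "masked_goe (n + m) (complete_bipartite n m)"
  show "sets ?W \<noteq> {}" using sets.empty_sets by blast
  fix A assume "A \<in> sets ?W"
  then have A [measurable]: "A \<in> sets (mat_space (n + m))" by (simp add: masked_wishart_eq)
  define I where "I = idx n m d"
  define K where "K = {1..n} \<times> {1..m}"
  have d: "m + 2 \<le> d" "m < d" "m \<le> d" "1 \<le> d" using m by auto
  have emb [measurable]: "embed n m \<in> measurable (fun_space K) (mat_space (n + m))"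
    unfolding K_def by (rule embed_measurable)
  have fI: "finite I" by (simp add: I_def)
  interpret prob_space "gauss I" by (rule prob_space_gauss)
  define h where "h = (\<lambda>\<omega>. \<lambda>p\<in>K. entry n d (fst p) (snd p) \<omega>)"
  have hm [measurable]: "h \<in> measurable (fun_space I) (fun_space K)"
    unfolding h_def by (intro measurable_restrict entry_measurable)
  define F :: "(nat \<times> nat \<Rightarrow> real) \<Rightarrow> ennreal" where "F = (\<lambda>y. indicator A (embed n m y))"
  have Fm [measurable]: "F \<in> borel_measurable (fun_space K)" unfolding F_def by measurable
  \<comment> \<open>The triangular form is stated for the block without the factor \<open>1 / sqrt d\<close>.\<close>
  define F' where "F' = (\<lambda>y. F (\<lambda>p\<in>K. y p / sqrt (real d)))"
  have F'm: "F' \<in> borel_measurable (fun_space K)"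
  proof -
    have "(\<lambda>y. \<lambda>p\<in>K. y p / sqrt (real d)) \<in> measurable (fun_space K) (fun_space K)"
      by (intro measurable_restrict) measurable
    then show ?thesis unfolding F'_def using Fm by (rule measurable_compose)
  qed
  define E where "E = {\<omega> \<in> space (gauss I). embed n m (h \<omega>) \<in> A}"
  have E [measurable]: "E \<in> events"
  proof -
    have "(\<lambda>\<omega>. embed n m (h \<omega>)) \<in> measurable (gauss I) (mat_space (n + m))"
      unfolding measurable_gauss by (rule measurable_compose[OF hm emb])
    from measurable_sets[OF this A] show ?thesis by (simp add: E_def vimage_def Int_def conj_commute)
  qed
  have FE: "F (h \<omega>) = indicator E \<omega>" if "\<omega> \<in> space (gauss I)" for \<omega>
    using that by (simp add: F_def E_def indicator_def)
  have "emeasure ?W A = (\<integral>\<^sup>+X. F (gram_block n m d X) \<partial>gauss I)"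
  proof -
    have g: "(\<lambda>X. embed n m (gram_block n m d X)) \<in> measurable (gauss I) (mat_space (n + m))"
      unfolding measurable_gauss by (rule measurable_compose[OF gram_block_measurable embed_measurable])
    show ?thesis unfolding masked_wishart_eq I_def[symmetric] F_def
      by (rule emeasure_distr_nn_integral[OF g A])
  qed
  also have "\<dots> = (\<integral>\<^sup>+\<omega>. F' (restrict (bartlett n d 0 \<omega>) K) \<partial>gauss I)"
    by (intro nn_integral_cong, unfold F'_def, intro arg_cong[of _ _ F])
      (auto simp: gram_block_def K_def bartlett_def fun_eq_iff)
  also have "\<dots> = (\<integral>\<^sup>+\<omega>. F' (restrict (bartlett n d m \<omega>) K) \<partial>gauss I)"
    unfolding I_def K_def by (rule bartlett_decomposition[OF order_refl d(2) F'm[unfolded K_def]])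
  also have "\<dots> = (\<integral>\<^sup>+\<omega>. F (h \<omega>) \<partial>gauss I)"
  proof (rule nn_integral_cong_AE)
    have "AE \<omega> in gauss I. \<forall>j\<in>{1..m}. scale n d j \<omega> = tail_norm d j (n + j) \<omega> / sqrt (real d)"
    proof (rule AE_finite_allI)
      fix j assume j: "j \<in> {1..m}"
      have "AE \<omega> in gauss (idx n m d). scale n d j \<omega> = tail_norm d j (n + j) \<omega> / sqrt (real d) \<and>
           (scale n d j \<omega>)\<^sup>2 = (\<Sum>k = j..d. (\<omega> (k, n + j))\<^sup>2) / real d"
        using j d by (intro scale_AE) auto
      then show "AE \<omega> in gauss I. scale n d j \<omega> = tail_norm d j (n + j) \<omega> / sqrt (real d)"
        unfolding I_def by (auto elim!: eventually_mono)
    qed simp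
    then show "AE \<omega> in gauss I. F' (restrict (bartlett n d m \<omega>) K) = F (h \<omega>)"
    proof eventually_elim
      case (elim \<omega>)
      have "(\<lambda>p\<in>K. restrict (bartlett n d m \<omega>) K p / sqrt (real d)) = h \<omega>"
        unfolding h_def
      proof (rule restrict_ext)
        fix p assume p: "p \<in> K"
        then have "snd p \<in> {1..m}" by (auto simp: K_def)
        with elim p show "restrict (bartlett n d m \<omega>) K p / sqrt (real d) = entry n d (fst p) (snd p) \<omega>"
          by (simp add: bartlett_def entry_def add_divide_distrib sum_divide_distrib)
      qed
      then show ?case by (simp add: F'_def)
    qed
  qed
  also have "\<dots> = emeasure (gauss I) E"
    by (subst nn_integral_indicator[OF E, symmetric]) (intro nn_integral_cong FE)
  finally have 1: "measure ?W A = prob E" by (simp add: measure_def)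
  \<comment> \<open>The target block is represented by the first \<open>m\<close> rows of \<open>A\<close>.\<close>
  have reidx: "distr (gauss I) (gauss K) (\<lambda>\<omega>. \<lambda>p\<in>K. \<omega> (snd p, fst p)) = gauss K"
  proof (rule distr_PiM_reindex)
    show "inj_on (\<lambda>p. (snd p, fst p)) K" by (auto simp: inj_on_def)
    show "(\<lambda>p. (snd p, fst p)) \<in> K \<rightarrow> I" using d by (auto simp: K_def I_def)
  qed (rule prob_space_normal_density, simp)
  have rm: "(\<lambda>\<omega>. \<lambda>p\<in>K. \<omega> (snd p, fst p)) \<in> measurable (fun_space I) (fun_space K)"
    by (intro measurable_restrict borel_measurable_coordinate)
  have "emeasure ?M A = (\<integral>\<^sup>+y. F y \<partial>gauss K)"
    unfolding masked_goe_eq K_def[symmetric] F_def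
    by (rule emeasure_distr_nn_integral[OF _ A]) (simp only: measurable_gauss emb)
  also have "\<dots> = (\<integral>\<^sup>+\<omega>. F (\<lambda>p\<in>K. \<omega> (snd p, fst p)) \<partial>gauss I)"
    by (subst reidx[symmetric], subst nn_integral_distr) (use rm in simp_all)
  also have "\<dots> = (\<integral>\<^sup>+\<omega>. F (h \<omega>) * ennreal (likelihood n m d \<omega>) \<partial>gauss I)"
    unfolding I_def K_def h_def by (rule likelihood_change_of_measure[OF d(3) Fm[unfolded K_def], symmetric])
  also have "\<dots> = (\<integral>\<^sup>+\<omega>. ennreal (indicator E \<omega> * likelihood n m d \<omega>) \<partial>gauss I)"
    by (intro nn_integral_cong) (auto simp: FE indicator_def)
  finally have M: "emeasure ?M A = (\<integral>\<^sup>+\<omega>. ennreal (indicator E \<omega> * likelihood n m d \<omega>) \<partial>gauss I)" .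
  have Lm [measurable]: "likelihood n m d \<in> borel_measurable (gauss I)"
    using likelihood_measurable[OF d(3), of n] by (simp add: I_def)
  have 2: "measure ?M A = (\<integral>\<omega>. indicator E \<omega> * likelihood n m d \<omega> \<partial>gauss I)"
    unfolding measure_def M
    by (rule integral_eq_nn_integral[symmetric]) (use neg_ln_likelihood_le(2)[OF d(4)] in \<open>auto simp: less_imp_le\<close>)
  have one: "(\<integral>\<^sup>+\<omega>. ennreal (likelihood n m d \<omega>) \<partial>gauss I) = 1"
  proof -
    have "(\<integral>\<^sup>+\<omega>. ennreal (likelihood n m d \<omega>) \<partial>gauss I) = (\<integral>\<^sup>+\<omega>. 1 \<partial>gauss I)"
      using likelihood_change_of_measure[OF d(3), of "\<lambda>_. 1" n, folded I_def] by (simp only: mult_1 borel_measurable_const)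
    then show ?thesis by (simp add: emeasure_space_1)
  qed
  have cost: "integrable (gauss I) (log_cost n m d)" "expectation (log_cost n m d) \<le> 2 * x + 2 * x\<^sup>2"
    using expectation_log_cost[OF d(1), of n] log_cost_bound[OF m] by (auto simp: has_bochner_integral_iff I_def x_def)
  have "\<bar>prob E - (\<integral>\<omega>. indicator E \<omega> * likelihood n m d \<omega> \<partial>gauss I)\<bar> \<le> 2 * sqrt (expectation (log_cost n m d))"
    by (rule change_of_measure_deviation[OF Lm _ one cost(1) _ E]) (rule neg_ln_likelihood_le[OF d(4)])+
  also have "\<dots> \<le> 2 * sqrt (2 * x + 2 * x\<^sup>2)" using cost(2) by simp
  finally show "\<bar>measure ?W A - measure ?M A\<bar> \<le> 2 * sqrt (2 * x + 2 * x\<^sup>2)" by (simp add: 1 2)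
qed

lemma tv_dist_masked_tendsto_0:
  fixes m d :: "nat \<Rightarrow> nat"
  assumes m: "\<And>n. 1 \<le> n \<Longrightarrow> 1 \<le> m n \<and> m n \<le> n"
    and lim: "(\<lambda>n. real (d n)) \<ggreater> (\<lambda>n. real (n * m n))"
  shows "(\<lambda>n. tv_dist (masked_wishart (n + m n) (complete_bipartite n (m n)) (d n))
                   (masked_goe (n + m n) (complete_bipartite n (m n)))) \<longlonglongrightarrow> 0"
proof (rule tendsto_sandwich[OF _ _ tendsto_const])
  define x where "x = (\<lambda>n. real (n * m n) / real (d n))"
  from lim have top: "filterlim (\<lambda>n. real (d n) / real (n * m n)) at_top sequentially"
    by (simp add: much_greater_def)
  from tendsto_inverse_0_at_top[OF top] have x: "x \<longlonglongrightarrow> 0" by (simp add: x_def)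
  have "(\<lambda>n. 2 * sqrt (2 * x n + 2 * (x n)\<^sup>2)) \<longlonglongrightarrow> 2 * sqrt (2 * 0 + 2 * 0\<^sup>2)"
    by (intro tendsto_intros x)
  then show "(\<lambda>n. 2 * sqrt (2 * x n + 2 * (x n)\<^sup>2)) \<longlonglongrightarrow> 0" by simp
  show "\<forall>\<^sub>F n in sequentially. 0 \<le> tv_dist (masked_wishart (n + m n) (complete_bipartite n (m n)) (d n))
                   (masked_goe (n + m n) (complete_bipartite n (m n)))"
    by (intro always_eventually allI tv_dist_bounds prob_space_masked)
  have "\<forall>\<^sub>F n in sequentially. 4 \<le> real (d n) / real (n * m n)"
    using top by (simp add: filterlim_at_top)
  moreover have "\<forall>\<^sub>F n :: nat in sequentially. 1 \<le> n" by (rule eventually_ge_at_top)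
  ultimately show "\<forall>\<^sub>F n in sequentially. tv_dist (masked_wishart (n + m n) (complete_bipartite n (m n)) (d n))
                   (masked_goe (n + m n) (complete_bipartite n (m n))) \<le> 2 * sqrt (2 * x n + 2 * (x n)\<^sup>2)"
  proof eventually_elim
    case (elim n)
    have mn: "1 \<le> m n" "m n \<le> n" using m[OF elim(2)] by auto
    have "0 < real (n * m n)" using mn elim(2) by simp
    then have "4 * real (n * m n) \<le> real (d n)" using elim(1) by (simp only: pos_le_divide_eq)
    then have "4 * (n * m n) \<le> d n" using of_nat_le_iff[of "4 * (n * m n)" "d n", where 'a = real] by simp
    moreover have "m n \<le> n * m n" using elim(2) by simp
    ultimately have "4 * m n \<le> d n" by linarith
    then show ?case unfolding x_def by (rule tv_dist_masked_le[OF mn])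
  qed
qed

section \<open>Concentration of the overlap of two scatter matrices\<close>

text \<open>
  Functions of disjoint sets of coordinates are independent. Integrability of the product is part
  of the claim, since it is needed for polynomials of degree 8 in the coordinates.
\<close>

lemma gauss_independent_product:
  fixes f g :: "('i \<Rightarrow> real) \<Rightarrow> real"
  assumes K: "K1 \<inter> K2 = {}" "finite K1" "finite K2"
    and "free_of K2 f" "free_of K1 g"
    and int: "integrable (gauss (K1 \<union> K2)) f" "integrable (gauss (K1 \<union> K2)) g"
  shows "has_bochner_integral (gauss (K1 \<union> K2)) (\<lambda>\<omega>. f \<omega> * g \<omega>)
           ((\<integral>\<omega>. f \<omega> \<partial>gauss (K1 \<union> K2)) * (\<integral>\<omega>. g \<omega> \<partial>gauss (K1 \<union> K2)))"
proof -
  interpret A: prob_space "gauss K1" by (rule prob_space_gauss)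
  interpret B: prob_space "gauss K2" by (rule prob_space_gauss)
  have F: "f (merge K1 K2 (x, y)) = f x" if "x \<in> space (gauss K1)" for x y
    using that by (intro free_ofD[OF assms(4)]) (auto simp: merge_def space_PiM PiE_def extensional_def)
  have G: "g (merge K1 K2 (x, y)) = g y" if "y \<in> space (gauss K2)" for x y
    using that K(1) by (intro free_ofD[OF assms(5)]) (auto simp: merge_def space_PiM PiE_def extensional_def)
  have fm [measurable]: "f \<in> borel_measurable (fun_space (K1 \<union> K2))" and gm [measurable]: "g \<in> borel_measurable (fun_space (K1 \<union> K2))"
    using int by (auto dest: borel_measurable_integrable)
  have gK: "g \<in> borel_measurable (gauss K2)"
  proof -
    obtain x where x: "x \<in> space (gauss K1)" using A.not_empty by blast
    have "(\<lambda>y. merge K1 K2 (x, y)) \<in> measurable (gauss K2) (gauss (K1 \<union> K2))"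
      using x by (intro measurable_compose[OF measurable_Pair1' measurable_merge]) simp
    then have "(\<lambda>y. g (merge K1 K2 (x, y))) \<in> borel_measurable (gauss K2)"
      by (rule measurable_compose) simp
    then show ?thesis by (rule measurable_cong[THEN iffD1, rotated]) (rule G)
  qed
  have fK: "f \<in> borel_measurable (gauss K1)"
  proof -
    obtain y where y: "y \<in> space (gauss K2)" using B.not_empty by blast
    have "(\<lambda>x. merge K1 K2 (x, y)) \<in> measurable (gauss K1) (gauss (K1 \<union> K2))"
      using y by (intro measurable_compose[OF measurable_Pair2' measurable_merge]) simp
    then have "(\<lambda>x. f (merge K1 K2 (x, y))) \<in> borel_measurable (gauss K1)"
      by (rule measurable_compose) simp
    then show ?thesis by (rule measurable_cong[THEN iffD1, rotated]) (rule F)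
  qed
  have nfold: "(\<integral>\<^sup>+\<omega>. h \<omega> \<partial>gauss (K1 \<union> K2)) = (\<integral>\<^sup>+x. (\<integral>\<^sup>+y. h (merge K1 K2 (x, y)) \<partial>gauss K2) \<partial>gauss K1)"
    if "h \<in> borel_measurable (gauss (K1 \<union> K2))" for h
    using K that by (rule gauss.product_nn_integral_fold)
  have "(\<integral>\<^sup>+\<omega>. ennreal \<bar>f \<omega>\<bar> \<partial>gauss (K1 \<union> K2)) = (\<integral>\<^sup>+x. (\<integral>\<^sup>+y. ennreal \<bar>f x\<bar> \<partial>gauss K2) \<partial>gauss K1)"
    by (subst nfold) (simp, intro nn_integral_cong, simp add: F)
  then have nf: "(\<integral>\<^sup>+x. ennreal \<bar>f x\<bar> \<partial>gauss K1) < \<infinity>"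
    using int(1) by (simp add: B.emeasure_space_1 integrable_iff_bounded)
  have "(\<integral>\<^sup>+\<omega>. ennreal \<bar>g \<omega>\<bar> \<partial>gauss (K1 \<union> K2)) = (\<integral>\<^sup>+x. (\<integral>\<^sup>+y. ennreal \<bar>g y\<bar> \<partial>gauss K2) \<partial>gauss K1)"
    by (subst nfold) (simp, intro nn_integral_cong, simp add: G)
  then have ng: "(\<integral>\<^sup>+y. ennreal \<bar>g y\<bar> \<partial>gauss K2) < \<infinity>"
    using int(2) by (simp add: A.emeasure_space_1 integrable_iff_bounded)
  have "(\<integral>\<^sup>+\<omega>. ennreal (norm (f \<omega> * g \<omega>)) \<partial>gauss (K1 \<union> K2))
      = (\<integral>\<^sup>+x. (\<integral>\<^sup>+y. ennreal \<bar>f x\<bar> * ennreal \<bar>g y\<bar> \<partial>gauss K2) \<partial>gauss K1)"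
    by (subst nfold) (simp, intro nn_integral_cong, simp add: F G abs_mult ennreal_mult)
  also have "\<dots> = (\<integral>\<^sup>+x. ennreal \<bar>f x\<bar> * (\<integral>\<^sup>+y. ennreal \<bar>g y\<bar> \<partial>gauss K2) \<partial>gauss K1)"
    using gK by (intro nn_integral_cong nn_integral_cmult) simp
  also have "\<dots> = (\<integral>\<^sup>+x. ennreal \<bar>f x\<bar> \<partial>gauss K1) * (\<integral>\<^sup>+y. ennreal \<bar>g y\<bar> \<partial>gauss K2)"
    using fK by (intro nn_integral_multc) simp
  also have "\<dots> < \<infinity>" using nf ng by (simp add: ennreal_mult_less_top)
  finally have ifg: "integrable (gauss (K1 \<union> K2)) (\<lambda>\<omega>. f \<omega> * g \<omega>)"
    by (intro integrableI_bounded) auto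
  have fold: "(\<integral>\<omega>. h \<omega> \<partial>gauss (K1 \<union> K2)) = (\<integral>x. (\<integral>y. h (merge K1 K2 (x, y)) \<partial>gauss K2) \<partial>gauss K1)"
    if "integrable (gauss (K1 \<union> K2)) h" for h :: "('i \<Rightarrow> real) \<Rightarrow> real"
    using K that by (rule gauss.product_integral_fold)
  have "(\<integral>\<omega>. f \<omega> * g \<omega> \<partial>gauss (K1 \<union> K2)) = (\<integral>x. (\<integral>y. f x * g y \<partial>gauss K2) \<partial>gauss K1)"
    by (subst fold[OF ifg]) (intro Bochner_Integration.integral_cong refl, auto simp: F G)
  moreover have "(\<integral>\<omega>. f \<omega> \<partial>gauss (K1 \<union> K2)) = (\<integral>x. f x \<partial>gauss K1)"
    by (subst fold[OF int(1)]) (intro Bochner_Integration.integral_cong refl, auto simp: F B.prob_space)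
  moreover have "(\<integral>\<omega>. g \<omega> \<partial>gauss (K1 \<union> K2)) = (\<integral>y. g y \<partial>gauss K2)"
  proof -
    have "(\<integral>\<omega>. g \<omega> \<partial>gauss (K1 \<union> K2)) = (\<integral>x. (\<integral>y. g y \<partial>gauss K2) \<partial>gauss K1)"
      by (subst fold[OF int(2)]) (intro Bochner_Integration.integral_cong refl, auto simp: G)
    then show ?thesis by (simp add: A.prob_space)
  qed
  ultimately show ?thesis using ifg by (simp add: has_bochner_integral_iff)
qed

text \<open>
  The vectors with components \<open>cov I (c i j) \<omega>\<close>, \<open>i \<in> R\<close>, are Gaussian samples; this is the sum of
  their outer products, centred at a matrix \<open>C\<close> that need not be their covariance.
\<close>

definition scatter :: "'i set \<Rightarrow> ('r \<Rightarrow> 'j \<Rightarrow> 'i \<Rightarrow> real) \<Rightarrow> ('j \<Rightarrow> 'j \<Rightarrow> real) \<Rightarrow> 'r set \<Rightarrow> 'j \<Rightarrow> 'j \<Rightarrow> ('i \<Rightarrow> real) \<Rightarrow> real" where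
  "scatter I c C R j k \<omega> = (\<Sum>i\<in>R. cov I (c i j) \<omega> * cov I (c i k) \<omega> - C j k)"

lemma scatter_mean:
  assumes "finite I" and "\<And>i. i \<in> R \<Longrightarrow> cov I (c i j) (c i k) = S j k"
  shows "has_bochner_integral (gauss I) (scatter I c C R j k) (real (card R) * (S j k - C j k))"
proof -
  have "has_bochner_integral (gauss I) (\<lambda>\<omega>. cov I (c i j) \<omega> * cov I (c i k) \<omega> - C j k) (S j k - C j k)" if "i \<in> R" for i
    using gauss_covariance[OF assms(1), of "c i j" "c i k"] assms(2)[OF that]
    by (intro has_bochner_integral_diff gauss_const) simp
  then have "has_bochner_integral (gauss I) (scatter I c C R j k) (\<Sum>i\<in>R. S j k - C j k)"
    unfolding scatter_def[abs_def] by (intro has_bochner_integral_sum)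
  then show ?thesis by simp
qed

lemma scatter_second_moment:
  assumes fin: "finite I" "finite R"
    and orth: "\<And>i i' j k. i \<in> R \<Longrightarrow> i' \<in> R \<Longrightarrow> j \<in> J \<Longrightarrow> k \<in> J \<Longrightarrow> cov I (c i j) (c i' k) = (if i = i' then S j k else 0)"
    and J: "j \<in> J" "k \<in> J" "j' \<in> J" "k' \<in> J"
  shows "has_bochner_integral (gauss I) (\<lambda>\<omega>. scatter I c C R j k \<omega> * scatter I c C R j' k' \<omega>)
    ((real (card R))\<^sup>2 * ((S j k - C j k) * (S j' k' - C j' k')) + real (card R) * (S j j' * S k k' + S j k' * S k j'))"
proof -
  define y where "y = (\<lambda>i j \<omega>. cov I (c i j) \<omega>)"
  define V where "V = S j j' * S k k' + S j k' * S k j'"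
  define D where "D = (S j k - C j k) * (S j' k' - C j' k')"
  have pair: "has_bochner_integral (gauss I) (\<lambda>\<omega>. (y i j \<omega> * y i k \<omega> - C j k) * (y i' j' \<omega> * y i' k' \<omega> - C j' k'))
      (D + V * kron i i')" if i: "i \<in> R" "i' \<in> R" for i i'
  proof -
    have 4: "has_bochner_integral (gauss I) (\<lambda>\<omega>. y i j \<omega> * y i k \<omega> * y i' j' \<omega> * y i' k' \<omega>)
        (S j k * S j' k' + V * kron i i')"
      using gauss_isserlis[OF fin(1), of "c i j" "c i k" "c i' j'" "c i' k'"] orth i J
      by (auto simp: y_def V_def add.assoc split: if_splits)
    have 2: "has_bochner_integral (gauss I) (\<lambda>\<omega>. y i j \<omega> * y i k \<omega>) (S j k)"
      "has_bochner_integral (gauss I) (\<lambda>\<omega>. y i' j' \<omega> * y i' k' \<omega>) (S j' k')"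
      using gauss_covariance[OF fin(1), of "c i j" "c i k"] gauss_covariance[OF fin(1), of "c i' j'" "c i' k'"] orth i J
      by (auto simp: y_def)
    have "has_bochner_integral (gauss I) (\<lambda>\<omega>. y i j \<omega> * y i k \<omega> * y i' j' \<omega> * y i' k' \<omega> - C j' k' * (y i j \<omega> * y i k \<omega>)
        - C j k * (y i' j' \<omega> * y i' k' \<omega>) + C j k * C j' k')
        (S j k * S j' k' + V * kron i i' - C j' k' * S j k - C j k * S j' k' + C j k * C j' k')"
      by (intro has_bochner_integral_add has_bochner_integral_diff has_bochner_integral_mult_right 4 2 gauss_const)
    then show ?thesis by (simp add: D_def algebra_simps)
  qed
  have "has_bochner_integral (gauss I) (\<lambda>\<omega>. \<Sum>i\<in>R. \<Sum>i'\<in>R. (y i j \<omega> * y i k \<omega> - C j k) * (y i' j' \<omega> * y i' k' \<omega> - C j' k'))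
     (\<Sum>i\<in>R. \<Sum>i'\<in>R. D + V * kron i i')"
    by (intro has_bochner_integral_sum pair)
  moreover have "(\<Sum>i\<in>R. \<Sum>i'\<in>R. D + V * kron i i') = (real (card R))\<^sup>2 * D + real (card R) * V"
  proof -
    have "(\<Sum>i\<in>R. \<Sum>i'\<in>R. D + V * kron i i') = (\<Sum>i\<in>R. real (card R) * D + V)"
      by (intro sum.cong refl) (simp add: sum.distrib sum_kron[OF fin(2)])
    then show ?thesis by (simp add: power2_eq_square algebra_simps)
  qed
  ultimately show ?thesis
    by (simp add: scatter_def sum_product y_def D_def V_def)
qed

lemma scatter_free:
  fixes c :: "'r \<Rightarrow> 'j \<Rightarrow> 'i \<Rightarrow> real"
  assumes "\<And>i p. i \<in> R \<Longrightarrow> p \<in> K \<Longrightarrow> c i j p = 0 \<and> c i k p = 0"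
  shows "free_of K (scatter I c C R j k)"
  unfolding free_of_def
proof (intro allI impI)
  fix \<omega> \<omega>' :: "'i \<Rightarrow> real" assume h: "\<forall>p. p \<notin> K \<longrightarrow> \<omega> p = \<omega>' p"
  have "cov I (c i l) \<omega> = cov I (c i l) \<omega>'" if "i \<in> R" "l = j \<or> l = k" for i l
    unfolding cov_def
  proof (rule sum.cong[OF refl])
    fix p show "c i l p * \<omega> p = c i l p * \<omega>' p"
      using h assms[OF that(1), of p] that(2) by (cases "p \<in> K") auto
  qed
  then show "scatter I c C R j k \<omega> = scatter I c C R j k \<omega>'"
    unfolding scatter_def by (intro sum.cong) auto
qed

lemma four_sum_Cauchy_Schwarz:
  fixes f g :: "'j \<Rightarrow> 'j \<Rightarrow> 'j \<Rightarrow> 'j \<Rightarrow> real"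
  shows "(\<Sum>a\<in>J. \<Sum>b\<in>J. \<Sum>c\<in>J. \<Sum>e\<in>J. f a b c e * g a b c e)\<^sup>2
    \<le> (\<Sum>a\<in>J. \<Sum>b\<in>J. \<Sum>c\<in>J. \<Sum>e\<in>J. (f a b c e)\<^sup>2) * (\<Sum>a\<in>J. \<Sum>b\<in>J. \<Sum>c\<in>J. \<Sum>e\<in>J. (g a b c e)\<^sup>2)"
proof -
  have flat: "(\<Sum>a\<in>J. \<Sum>b\<in>J. \<Sum>c\<in>J. \<Sum>e\<in>J. h a b c e)
      = (\<Sum>x\<in>J \<times> J \<times> J \<times> J. h (fst x) (fst (snd x)) (fst (snd (snd x))) (snd (snd (snd x))))"
    for h :: "'j \<Rightarrow> 'j \<Rightarrow> 'j \<Rightarrow> 'j \<Rightarrow> real"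
    by (simp only: sum.cartesian_product' fst_conv snd_conv)
  show ?thesis unfolding flat by (rule Cauchy_Schwarz_ineq_sum)
qed

text \<open>
  The inner product of the scatter matrices of two independent groups of samples. Using two groups
  removes the diagonal terms, so that the mean is exactly \<open>h\<^sup>2\<close> times the squared Hilbert-Schmidt
  distance from the covariance to \<open>C\<close>.
\<close>

definition overlap :: "'i set \<Rightarrow> 'j set \<Rightarrow> ('r \<Rightarrow> 'j \<Rightarrow> 'i \<Rightarrow> real) \<Rightarrow> ('j \<Rightarrow> 'j \<Rightarrow> real) \<Rightarrow> 'r set \<Rightarrow> 'r set \<Rightarrow> ('i \<Rightarrow> real) \<Rightarrow> real" where
  "overlap I J c C R1 R2 \<omega> = (\<Sum>j\<in>J. \<Sum>k\<in>J. scatter I c C R1 j k \<omega> * scatter I c C R2 j k \<omega>)"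

definition hs_norm_sq :: "'j set \<Rightarrow> ('j \<Rightarrow> 'j \<Rightarrow> real) \<Rightarrow> real" where
  "hs_norm_sq J A = (\<Sum>j\<in>J. \<Sum>k\<in>J. (A j k)\<^sup>2)"

lemma hs_norm_sq_nonneg: "0 \<le> hs_norm_sq J A"
  unfolding hs_norm_sq_def by (intro sum_nonneg) simp

lemma double_sum_product:
  fixes f g :: "'j \<Rightarrow> 'j \<Rightarrow> real"
  shows "(\<Sum>j\<in>J. \<Sum>k\<in>J. f j k) * (\<Sum>j\<in>J. \<Sum>k\<in>J. g j k) = (\<Sum>j\<in>J. \<Sum>k\<in>J. \<Sum>j'\<in>J. \<Sum>k'\<in>J. f j k * g j' k')"
proof -
  define X where "X = (\<Sum>j\<in>J. \<Sum>k\<in>J. g j k)"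
  have "f j k * X = (\<Sum>j'\<in>J. \<Sum>k'\<in>J. f j k * g j' k')" for j k
    unfolding X_def sum_distrib_left ..
  moreover have "(\<Sum>j\<in>J. \<Sum>k\<in>J. f j k) * X = (\<Sum>j\<in>J. \<Sum>k\<in>J. f j k * X)"
    unfolding sum_distrib_right ..
  ultimately show ?thesis unfolding X_def by simp
qed

text \<open>
  The left-hand side is the second moment of the overlap. Its leading part is the square of the
  mean; the Cauchy-Schwarz inequality bounds the remaining terms by Hilbert-Schmidt norms.
\<close>

lemma overlap_second_moment_sum:
  fixes S D :: "'j \<Rightarrow> 'j \<Rightarrow> real" and J :: "'j set" and h :: real
  assumes "0 \<le> h"
  defines "w \<equiv> hs_norm_sq J D" and "s \<equiv> hs_norm_sq J S"
  shows "(\<Sum>j\<in>J. \<Sum>k\<in>J. \<Sum>j'\<in>J. \<Sum>k'\<in>J. (h\<^sup>2 * (D j k * D j' k') + h * (S j j' * S k k' + S j k' * S k j'))\<^sup>2)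
     \<le> h ^ 4 * w\<^sup>2 + 4 * h ^ 3 * w * s + 4 * h\<^sup>2 * s\<^sup>2"
proof -
  let ?Q = "\<lambda>f. \<Sum>j\<in>J. \<Sum>k\<in>J. \<Sum>j'\<in>J. \<Sum>k'\<in>J. f j k j' k' :: real"
  define a where "a = (\<lambda>j k j' k'. S j j' * S k k')"
  define b where "b = (\<lambda>j k j' k'. S j k' * S k j')"
  define e where "e = (\<lambda>j k j' k'. D j k * D j' k')"
  have nn: "0 \<le> w" "0 \<le> s" unfolding w_def s_def by (rule hs_norm_sq_nonneg)+
  have e2: "?Q (\<lambda>j k j' k'. (e j k j' k')\<^sup>2) = w\<^sup>2"
    unfolding e_def power_mult_distrib w_def hs_norm_sq_def power2_eq_square[of "\<Sum>j\<in>J. \<Sum>k\<in>J. (D j k)\<^sup>2"]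
    by (rule double_sum_product[symmetric])
  define A where "A = (\<lambda>j. \<Sum>k\<in>J. (S j k)\<^sup>2)"
  have s2: "s\<^sup>2 = (\<Sum>j\<in>J. \<Sum>k\<in>J. A j * A k)"
  proof -
    have "s = sum A J" unfolding s_def hs_norm_sq_def A_def ..
    then show ?thesis unfolding power2_eq_square by (simp only: sum_product)
  qed
  have AA: "A j * A k = (\<Sum>j'\<in>J. \<Sum>k'\<in>J. (S j j')\<^sup>2 * (S k k')\<^sup>2)" for j k
    unfolding A_def by (rule sum_product)
  have a2: "?Q (\<lambda>j k j' k'. (a j k j' k')\<^sup>2) = s\<^sup>2"
    unfolding s2 AA a_def power_mult_distrib ..
  have b2: "?Q (\<lambda>j k j' k'. (b j k j' k')\<^sup>2) = s\<^sup>2"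
  proof -
    have "?Q (\<lambda>j k j' k'. (b j k j' k')\<^sup>2) = ?Q (\<lambda>j k k' j'. (b j k j' k')\<^sup>2)"
      by (rule sum.cong[OF refl], rule sum.cong[OF refl], rule sum.swap)
    also have "\<dots> = s\<^sup>2" unfolding s2 AA b_def power_mult_distrib ..
    finally show ?thesis .
  qed
  have ea: "?Q (\<lambda>j k j' k'. e j k j' k' * a j k j' k') \<le> w * s"
    using four_sum_Cauchy_Schwarz[of e a J] nn unfolding e2 a2
    by - (rule power2_le_imp_le, simp_all add: power_mult_distrib)
  have eb: "?Q (\<lambda>j k j' k'. e j k j' k' * b j k j' k') \<le> w * s"
    using four_sum_Cauchy_Schwarz[of e b J] nn unfolding e2 b2
    by - (rule power2_le_imp_le, simp_all add: power_mult_distrib)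
  have "?Q (\<lambda>j k j' k'. (h\<^sup>2 * (D j k * D j' k') + h * (S j j' * S k k' + S j k' * S k j'))\<^sup>2)
     \<le> ?Q (\<lambda>j k j' k'. h ^ 4 * (e j k j' k')\<^sup>2 + 2 * h ^ 3 * (e j k j' k' * a j k j' k')
          + 2 * h ^ 3 * (e j k j' k' * b j k j' k') + 2 * h\<^sup>2 * (a j k j' k')\<^sup>2 + 2 * h\<^sup>2 * (b j k j' k')\<^sup>2)"
  proof (intro sum_mono)
    fix j k j' k'
    have sq: "(x + y)\<^sup>2 \<le> 2 * x\<^sup>2 + 2 * y\<^sup>2" for x y :: real
      using zero_le_power2[of "x - y"] by (simp add: power2_eq_square algebra_simps)
    have "(h\<^sup>2 * u + h * (x + y))\<^sup>2 \<le> h ^ 4 * u\<^sup>2 + 2 * h ^ 3 * (u * x) + 2 * h ^ 3 * (u * y) + 2 * h\<^sup>2 * x\<^sup>2 + 2 * h\<^sup>2 * y\<^sup>2"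
      for u x y :: real
    proof -
      have "(h\<^sup>2 * u + h * (x + y))\<^sup>2 = h ^ 4 * u\<^sup>2 + 2 * h ^ 3 * (u * x) + 2 * h ^ 3 * (u * y) + h\<^sup>2 * (x + y)\<^sup>2"
        by algebra
      also have "\<dots> \<le> h ^ 4 * u\<^sup>2 + 2 * h ^ 3 * (u * x) + 2 * h ^ 3 * (u * y) + h\<^sup>2 * (2 * x\<^sup>2 + 2 * y\<^sup>2)"
        by (intro add_left_mono mult_left_mono sq) simp
      also have "\<dots> = h ^ 4 * u\<^sup>2 + 2 * h ^ 3 * (u * x) + 2 * h ^ 3 * (u * y) + 2 * h\<^sup>2 * x\<^sup>2 + 2 * h\<^sup>2 * y\<^sup>2"
        by algebra
      finally show ?thesis .
    qed
    then show "(h\<^sup>2 * (D j k * D j' k') + h * (S j j' * S k k' + S j k' * S k j'))\<^sup>2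
       \<le> h ^ 4 * (e j k j' k')\<^sup>2 + 2 * h ^ 3 * (e j k j' k' * a j k j' k')
          + 2 * h ^ 3 * (e j k j' k' * b j k j' k') + 2 * h\<^sup>2 * (a j k j' k')\<^sup>2 + 2 * h\<^sup>2 * (b j k j' k')\<^sup>2"
      by (simp only: a_def b_def e_def)
  qed
  also have "\<dots> = h ^ 4 * ?Q (\<lambda>j k j' k'. (e j k j' k')\<^sup>2) + 2 * h ^ 3 * ?Q (\<lambda>j k j' k'. e j k j' k' * a j k j' k')
          + 2 * h ^ 3 * ?Q (\<lambda>j k j' k'. e j k j' k' * b j k j' k') + 2 * h\<^sup>2 * ?Q (\<lambda>j k j' k'. (a j k j' k')\<^sup>2)
          + 2 * h\<^sup>2 * ?Q (\<lambda>j k j' k'. (b j k j' k')\<^sup>2)"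
    by (simp only: sum.distrib sum_distrib_left)
  also have "\<dots> \<le> h ^ 4 * w\<^sup>2 + 2 * h ^ 3 * (w * s) + 2 * h ^ 3 * (w * s) + 2 * h\<^sup>2 * s\<^sup>2 + 2 * h\<^sup>2 * s\<^sup>2"
    unfolding e2 a2 b2 using ea eb assms(1) by (intro add_mono mult_left_mono order_refl) auto
  also have "\<dots> = h ^ 4 * w\<^sup>2 + 4 * h ^ 3 * w * s + 4 * h\<^sup>2 * s\<^sup>2" by (simp add: algebra_simps)
  finally show ?thesis .
qed

text \<open>
  Chebyshev's inequality for the overlap. The second moment factorizes entrywise because the two
  groups are independent, and each factor is given by Isserlis' formula. The theorem is used
  below for the rows of a Gaussian block, for the rows of the Wishart block given \<open>B\<close>, and for the
  columns of \<open>B\<close>.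
\<close>

theorem overlap_concentration:
  fixes c :: "'r \<Rightarrow> 'j \<Rightarrow> 'i \<Rightarrow> real" and J :: "'j set" and S C :: "'j \<Rightarrow> 'j \<Rightarrow> real"
  assumes K: "K1 \<inter> K2 = {}" "finite K1" "finite K2" "I = K1 \<union> K2"
    and R: "finite R1" "finite R2" "card R1 = h" "card R2 = h"
    and supp: "\<And>i j p. i \<in> R1 \<Longrightarrow> j \<in> J \<Longrightarrow> p \<in> K2 \<Longrightarrow> c i j p = 0"
      "\<And>i j p. i \<in> R2 \<Longrightarrow> j \<in> J \<Longrightarrow> p \<in> K1 \<Longrightarrow> c i j p = 0"
    and orth1: "\<And>i i' j k. i \<in> R1 \<Longrightarrow> i' \<in> R1 \<Longrightarrow> j \<in> J \<Longrightarrow> k \<in> J \<Longrightarrow> cov I (c i j) (c i' k) = (if i = i' then S j k else 0)"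
    and orth2: "\<And>i i' j k. i \<in> R2 \<Longrightarrow> i' \<in> R2 \<Longrightarrow> j \<in> J \<Longrightarrow> k \<in> J \<Longrightarrow> cov I (c i j) (c i' k) = (if i = i' then S j k else 0)"
    and "0 < t"
  defines "w \<equiv> hs_norm_sq J (\<lambda>j k. S j k - C j k)" and "s \<equiv> hs_norm_sq J S"
  shows "measure (gauss I) {\<omega> \<in> space (gauss I). t \<le> \<bar>overlap I J c C R1 R2 \<omega> - (real h)\<^sup>2 * w\<bar>}
     \<le> (4 * real h ^ 3 * w * s + 4 * (real h)\<^sup>2 * s\<^sup>2) / t\<^sup>2"
proof -
  interpret prob_space "gauss I" by (rule prob_space_gauss)
  have fin: "finite I" using K by simp
  define M1 where "M1 = scatter I c C R1"
  define M2 where "M2 = scatter I c C R2"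
  define D where "D = (\<lambda>j k. S j k - C j k)"
  define Kk where "Kk = (\<lambda>j k j' k'. (real h)\<^sup>2 * (D j k * D j' k') + real h * (S j j' * S k k' + S j k' * S k j'))"
  define T where "T = overlap I J c C R1 R2"
  have free: "free_of K2 (M1 j k)" "free_of K1 (M2 j k)" if "j \<in> J" "k \<in> J" for j k
    unfolding M1_def M2_def using supp that by (auto intro!: scatter_free)
  have mean: "has_bochner_integral (gauss I) (M1 j k) (real h * D j k)"
    "has_bochner_integral (gauss I) (M2 j k) (real h * D j k)" if "j \<in> J" "k \<in> J" for j k
    unfolding M1_def M2_def D_def using scatter_mean[OF fin, of R1 c j k S C] scatter_mean[OF fin, of R2 c j k S C] orth1 orth2 that R
    by auto
  have sec: "has_bochner_integral (gauss I) (\<lambda>\<omega>. M1 j k \<omega> * M1 j' k' \<omega>) (Kk j k j' k')"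
    "has_bochner_integral (gauss I) (\<lambda>\<omega>. M2 j k \<omega> * M2 j' k' \<omega>) (Kk j k j' k')"
    if "j \<in> J" "k \<in> J" "j' \<in> J" "k' \<in> J" for j k j' k'
    unfolding M1_def M2_def D_def Kk_def
    using scatter_second_moment[where C = C, OF fin R(1) orth1 that] scatter_second_moment[where C = C, OF fin R(2) orth2 that] R
    by simp_all
  have "has_bochner_integral (gauss I) (\<lambda>\<omega>. M1 j k \<omega> * M2 j k \<omega>) (real h * D j k * (real h * D j k))"
    if "j \<in> J" "k \<in> J" for j k
    using gauss_independent_product[OF K(1-3) free(1)[OF that] free(2)[OF that]] mean[OF that] K(4)
    by (auto simp: has_bochner_integral_iff)
  then have ET: "has_bochner_integral (gauss I) T (\<Sum>j\<in>J. \<Sum>k\<in>J. real h * D j k * (real h * D j k))"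
    unfolding T_def overlap_def[abs_def] M1_def[symmetric] M2_def[symmetric] by (intro has_bochner_integral_sum)
  have ETv: "(\<Sum>j\<in>J. \<Sum>k\<in>J. real h * D j k * (real h * D j k)) = (real h)\<^sup>2 * w"
    by (simp add: w_def hs_norm_sq_def D_def sum_distrib_left power2_eq_square mult_ac)
  have "has_bochner_integral (gauss I) (\<lambda>\<omega>. (M1 j k \<omega> * M1 j' k' \<omega>) * (M2 j k \<omega> * M2 j' k' \<omega>)) ((Kk j k j' k')\<^sup>2)"
    if J: "j \<in> J" "k \<in> J" "j' \<in> J" "k' \<in> J" for j k j' k'
  proof -
    have f: "free_of K2 (\<lambda>\<omega>. M1 j k \<omega> * M1 j' k' \<omega>)" "free_of K1 (\<lambda>\<omega>. M2 j k \<omega> * M2 j' k' \<omega>)"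
      by (rule free_of_binary[where h = "(*)"], (rule free J)+)+
    show ?thesis
      using gauss_independent_product[OF K(1-3) f] sec[OF J] K(4) by (auto simp: has_bochner_integral_iff power2_eq_square)
  qed
  then have "has_bochner_integral (gauss I) (\<lambda>\<omega>. \<Sum>j\<in>J. \<Sum>k\<in>J. \<Sum>j'\<in>J. \<Sum>k'\<in>J. (M1 j k \<omega> * M1 j' k' \<omega>) * (M2 j k \<omega> * M2 j' k' \<omega>))
     (\<Sum>j\<in>J. \<Sum>k\<in>J. \<Sum>j'\<in>J. \<Sum>k'\<in>J. (Kk j k j' k')\<^sup>2)"
    by (intro has_bochner_integral_sum)
  moreover have "(\<Sum>j\<in>J. \<Sum>k\<in>J. \<Sum>j'\<in>J. \<Sum>k'\<in>J. (M1 j k \<omega> * M1 j' k' \<omega>) * (M2 j k \<omega> * M2 j' k' \<omega>)) = (T \<omega>)\<^sup>2" for \<omega>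
  proof -
    have "(T \<omega>)\<^sup>2 = (\<Sum>j\<in>J. \<Sum>k\<in>J. M1 j k \<omega> * M2 j k \<omega>) * (\<Sum>j'\<in>J. \<Sum>k'\<in>J. M1 j' k' \<omega> * M2 j' k' \<omega>)"
      by (simp only: T_def overlap_def M1_def M2_def power2_eq_square)
    also have "\<dots> = (\<Sum>j\<in>J. \<Sum>k\<in>J. \<Sum>j'\<in>J. \<Sum>k'\<in>J. (M1 j k \<omega> * M2 j k \<omega>) * (M1 j' k' \<omega> * M2 j' k' \<omega>))"
      by (rule double_sum_product)
    finally show ?thesis by (simp add: mult_ac)
  qed
  ultimately have ET2: "has_bochner_integral (gauss I) (\<lambda>\<omega>. (T \<omega>)\<^sup>2) (\<Sum>j\<in>J. \<Sum>k\<in>J. \<Sum>j'\<in>J. \<Sum>k'\<in>J. (Kk j k j' k')\<^sup>2)"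
    by simp
  have E: "expectation T = (real h)\<^sup>2 * w" "integrable (gauss I) T" "integrable (gauss I) (\<lambda>\<omega>. (T \<omega>)\<^sup>2)"
    using ET ET2 ETv by (auto simp: has_bochner_integral_iff)
  have "variance T = expectation (\<lambda>\<omega>. (T \<omega>)\<^sup>2) - (expectation T)\<^sup>2"
    by (rule variance_eq[OF E(2,3)])
  also have "expectation (\<lambda>\<omega>. (T \<omega>)\<^sup>2) \<le> real h ^ 4 * w\<^sup>2 + 4 * real h ^ 3 * w * s + 4 * (real h)\<^sup>2 * s\<^sup>2"
    using ET2 overlap_second_moment_sum[of "real h" D S J] unfolding Kk_def
    by (simp add: has_bochner_integral_iff w_def s_def D_def)
  finally have V: "variance T \<le> 4 * real h ^ 3 * w * s + 4 * (real h)\<^sup>2 * s\<^sup>2"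
    by (simp add: E(1) power_mult_distrib flip: power_mult)
  have "prob {\<omega> \<in> space (gauss I). t \<le> \<bar>T \<omega> - expectation T\<bar>} \<le> variance T / t\<^sup>2"
    using E \<open>0 < t\<close> by (intro Chebyshev_inequality) (auto dest: borel_measurable_integrable)
  also have "\<dots> \<le> (4 * real h ^ 3 * w * s + 4 * (real h)\<^sup>2 * s\<^sup>2) / t\<^sup>2"
    using V by (rule divide_right_mono) simp
  finally show ?thesis unfolding E(1) unfolding T_def .
qed

section \<open>The overlap of rows as a test statistic\<close>

lemma cov_kron: "finite I \<Longrightarrow> p \<in> I \<Longrightarrow> cov I (kron p) x = x p"
  unfolding cov_def by (simp add: mult_delta_left)

lemma hs_norm_sq_kron: "finite J \<Longrightarrow> hs_norm_sq J kron = real (card J)"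
proof -
  assume J: "finite J"
  have "(\<Sum>k\<in>J. (kron j k)\<^sup>2) = 1" if "j \<in> J" for j
    using sum_kron[OF J that, of "\<lambda>_. 1"] by (simp add: if_distrib[where f = "\<lambda>x. x\<^sup>2"] cong: if_cong)
  then show ?thesis unfolding hs_norm_sq_def by simp
qed

text \<open>
  The test statistic: the overlap of the first \<open>h\<close> and the next \<open>h\<close> rows of the block, centred at the
  identity.
\<close>

definition row_stat :: "nat \<Rightarrow> nat \<Rightarrow> (nat \<times> nat \<Rightarrow> real) \<Rightarrow> real" where
  "row_stat h m y = (\<Sum>j = 1..m. \<Sum>k = 1..m.
      (\<Sum>i = 1..h. y (i, j) * y (i, k) - kron j k) * (\<Sum>i = h+1..2*h. y (i, j) * y (i, k) - kron j k))"

lemma row_stat_measurable [measurable]: "row_stat h m \<in> borel_measurable (fun_space I)"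
  unfolding row_stat_def[abs_def] by measurable

lemma row_stat_cong: "(\<And>i j. i \<in> {1..2*h} \<Longrightarrow> j \<in> {1..m} \<Longrightarrow> y (i, j) = y' (i, j)) \<Longrightarrow> row_stat h m y = row_stat h m y'"
  unfolding row_stat_def by (intro sum.cong refl arg_cong2[where f = "(*)"] arg_cong2[where f = "(-)"]) auto

lemma row_stat_gaussian:
  assumes "2 * h \<le> n" "0 < t"
  shows "measure (gauss ({1..n} \<times> {1..m})) {y \<in> space (gauss ({1..n} \<times> {1..m})). t \<le> \<bar>row_stat h m y\<bar>}
     \<le> 4 * (real h)\<^sup>2 * (real m)\<^sup>2 / t\<^sup>2"
proof -
  define K where "K = {1..n} \<times> {1..m}"
  define c where "c = (\<lambda>i j. kron (i :: nat, j :: nat))"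
  have fK: "finite K" by (simp add: K_def)
  have co: "cov K (c i j) y = y (i, j)" if "i \<in> {1..n}" "j \<in> {1..m}" for i j y
    unfolding c_def using that by (intro cov_kron fK) (auto simp: K_def)
  have st: "overlap K {1..m} c kron {1..h} {h+1..2*h} y = row_stat h m y" for y
    unfolding overlap_def row_stat_def scatter_def
    using assms(1) by (intro sum.cong refl arg_cong2[where f = "(*)"] arg_cong2[where f = "(-)"] co) auto
  have "measure (gauss K) {y \<in> space (gauss K). t \<le> \<bar>overlap K {1..m} c kron {1..h} {h+1..2*h} y - (real h)\<^sup>2 * hs_norm_sq {1..m} (\<lambda>j k. kron j k - kron j k)\<bar>}
     \<le> (4 * real h ^ 3 * hs_norm_sq {1..m} (\<lambda>j k. kron j k - kron j k) * hs_norm_sq {1..m} kron + 4 * (real h)\<^sup>2 * (hs_norm_sq {1..m} kron)\<^sup>2) / t\<^sup>2"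
  proof (rule overlap_concentration)
    show "K = {1..h} \<times> {1..m} \<union> {h+1..n} \<times> {1..m}" using assms(1) by (auto simp: K_def)
    show "cov K (c i j) (c i' k) = (if i = i' then kron j k else 0)"
      if "i \<in> {1..h}" "i' \<in> {1..h}" "j \<in> {1..m}" "k \<in> {1..m}" for i i' j k
      using that assms(1) by (subst co) (auto simp: c_def)
    show "cov K (c i j) (c i' k) = (if i = i' then kron j k else 0)"
      if "i \<in> {h+1..2*h}" "i' \<in> {h+1..2*h}" "j \<in> {1..m}" "k \<in> {1..m}" for i i' j k
      using that assms(1) by (subst co) (auto simp: c_def)
  qed (use assms in \<open>auto simp: c_def\<close>)
  moreover have "hs_norm_sq {1..m} (\<lambda>j k. kron j k - kron j k) = 0" by (simp add: hs_norm_sq_def)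
  moreover have "hs_norm_sq {1..m} kron = real m" by (simp add: hs_norm_sq_kron)
  ultimately show ?thesis unfolding st unfolding K_def by simp
qed

definition sample_cov :: "nat \<Rightarrow> nat \<Rightarrow> (nat \<times> nat \<Rightarrow> real) \<Rightarrow> nat \<Rightarrow> nat \<Rightarrow> real" where
  "sample_cov n d X j k = (\<Sum>r = 1..d. X (r, n + j) * X (r, n + k)) / real d"

text \<open>
  Given \<open>B\<close>, the rows of the Wishart block are independent with covariance \<open>sample_cov\<close>; the mean of
  the test statistic is \<open>h\<^sup>2\<close> times this quantity.
\<close>

definition cov_excess :: "nat \<Rightarrow> nat \<Rightarrow> nat \<Rightarrow> (nat \<times> nat \<Rightarrow> real) \<Rightarrow> real" where
  "cov_excess n m d X = hs_norm_sq {1..m} (\<lambda>j k. sample_cov n d X j k - kron j k)"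

lemma cov_excess_measurable [measurable]: "cov_excess n m d \<in> borel_measurable (fun_space I)"
  unfolding cov_excess_def[abs_def] hs_norm_sq_def sample_cov_def by measurable

lemma hs_norm_sq_sample_cov_le: "hs_norm_sq {1..m} (sample_cov n d X) \<le> 2 * real m + 2 * cov_excess n m d X"
proof -
  have "hs_norm_sq {1..m} (sample_cov n d X) \<le> (\<Sum>j = 1..m. \<Sum>k = 1..m. 2 * (kron j k)\<^sup>2 + 2 * (sample_cov n d X j k - kron j k)\<^sup>2)"
    unfolding hs_norm_sq_def
  proof (intro sum_mono)
    fix j k
    have "x\<^sup>2 \<le> 2 * y\<^sup>2 + 2 * (x - y)\<^sup>2" for x y :: real
      using zero_le_power2[of "x - 2 * y"] by (simp add: power2_eq_square algebra_simps)
    then show "(sample_cov n d X j k)\<^sup>2 \<le> 2 * (kron j k)\<^sup>2 + 2 * (sample_cov n d X j k - kron j k)\<^sup>2" .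
  qed
  also have "\<dots> = 2 * hs_norm_sq {1..m} kron + 2 * cov_excess n m d X"
    unfolding cov_excess_def hs_norm_sq_def by (simp only: sum.distrib sum_distrib_left)
  finally show ?thesis by (simp add: hs_norm_sq_kron)
qed

lemma row_stat_gram_conditional:
  fixes n m d h :: nat
  assumes "2 * h \<le> n" "1 \<le> d" "0 < t"
  defines "A \<equiv> {1..d} \<times> {1..n}"
  shows "measure (gauss A) {a \<in> space (gauss A). t \<le> \<bar>row_stat h m (\<lambda>p. (\<Sum>r = 1..d. a (r, fst p) * X (r, n + snd p)) / sqrt (real d))
         - (real h)\<^sup>2 * cov_excess n m d X\<bar>}
     \<le> (4 * real h ^ 3 * cov_excess n m d X * hs_norm_sq {1..m} (sample_cov n d X)
         + 4 * (real h)\<^sup>2 * (hs_norm_sq {1..m} (sample_cov n d X))\<^sup>2) / t\<^sup>2"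
proof -
  define c where "c = (\<lambda>i j (p :: nat \<times> nat). if snd p = i then X (fst p, n + j) / sqrt (real d) else 0)"
  have co: "cov A (c i j) a = (\<Sum>r = 1..d. X (r, n + j) / sqrt (real d) * a (r, i))" if "i \<in> {1..n}" for i j a
  proof -
    have "cov A (c i j) a = (\<Sum>r = 1..d. \<Sum>i' = 1..n. if i' = i then X (r, n + j) / sqrt (real d) * a (r, i') else 0)"
      unfolding cov_def A_def c_def sum.cartesian_product' by (intro sum.cong refl) auto
    then show ?thesis using that by simp
  qed
  have st: "overlap A {1..m} c kron {1..h} {h+1..2*h} a
      = row_stat h m (\<lambda>p. (\<Sum>r = 1..d. a (r, fst p) * X (r, n + snd p)) / sqrt (real d))" for a
  proof -
    have "cov A (c i j) a = (\<Sum>r = 1..d. a (r, i) * X (r, n + j)) / sqrt (real d)" if "i \<in> {1..n}" for i j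
      using co[OF that, of j a] by (simp add: sum_divide_distrib mult.commute)
    then show ?thesis unfolding overlap_def row_stat_def scatter_def
      using assms(1) by (intro sum.cong refl arg_cong2[where f = "(*)"] arg_cong2[where f = "(-)"]) auto
  qed
  have orth: "cov A (c i j) (c i' k) = (if i = i' then sample_cov n d X j k else 0)" if "i \<in> {1..n}" for i i' j k
  proof -
    have "X (r, n + j) / sqrt (real d) * (X (r, n + k) / sqrt (real d)) = X (r, n + j) * X (r, n + k) / real d" for r
    proof -
      have "X (r, n + j) / sqrt (real d) * (X (r, n + k) / sqrt (real d)) = X (r, n + j) * X (r, n + k) / (sqrt (real d) * sqrt (real d))"
        by simp
      then show ?thesis by (simp only: real_sqrt_mult_self abs_of_nat)
    qed
    then show ?thesis using co[OF that, of j "c i' k"]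
      by (auto simp: c_def sample_cov_def sum_divide_distrib)
  qed
  have "measure (gauss A) {a \<in> space (gauss A). t \<le> \<bar>overlap A {1..m} c kron {1..h} {h+1..2*h} a - (real h)\<^sup>2 * hs_norm_sq {1..m} (\<lambda>j k. sample_cov n d X j k - kron j k)\<bar>}
     \<le> (4 * real h ^ 3 * hs_norm_sq {1..m} (\<lambda>j k. sample_cov n d X j k - kron j k) * hs_norm_sq {1..m} (sample_cov n d X)
        + 4 * (real h)\<^sup>2 * (hs_norm_sq {1..m} (sample_cov n d X))\<^sup>2) / t\<^sup>2"
  proof (rule overlap_concentration)
    show "A = {1..d} \<times> {1..h} \<union> {1..d} \<times> {h+1..n}" using assms(1) by (auto simp: A_def)
    show "cov A (c i j) (c i' k) = (if i = i' then sample_cov n d X j k else 0)"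
      if "i \<in> {1..h}" for i i' j k using that assms(1) by (intro orth) auto
    show "cov A (c i j) (c i' k) = (if i = i' then sample_cov n d X j k else 0)"
      if "i \<in> {h+1..2*h}" for i i' j k using that assms(1) by (intro orth) auto
  qed (use assms in \<open>auto simp: c_def\<close>)
  then show ?thesis by (simp only: st cov_excess_def)
qed

section \<open>Small-ball estimates for the sample covariance\<close>

text \<open>
  The off-diagonal part of the excess dominates the sum of \<open>(b\<^sub>i \<bullet> b\<^sub>k)\<^sup>2 / d\<^sup>2\<close> over \<open>i \<le> l < k \<le> 2 l\<close>. The
  numerator is again an overlap, now of the columns of \<open>B\<close> as samples in dimension \<open>d\<close> with centre 0;
  its mean is \<open>l\<^sup>2 d\<close>, with relative variance of order \<open>1 / l\<close>.
\<close>

lemma cov_excess_small_ball_many_columns: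
  fixes n m d l :: nat
  assumes l: "1 \<le> l" "2 * l \<le> m" "1 \<le> d" and W: "W \<le> (real l)\<^sup>2 / (2 * real d)"
  defines "B \<equiv> {1..d} \<times> {n+1..n+m}"
  shows "measure (gauss B) {b \<in> space (gauss B). cov_excess n m d b < W} \<le> 32 / real l"
proof -
  interpret prob_space "gauss B" by (rule prob_space_gauss)
  define c where "c = (\<lambda>i (r::nat). kron (r, n + i))"
  define Z where "Z = (\<lambda>(_::nat) (_::nat). 0 :: real)"
  define V where "V = overlap B {1..d} c Z {1..l} {l+1..2*l}"
  have fB: "finite B" by (simp add: B_def)
  have d: "0 < real d" and l0: "0 < real l" using l by auto
  have co: "cov B (c i r) b = b (r, n + i)" if "i \<in> {1..m}" "r \<in> {1..d}" for i r b
    unfolding c_def using that by (intro cov_kron fB) (auto simp: B_def)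
  define t where "t = (real l)\<^sup>2 * real d / 2"
  have t: "0 < t" using d l0 by (simp add: t_def)
  have wZ: "hs_norm_sq {1..d} (\<lambda>j k. kron j k - Z j k) = real d"
    unfolding Z_def by (simp add: hs_norm_sq_kron)
  have "prob {b \<in> space (gauss B). t \<le> \<bar>V b - (real l)\<^sup>2 * hs_norm_sq {1..d} (\<lambda>j k. kron j k - Z j k)\<bar>}
     \<le> (4 * real l ^ 3 * hs_norm_sq {1..d} (\<lambda>j k. kron j k - Z j k) * hs_norm_sq {1..d} kron + 4 * (real l)\<^sup>2 * (hs_norm_sq {1..d} kron)\<^sup>2) / t\<^sup>2"
    unfolding V_def
  proof (rule overlap_concentration)
    show "B = {1..d} \<times> {n+1..n+l} \<union> {1..d} \<times> {n+l+1..n+m}" using l by (auto simp: B_def)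
    show "cov B (c i j) (c i' k) = (if i = i' then kron j k else 0)"
      if "i \<in> {1..l}" "i' \<in> {1..l}" "j \<in> {1..d}" "k \<in> {1..d}" for i i' j k
      using that l by (subst co) (auto simp: c_def)
    show "cov B (c i j) (c i' k) = (if i = i' then kron j k else 0)"
      if "i \<in> {l+1..2*l}" "i' \<in> {l+1..2*l}" "j \<in> {1..d}" "k \<in> {1..d}" for i i' j k
      using that l by (subst co) (auto simp: c_def)
  qed (use l t in \<open>auto simp: c_def\<close>)
  then have ch: "prob {b \<in> space (gauss B). t \<le> \<bar>V b - (real l)\<^sup>2 * real d\<bar>}
     \<le> (4 * real l ^ 3 * real d * real d + 4 * (real l)\<^sup>2 * (real d)\<^sup>2) / t\<^sup>2"
    unfolding wZ by (simp add: hs_norm_sq_kron)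
  have V: "V b / (real d)\<^sup>2 \<le> cov_excess n m d b" for b
  proof -
    have "V b = (\<Sum>r = 1..d. \<Sum>r' = 1..d. (\<Sum>i = 1..l. b (r, n + i) * b (r', n + i)) * (\<Sum>i = l+1..2*l. b (r, n + i) * b (r', n + i)))"
      unfolding V_def overlap_def scatter_def Z_def using l
      by (intro sum.cong refl arg_cong2[where f = "(*)"]) (auto simp: co)
    also have "\<dots> = (\<Sum>r = 1..d. \<Sum>r' = 1..d. \<Sum>i = 1..l. \<Sum>i' = l+1..2*l. (b (r, n + i) * b (r, n + i')) * (b (r', n + i) * b (r', n + i')))"
      by (simp add: sum_product mult_ac)
    also have "\<dots> = (\<Sum>i = 1..l. \<Sum>i' = l+1..2*l. \<Sum>r = 1..d. \<Sum>r' = 1..d. (b (r, n + i) * b (r, n + i')) * (b (r', n + i) * b (r', n + i')))"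
    proof -
      have "(\<Sum>r = 1..d. \<Sum>r' = 1..d. \<Sum>i = 1..l. \<Sum>i' = l+1..2*l. F r r' i i')
         = (\<Sum>i = 1..l. \<Sum>i' = l+1..2*l. \<Sum>r = 1..d. \<Sum>r' = 1..d. F r r' i i')" for F :: "nat \<Rightarrow> nat \<Rightarrow> nat \<Rightarrow> nat \<Rightarrow> real"
      proof -
        have "(\<Sum>r = 1..d. \<Sum>r' = 1..d. \<Sum>i = 1..l. \<Sum>i' = l+1..2*l. F r r' i i')
           = (\<Sum>x\<in>{1..d} \<times> {1..d}. \<Sum>y\<in>{1..l} \<times> {l+1..2*l}. F (fst x) (snd x) (fst y) (snd y))"
          by (simp only: sum.cartesian_product' fst_conv snd_conv)
        also have "\<dots> = (\<Sum>y\<in>{1..l} \<times> {l+1..2*l}. \<Sum>x\<in>{1..d} \<times> {1..d}. F (fst x) (snd x) (fst y) (snd y))"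
          by (rule sum.swap)
        finally show ?thesis by (simp only: sum.cartesian_product' fst_conv snd_conv)
      qed
      then show ?thesis .
    qed
    also have "\<dots> = (\<Sum>i = 1..l. \<Sum>i' = l+1..2*l. (\<Sum>r = 1..d. b (r, n + i) * b (r, n + i'))\<^sup>2)"
      by (simp only: sum_product power2_eq_square)
    finally have Vb: "V b = (\<Sum>i = 1..l. \<Sum>i' = l+1..2*l. (\<Sum>r = 1..d. b (r, n + i) * b (r, n + i'))\<^sup>2)" .
    have "V b / (real d)\<^sup>2 = (\<Sum>i = 1..l. \<Sum>i' = l+1..2*l. (sample_cov n d b i i')\<^sup>2)"
    proof -
      have "(sample_cov n d b i i')\<^sup>2 = (\<Sum>r = 1..d. b (r, n + i) * b (r, n + i'))\<^sup>2 / (real d)\<^sup>2" for i i'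
        by (simp add: sample_cov_def power_divide)
      then show ?thesis by (simp only: Vb sum_divide_distrib)
    qed
    also have "\<dots> = (\<Sum>i = 1..l. \<Sum>i' = l+1..2*l. (sample_cov n d b i i' - kron i i')\<^sup>2)"
      by (intro sum.cong refl) auto
    also have "\<dots> \<le> (\<Sum>i = 1..l. \<Sum>i' = 1..m. (sample_cov n d b i i' - kron i i')\<^sup>2)"
      using l by (intro sum_mono sum_mono2) auto
    also have "\<dots> \<le> cov_excess n m d b"
      unfolding cov_excess_def hs_norm_sq_def using l by (intro sum_mono2 sum_nonneg) auto
    finally show ?thesis .
  qed
  have Vm [measurable]: "V \<in> borel_measurable (fun_space B)"
    unfolding V_def overlap_def[abs_def] scatter_def cov_def by measurable
  have "prob {b \<in> space (gauss B). cov_excess n m d b < W} \<le> prob {b \<in> space (gauss B). t \<le> \<bar>V b - (real l)\<^sup>2 * real d\<bar>}"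
  proof (rule finite_measure_mono)
    show "{b \<in> space (gauss B). cov_excess n m d b < W} \<subseteq> {b \<in> space (gauss B). t \<le> \<bar>V b - (real l)\<^sup>2 * real d\<bar>}"
    proof safe
      fix b assume "cov_excess n m d b < W"
      then have "V b / (real d)\<^sup>2 < (real l)\<^sup>2 / (2 * real d)" using V[of b] W by linarith
      then have "V b < (real l)\<^sup>2 / (2 * real d) * (real d)\<^sup>2" using d by (simp add: pos_divide_less_eq)
      also have "\<dots> = t" using d by (simp add: t_def power2_eq_square)
      finally have "V b < t" .
      moreover have "(real l)\<^sup>2 * real d = 2 * t" by (simp add: t_def)
      ultimately show "t \<le> \<bar>V b - (real l)\<^sup>2 * real d\<bar>" by linarith
    qed
    show "{b \<in> space (gauss B). t \<le> \<bar>V b - (real l)\<^sup>2 * real d\<bar>} \<in> events" by measurable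
  qed
  also note ch
  also have "(4 * real l ^ 3 * real d * real d + 4 * (real l)\<^sup>2 * (real d)\<^sup>2) / t\<^sup>2 = 16 / real l + 16 / (real l)\<^sup>2"
    using d l0 by (simp add: t_def field_simps power2_eq_square power3_eq_cube)
  also have "\<dots> \<le> 16 / real l + 16 / real l"
    using l by (intro add_left_mono divide_left_mono) (auto simp: power2_eq_square)
  finally show ?thesis by simp
qed

text \<open>
  Dilating the coordinates in \<open>A\<close> by \<open>exp (v / 2)\<close> maps the shell around \<open>d\<close> to the shell around
  \<open>exp v * d\<close>. On the shell the density ratio has exponent
  \<open>v d / 2 - (exp v - 1) Q / 2\<close>, whose first-order terms cancel because \<open>Q\<close> is close to \<open>d\<close>.
\<close>

lemma chi_square_scaling:
  fixes A I :: "'i set" and d :: nat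
  assumes fin: "finite I" "A \<subseteq> I" "card A = d" "1 \<le> d" and v: "0 \<le> v" "v \<le> 1 / sqrt (real d)"
    and \<theta>: "0 \<le> \<theta>" "\<theta> \<le> 1 / sqrt (real d)"
  defines "Q \<equiv> \<lambda>\<omega> :: 'i \<Rightarrow> real. \<Sum>p\<in>A. (\<omega> p)\<^sup>2"
  shows "exp (- 2) * measure (gauss I) {\<omega> \<in> space (gauss I). \<bar>Q \<omega> - d\<bar> \<le> \<theta> * d}
     \<le> measure (gauss I) {\<omega> \<in> space (gauss I). \<bar>Q \<omega> - exp v * d\<bar> \<le> \<theta> * (exp v * d)}"
proof -
  interpret prob_space "gauss I" by (rule prob_space_gauss)
  \<comment> \<open>Coordinates are multiplied by \<open>g\<close>, hence their sum of squares by \<open>exp v\<close>.\<close>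
  define g where "g = exp (v / 2)"
  have g: "0 < g" "g\<^sup>2 = exp v" by (simp_all add: g_def exp_double[symmetric])
  have Qm [measurable]: "Q \<in> borel_measurable (fun_space I)" unfolding Q_def by measurable
  define E where "E = {\<omega> \<in> space (gauss I). \<bar>Q \<omega> - d\<bar> \<le> \<theta> * d}"
  define E' where "E' = {\<omega> \<in> space (gauss I). \<bar>Q \<omega> - exp v * d\<bar> \<le> \<theta> * (exp v * d)}"
  have Em [measurable]: "E \<in> events" "E' \<in> events" unfolding E_def E'_def by measurable
  define T where "T = block_affine A (\<lambda>_ (_ :: 'i \<Rightarrow> real). g) (\<lambda>_ _. 0)"
  have Tm: "T \<in> measurable (fun_space I) (fun_space I)"
    unfolding T_def by (intro measurable_block_affine fin) auto
  have J: "jacobian I T (\<lambda>\<omega>. \<Prod>p\<in>A. \<bar>g\<bar>)"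
    unfolding T_def using g by (intro jacobian_block_affine fin) (auto simp: free_of_def)
  have fA: "finite A" using fin finite_subset by blast
  have QT: "Q (T \<omega>) = exp v * Q \<omega>" for \<omega>
    by (simp add: Q_def T_def block_affine_def power_mult_distrib g sum_distrib_left)
  have norm: "sq_norm I (T \<omega>) - sq_norm I \<omega> = (exp v - 1) * Q \<omega>" for \<omega>
  proof -
    have "sq_norm I \<omega>' = Q \<omega>' + (\<Sum>p\<in>I - A. (\<omega>' p)\<^sup>2)" for \<omega>' :: "'i \<Rightarrow> real"
      unfolding sq_norm_def Q_def using fin by (metis sum.subset_diff add.commute)
    moreover have "(\<Sum>p\<in>I - A. (T \<omega> p)\<^sup>2) = (\<Sum>p\<in>I - A. (\<omega> p)\<^sup>2)"
      by (intro sum.cong) (auto simp: T_def block_affine_def)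
    ultimately show ?thesis by (simp add: QT algebra_simps)
  qed
  have d: "0 < real d" "sqrt (real d) * sqrt (real d) = real d" using fin by auto
  have vb: "v * v \<le> 1 / real d" "\<theta> * v \<le> 1 / real d" "v \<le> 1"
  proof -
    have "1 / sqrt (real d) * (1 / sqrt (real d)) = 1 / real d" using d by simp
    then show "v * v \<le> 1 / real d" "\<theta> * v \<le> 1 / real d"
      using v \<theta> mult_mono[of v "1 / sqrt (real d)" v "1 / sqrt (real d)"] mult_mono[of \<theta> "1 / sqrt (real d)" v "1 / sqrt (real d)"]
      by auto
    have "1 / sqrt (real d) \<le> 1" using fin by simp
    then show "v \<le> 1" using v by linarith
  qed
  have ev: "exp v - 1 \<le> v + v\<^sup>2" "0 \<le> exp v - 1" using exp_bound[of v] v vb by auto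
  have weight: "exp (- 2) \<le> (\<Prod>p\<in>A. \<bar>g\<bar>) * exp (- (sq_norm I (T \<omega>) - sq_norm I \<omega>) / 2)" if \<omega>: "\<omega> \<in> E" for \<omega>
  proof -
    have "Q \<omega> \<le> (1 + \<theta>) * real d" using \<omega> by (simp add: E_def abs_le_iff algebra_simps)
    then have "(exp v - 1) * Q \<omega> \<le> (v + v\<^sup>2) * ((1 + \<theta>) * real d)"
      using ev v \<theta> d by (intro mult_mono) (auto simp: Q_def sum_nonneg)
    also have "\<dots> = v * real d + (v * v + \<theta> * v + \<theta> * v * v) * real d"
      by (simp add: power2_eq_square algebra_simps)
    also have "\<dots> \<le> v * real d + (1 / real d + 1 / real d + 1 / real d) * real d"
    proof -
      have "\<theta> * v * v \<le> \<theta> * v * 1" using v \<theta> vb by (intro mult_left_mono) auto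
      then show ?thesis using vb d by (intro add_left_mono mult_right_mono add_mono) auto
    qed
    also have "\<dots> = v * real d + 3" using d by simp
    finally have "- 2 \<le> v * real d / 2 - (exp v - 1) * Q \<omega> / 2" by simp
    then have "exp (- 2) \<le> exp (v * real d / 2 - (exp v - 1) * Q \<omega> / 2)" by simp
    also have "\<dots> = (\<Prod>p\<in>A. \<bar>g\<bar>) * exp (- (sq_norm I (T \<omega>) - sq_norm I \<omega>) / 2)"
    proof -
      have "(\<Prod>p\<in>A. \<bar>g\<bar>) = exp (v * real d / 2)"
        using fin g(1) by (simp add: g_def exp_of_nat_mult[symmetric] mult.commute)
      then show ?thesis by (simp only: norm exp_diff exp_minus divide_inverse minus_mult_left[symmetric])
    qed
    finally show ?thesis .
  qed
  have ETE: "T \<omega> \<in> E' \<longleftrightarrow> \<omega> \<in> E" if "\<omega> \<in> space (gauss I)" for \<omega>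
  proof -
    have sp: "T \<omega> \<in> space (gauss I)" using measurable_space[OF Tm] that by (simp add: space_PiM)
    have "exp v * Q \<omega> - exp v * d = exp v * (Q \<omega> - d)" by (simp add: algebra_simps)
    then have "\<bar>exp v * Q \<omega> - exp v * d\<bar> = exp v * \<bar>Q \<omega> - d\<bar>" by (simp add: abs_mult)
    moreover have "\<theta> * (exp v * d) = exp v * (\<theta> * d)" by simp
    ultimately have "\<bar>exp v * Q \<omega> - exp v * d\<bar> \<le> \<theta> * (exp v * d) \<longleftrightarrow> \<bar>Q \<omega> - d\<bar> \<le> \<theta> * d"
      by (simp only: mult_le_cancel_left_pos[OF exp_gt_zero])
    then show ?thesis using that sp by (simp add: E_def E'_def QT)
  qed
  have "emeasure (gauss I) E' = (\<integral>\<^sup>+\<omega>. indicator E' \<omega> \<partial>gauss I)" by simp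
  also have "\<dots> = (\<integral>\<^sup>+\<omega>. indicator E' (T \<omega>) * ennreal ((\<Prod>p\<in>A. \<bar>g\<bar>) * exp (- (sq_norm I (T \<omega>) - sq_norm I \<omega>) / 2)) \<partial>gauss I)"
    by (rule gauss_transform[OF fin(1) J, symmetric]) (use Em(2) in \<open>simp add: sets_gauss\<close>)
  also have "\<dots> \<ge> (\<integral>\<^sup>+\<omega>. ennreal (exp (- 2)) * indicator E \<omega> \<partial>gauss I)"
    using weight by (intro nn_integral_mono) (auto simp: indicator_def ETE intro!: ennreal_leI)
  also have "(\<integral>\<^sup>+\<omega>. ennreal (exp (- 2)) * indicator E \<omega> \<partial>gauss I) = ennreal (exp (- 2)) * emeasure (gauss I) E"
    by (rule nn_integral_cmult_indicator) (rule Em)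
  finally have "ennreal (exp (- 2)) * emeasure (gauss I) E \<le> emeasure (gauss I) E'" .
  then have "exp (- 2) * prob E \<le> prob E'"
    by (simp add: emeasure_eq_measure ennreal_mult[symmetric])
  then show ?thesis by (simp add: E_def E'_def)
qed

text \<open>
  About \<open>1 / (4 \<kappa>)\<close> dilated copies of the shell are disjoint, and by the previous lemma each has at
  least a constant fraction of its probability. As the probabilities add up to at most 1, the
  shell has probability of order \<open>\<kappa>\<close>, uniformly in \<open>d\<close>.
\<close>

lemma chi_square_anticoncentration:
  fixes A I :: "'i set" and d :: nat
  assumes fin: "finite I" "A \<subseteq> I" "card A = d" "1 \<le> d" and \<kappa>: "0 < \<kappa>"
  defines "Q \<equiv> \<lambda>\<omega> :: 'i \<Rightarrow> real. \<Sum>p\<in>A. (\<omega> p)\<^sup>2"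
  shows "measure (gauss I) {\<omega> \<in> space (gauss I). \<bar>Q \<omega> - d\<bar> \<le> \<kappa> / sqrt (real d) * d} \<le> 72 * \<kappa>"
proof (cases "\<kappa> \<le> 1 / 8")
  case False
  interpret prob_space "gauss I" by (rule prob_space_gauss)
  show ?thesis using False by (intro order_trans[OF prob_le_1]) auto
next
  case True
  interpret prob_space "gauss I" by (rule prob_space_gauss)
  define \<theta> where "\<theta> = \<kappa> / sqrt (real d)"
  have sd: "1 \<le> sqrt (real d)" using fin by simp
  have \<theta>: "0 < \<theta>" "\<theta> \<le> 1 / sqrt (real d)" "\<theta> \<le> 1 / 8"
  proof -
    show "0 < \<theta>" using \<kappa> sd by (simp add: \<theta>_def)
    show "\<theta> \<le> 1 / sqrt (real d)" using True sd by (simp add: \<theta>_def divide_right_mono)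
    have "\<theta> \<le> \<kappa> / 1" unfolding \<theta>_def using \<kappa> sd by (intro divide_left_mono) auto
    then show "\<theta> \<le> 1 / 8" using True by simp
  qed
  \<comment> \<open>The exponents \<open>4 \<theta> i\<close> with \<open>i < N\<close> stay below \<open>1 / sqrt d\<close>, where dilation costs a constant.\<close>
  define N where "N = nat \<lfloor>1 / (4 * \<kappa>)\<rfloor>"
  have fl: "1 / (4 * \<kappa>) - 1 < real N" "real N \<le> 1 / (4 * \<kappa>)"
    unfolding N_def using \<kappa> by (auto simp: of_nat_nat)
  have "1 / (8 * \<kappa>) \<le> 1 / (4 * \<kappa>) - 1" using True \<kappa> by (simp add: field_simps)
  then have N: "1 / (8 * \<kappa>) \<le> real N" using fl by simp
  have Qm [measurable]: "Q \<in> borel_measurable (fun_space I)" unfolding Q_def by measurable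
  define E where "E = (\<lambda>i. {\<omega> \<in> space (gauss I). \<bar>Q \<omega> - exp (4 * \<theta> * real i) * d\<bar> \<le> \<theta> * (exp (4 * \<theta> * real i) * d)})"
  have Em: "E i \<in> events" for i unfolding E_def by measurable
  have low: "exp (- 2) * prob {\<omega> \<in> space (gauss I). \<bar>Q \<omega> - d\<bar> \<le> \<theta> * d} \<le> prob (E i)" if "i < N" for i
    unfolding E_def Q_def
  proof (rule chi_square_scaling[OF fin])
    have "4 * \<theta> * real i \<le> 4 * \<theta> * (1 / (4 * \<kappa>))"
      using that fl \<theta> by (intro mult_left_mono) auto
    also have "\<dots> = 1 / sqrt (real d)" using \<kappa> by (simp add: \<theta>_def)
    finally show "4 * \<theta> * real i \<le> 1 / sqrt (real d)" .
  qed (use \<theta> in auto)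
  have disj: "E i \<inter> E k = {}" if "i < k" for i k
  proof (rule ccontr)
    assume "E i \<inter> E k \<noteq> {}"
    then obtain \<omega> where \<omega>: "\<omega> \<in> E i" "\<omega> \<in> E k" by blast
    define a where "a = exp (4 * \<theta> * real i) * real d"
    define b where "b = exp (4 * \<theta> * real k) * real d"
    have a: "0 < a" using fin by (simp add: a_def)
    have "\<bar>Q \<omega> - a\<bar> \<le> \<theta> * a" "\<bar>Q \<omega> - b\<bar> \<le> \<theta> * b" using \<omega> by (simp_all add: E_def a_def b_def)
    then have "(1 - \<theta>) * b \<le> (1 + \<theta>) * a" by (simp add: abs_le_iff algebra_simps)
    moreover have "(1 + 4 * \<theta>) * a \<le> b"
    proof -
      \<comment> \<open>The relative half-width of a shell is \<open>\<theta>\<close>, so that steps by \<open>4 \<theta>\<close> on the logarithmic scale separate the shells.\<close>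
      have "1 + 4 * \<theta> \<le> exp (4 * \<theta>)" by (rule exp_ge_add_one_self)
      also have "\<dots> \<le> exp (4 * \<theta> * (real k - real i))"
        using that \<theta> by simp
      finally have "(1 + 4 * \<theta>) * a \<le> exp (4 * \<theta> * (real k - real i)) * a" using a by (intro mult_right_mono) auto
      also have "\<dots> = b" by (simp add: a_def b_def exp_add[symmetric] algebra_simps)
      finally show ?thesis .
    qed
    ultimately have "(1 - \<theta>) * ((1 + 4 * \<theta>) * a) \<le> (1 + \<theta>) * a"
      using \<theta> mult_left_mono[of "(1 + 4 * \<theta>) * a" b "1 - \<theta>"] by linarith
    then have "(1 - \<theta>) * (1 + 4 * \<theta>) \<le> 1 + \<theta>" using a by (simp add: mult.assoc[symmetric])
    then have "2 * \<theta> \<le> 4 * (\<theta> * \<theta>)" by (simp add: algebra_simps)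
    moreover have "\<theta> * \<theta> \<le> \<theta> * (1 / 8)" using \<theta> by (intro mult_left_mono) auto
    ultimately show False using \<theta> by linarith
  qed
  have "disjoint_family_on E {..<N}"
    unfolding disjoint_family_on_def
  proof safe
    fix i k x assume h: "i \<noteq> k" "x \<in> E i" "x \<in> E k"
    then consider "i < k" | "k < i" by linarith
    then show "x \<in> {}" using h disj[of i k] disj[of k i] by cases blast+
  qed
  then have "prob (\<Union>i<N. E i) = (\<Sum>i<N. prob (E i))"
    using Em by (intro finite_measure_finite_Union) auto
  then have "(\<Sum>i<N. prob (E i)) \<le> 1" using prob_le_1[of "\<Union>i<N. E i"] by simp
  moreover have "(\<Sum>i<N. exp (- 2) * prob {\<omega> \<in> space (gauss I). \<bar>Q \<omega> - d\<bar> \<le> \<theta> * d}) \<le> (\<Sum>i<N. prob (E i))"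
    by (intro sum_mono low) simp
  ultimately have 1: "real N * (exp (- 2) * prob {\<omega> \<in> space (gauss I). \<bar>Q \<omega> - d\<bar> \<le> \<theta> * d}) \<le> 1" by simp
  have e2: "exp 2 \<le> (9 :: real)"
  proof -
    have "exp (2 :: real) = exp 1 * exp 1" by (simp add: exp_add[symmetric])
    also have "\<dots> \<le> 3 * 3" using exp_le by (intro mult_mono) auto
    finally show ?thesis by simp
  qed
  define P where "P = prob {\<omega> \<in> space (gauss I). \<bar>Q \<omega> - d\<bar> \<le> \<theta> * d}"
  have "1 / (8 * \<kappa>) * (exp (- 2) * P) \<le> real N * (exp (- 2) * P)"
    using N by (intro mult_right_mono) (auto simp: P_def)
  then have "1 / (8 * \<kappa>) * (exp (- 2) * P) \<le> 1" using 1 by (simp add: P_def)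
  then have "P \<le> 8 * \<kappa> * exp 2" using \<kappa> by (simp add: exp_minus field_simps)
  also have "\<dots> \<le> 8 * \<kappa> * 9" using e2 \<kappa> by (intro mult_left_mono) auto
  finally show ?thesis by (simp add: P_def \<theta>_def)
qed

lemma cov_excess_small_ball_one_column:
  fixes n m d :: nat
  assumes "1 \<le> m" "1 \<le> d" "0 < \<kappa>"
  defines "B \<equiv> {1..d} \<times> {n+1..n+m}"
  shows "measure (gauss B) {b \<in> space (gauss B). cov_excess n m d b < \<kappa>\<^sup>2 / real d} \<le> 72 * \<kappa>"
proof -
  interpret prob_space "gauss B" by (rule prob_space_gauss)
  define A where "A = {1..d} \<times> {n+1}"
  have d: "0 < real d" using assms by simp
  have "prob {b \<in> space (gauss B). cov_excess n m d b < \<kappa>\<^sup>2 / real d}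
     \<le> prob {b \<in> space (gauss B). \<bar>(\<Sum>p\<in>A. (b p)\<^sup>2) - real d\<bar> \<le> \<kappa> / sqrt (real d) * real d}"
  proof (rule finite_measure_mono)
    show "{b \<in> space (gauss B). cov_excess n m d b < \<kappa>\<^sup>2 / real d}
      \<subseteq> {b \<in> space (gauss B). \<bar>(\<Sum>p\<in>A. (b p)\<^sup>2) - real d\<bar> \<le> \<kappa> / sqrt (real d) * real d}"
    proof safe
      fix b assume h: "cov_excess n m d b < \<kappa>\<^sup>2 / real d"
      define q where "q = sample_cov n d b 1 1 - 1"
      have "q\<^sup>2 \<le> (\<Sum>k = 1..m. (sample_cov n d b 1 k - kron 1 k)\<^sup>2)"
        unfolding q_def using assms(1) member_le_sum[of 1 "{1..m}" "\<lambda>k. (sample_cov n d b 1 k - kron 1 k)\<^sup>2"] by simp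
      also have "\<dots> \<le> cov_excess n m d b"
        unfolding cov_excess_def hs_norm_sq_def
        using assms(1) by (intro member_le_sum[of 1 "{1..m}" "\<lambda>j. \<Sum>k = 1..m. (sample_cov n d b j k - kron j k)\<^sup>2"]) (auto intro: sum_nonneg)
      finally have "q\<^sup>2 \<le> (\<kappa> / sqrt (real d))\<^sup>2" using h by (simp add: power_divide)
      then have "\<bar>q\<bar>\<^sup>2 \<le> (\<kappa> / sqrt (real d))\<^sup>2" by simp
      then have "\<bar>q\<bar> \<le> \<kappa> / sqrt (real d)" by (rule power2_le_imp_le) (use assms(3) in simp)
      then have "\<bar>q\<bar> * real d \<le> \<kappa> / sqrt (real d) * real d" by (intro mult_right_mono) auto
      moreover have "\<bar>q\<bar> * real d = \<bar>q * real d\<bar>" by (simp add: abs_mult)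
      moreover have "q * real d = (\<Sum>p\<in>A. (b p)\<^sup>2) - real d"
        using d by (simp add: q_def sample_cov_def A_def sum.cartesian_product' power2_eq_square left_diff_distrib)
      ultimately show "\<bar>(\<Sum>p\<in>A. (b p)\<^sup>2) - real d\<bar> \<le> \<kappa> / sqrt (real d) * real d" by simp
    qed
    show "{b \<in> space (gauss B). \<bar>(\<Sum>p\<in>A. (b p)\<^sup>2) - real d\<bar> \<le> \<kappa> / sqrt (real d) * real d} \<in> events" by measurable
  qed
  also have "\<dots> \<le> 72 * \<kappa>"
    using assms by (intro chi_square_anticoncentration) (auto simp: A_def B_def)
  finally show ?thesis .
qed

section \<open>Total variation for small dimension\<close>

text \<open>
  Fubini with \<open>B\<close> as the outer variable. If the excess is at least \<open>W\<close>, then the conditional mean of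
  the statistic is at least twice the threshold and Chebyshev's inequality applies.
\<close>

lemma row_stat_gram_lower_tail:
  fixes n m d h :: nat and W :: real
  assumes h: "1 \<le> h" "2 * h \<le> n" "1 \<le> d" and W: "0 < W"
  defines "B \<equiv> {1..d} \<times> {n+1..n+m}" and "\<rho> \<equiv> 2 * real m / (real h * W) + 2 / real h"
  shows "measure (gauss (idx n m d)) {X \<in> space (gauss (idx n m d)). row_stat h m (gram_block n m d X) \<le> (real h)\<^sup>2 * W / 2}
     \<le> measure (gauss B) {b \<in> space (gauss B). cov_excess n m d b < W} + 16 * (\<rho> + \<rho>\<^sup>2)"
proof -
  define A where "A = {1..d} \<times> {1..n}"
  have I: "idx n m d = B \<union> A" "B \<inter> A = {}" "finite B" "finite A" by (auto simp: A_def B_def)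
  interpret A: prob_space "gauss A" by (rule prob_space_gauss)
  interpret B: prob_space "gauss B" by (rule prob_space_gauss)
  interpret X: prob_space "gauss (idx n m d)" by (rule prob_space_gauss)
  have \<rho>: "0 \<le> \<rho>" using W by (simp add: \<rho>_def)
  have q0: "0 \<le> 16 * (\<rho> + \<rho>\<^sup>2)" using \<rho> by simp
  \<comment> \<open>Half of the smallest conditional mean on the event that the excess is at least \<open>W\<close>.\<close>
  define \<tau> where "\<tau> = (real h)\<^sup>2 * W / 2"
  define G where "G = {X \<in> space (gauss (idx n m d)). row_stat h m (gram_block n m d X) \<le> \<tau>}"
  have "(\<lambda>X. row_stat h m (gram_block n m d X)) \<in> borel_measurable (fun_space (idx n m d))"
    by (rule measurable_compose[OF gram_block_measurable row_stat_measurable])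
  then have G: "G \<in> sets (gauss (idx n m d))" unfolding G_def by measurable
  define st where "st = (\<lambda>b a. row_stat h m (\<lambda>p. (\<Sum>r = 1..d. a (r, fst p) * b (r, n + snd p)) / sqrt (real d)))"
  have stm [measurable]: "st b \<in> borel_measurable (fun_space A)" for b
    unfolding st_def row_stat_def by measurable
  have merge: "row_stat h m (gram_block n m d (merge B A (b, a))) = st b a" for a b
    unfolding st_def
  proof (rule row_stat_cong)
    fix i j assume ij: "i \<in> {1..2*h}" "j \<in> {1..m}"
    then have "i \<in> {1..n}" using h by auto
    with ij have "gram_block n m d (merge B A (b, a)) (i, j)
        = (\<Sum>r = 1..d. merge B A (b, a) (r, i) * merge B A (b, a) (r, n + j)) / sqrt (real d)"
      by (simp add: gram_block_def)
    also have "(\<Sum>r = 1..d. merge B A (b, a) (r, i) * merge B A (b, a) (r, n + j)) = (\<Sum>r = 1..d. a (r, i) * b (r, n + j))"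
      using \<open>i \<in> {1..n}\<close> ij by (intro sum.cong refl) (auto simp: merge_def A_def B_def)
    finally show "gram_block n m d (merge B A (b, a)) (i, j) = (\<Sum>r = 1..d. a (r, fst (i, j)) * b (r, n + snd (i, j))) / sqrt (real d)"
      by simp
  qed
  have inner: "(\<integral>\<^sup>+a. indicator G (merge B A (b, a)) \<partial>gauss A)
      \<le> indicator {b \<in> space (gauss B). cov_excess n m d b < W} b + ennreal (16 * (\<rho> + \<rho>\<^sup>2))"
    if b: "b \<in> space (gauss B)" for b
  proof (cases "cov_excess n m d b < W")
    case True
    have "(\<integral>\<^sup>+a. indicator G (merge B A (b, a)) \<partial>gauss A) \<le> (\<integral>\<^sup>+a. 1 \<partial>gauss A)"
      by (intro nn_integral_mono) (simp add: indicator_def)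
    also have "\<dots> = 1" by (simp add: A.emeasure_space_1)
    finally show ?thesis using True b by (simp add: indicator_def add_increasing2)
  next
    case False
    define w where "w = cov_excess n m d b"
    define s where "s = hs_norm_sq {1..m} (sample_cov n d b)"
    define t where "t = (real h)\<^sup>2 * w / 2"
    have w: "W \<le> w" "0 < w" using False W by (auto simp: w_def)
    have h0: "0 < real h" using h by simp
    have t: "0 < t" using w h0 by (simp add: t_def)
    have "(\<integral>\<^sup>+a. indicator G (merge B A (b, a)) \<partial>gauss A)
        \<le> (\<integral>\<^sup>+a. indicator {a \<in> space (gauss A). t \<le> \<bar>st b a - (real h)\<^sup>2 * w\<bar>} a \<partial>gauss A)"
    proof (intro nn_integral_mono)
      fix a assume a: "a \<in> space (gauss A)"
      have "t \<le> \<bar>st b a - (real h)\<^sup>2 * w\<bar>" if "merge B A (b, a) \<in> G"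
      proof -
        have "st b a \<le> \<tau>" using that by (simp add: G_def merge)
        moreover have "\<tau> \<le> t" unfolding \<tau>_def t_def using w by (intro divide_right_mono mult_left_mono) auto
        moreover have "(real h)\<^sup>2 * w = 2 * t" by (simp add: t_def)
        ultimately show ?thesis by linarith
      qed
      then show "indicator G (merge B A (b, a)) \<le> (indicator {a \<in> space (gauss A). t \<le> \<bar>st b a - (real h)\<^sup>2 * w\<bar>} a :: ennreal)"
        using a by (auto simp: indicator_def)
    qed
    also have "\<dots> = ennreal (A.prob {a \<in> space (gauss A). t \<le> \<bar>st b a - (real h)\<^sup>2 * w\<bar>})"
      by (subst nn_integral_indicator) (measurable, simp add: A.emeasure_eq_measure)
    also have "\<dots> \<le> ennreal (16 * (\<rho> + \<rho>\<^sup>2))"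
    proof (rule ennreal_leI)
      have "A.prob {a \<in> space (gauss A). t \<le> \<bar>st b a - (real h)\<^sup>2 * w\<bar>}
         \<le> (4 * real h ^ 3 * w * s + 4 * (real h)\<^sup>2 * s\<^sup>2) / t\<^sup>2"
        unfolding st_def w_def s_def A_def by (rule row_stat_gram_conditional[OF h(2,3) t])
      also have "\<dots> = 16 * (s / (real h * w) + (s / (real h * w))\<^sup>2)"
        using h0 w by (simp add: t_def field_simps power2_eq_square power3_eq_cube)
      also have "\<dots> \<le> 16 * (\<rho> + \<rho>\<^sup>2)"
      proof -
        have "s / (real h * w) \<le> (2 * real m + 2 * w) / (real h * w)"
          unfolding s_def w_def using hs_norm_sq_sample_cov_le h0 w[unfolded w_def] by (intro divide_right_mono) auto
        also have "\<dots> = 2 * real m / (real h * w) + 2 / real h" using h0 w by (simp add: field_simps)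
        also have "\<dots> \<le> \<rho>"
          unfolding \<rho>_def using h0 w W by (intro add_right_mono divide_left_mono mult_left_mono) auto
        finally have "s / (real h * w) \<le> \<rho>" .
        moreover have "0 \<le> s / (real h * w)" using h0 w hs_norm_sq_nonneg[of "{1..m}" "sample_cov n d b"] by (simp add: s_def)
        ultimately show ?thesis by (intro mult_left_mono add_mono power_mono) auto
      qed
      finally show "A.prob {a \<in> space (gauss A). t \<le> \<bar>st b a - (real h)\<^sup>2 * w\<bar>} \<le> 16 * (\<rho> + \<rho>\<^sup>2)" .
    qed
    finally show ?thesis by (simp add: add_increasing)
  qed
  have Gi: "(indicator G :: _ \<Rightarrow> ennreal) \<in> borel_measurable (gauss (B \<union> A))" using G I(1) by simp
  have "emeasure (gauss (idx n m d)) G = (\<integral>\<^sup>+X. indicator G X \<partial>gauss (B \<union> A))"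
    unfolding I(1)[symmetric] by (rule nn_integral_indicator[OF G, symmetric])
  also have "\<dots> = (\<integral>\<^sup>+b. (\<integral>\<^sup>+a. indicator G (merge B A (b, a)) \<partial>gauss A) \<partial>gauss B)"
    by (rule gauss.product_nn_integral_fold[OF I(2-4) Gi])
  also have "\<dots> \<le> (\<integral>\<^sup>+b. indicator {b \<in> space (gauss B). cov_excess n m d b < W} b + ennreal (16 * (\<rho> + \<rho>\<^sup>2)) \<partial>gauss B)"
    by (intro nn_integral_mono inner)
  also have "\<dots> = emeasure (gauss B) {b \<in> space (gauss B). cov_excess n m d b < W} + ennreal (16 * (\<rho> + \<rho>\<^sup>2))"
    by (subst nn_integral_add) (measurable, simp_all add: B.emeasure_space_1)
  finally have "ennreal (X.prob G) \<le> ennreal (B.prob {b \<in> space (gauss B). cov_excess n m d b < W} + 16 * (\<rho> + \<rho>\<^sup>2))"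
    unfolding X.emeasure_eq_measure B.emeasure_eq_measure using q0 by (simp only: ennreal_plus measure_nonneg)
  then have "X.prob G \<le> B.prob {b \<in> space (gauss B). cov_excess n m d b < W} + 16 * (\<rho> + \<rho>\<^sup>2)"
    using \<rho> by (subst (asm) ennreal_le_iff) auto
  then show ?thesis by (simp add: G_def \<tau>_def)
qed

text \<open>
  The bound from one column is good for small \<open>m\<close> and the bound from many columns for large \<open>m\<close>; their
  geometric mean does not depend on \<open>m\<close>.
\<close>

lemma cov_excess_small_ball:
  fixes n m d :: nat and \<epsilon> :: real
  assumes m: "1 \<le> m" "1 \<le> d" and e: "0 < \<epsilon>" "\<epsilon> \<le> 1 / 18"
  defines "B \<equiv> {1..d} \<times> {n+1..n+m}"
  shows "measure (gauss B) {b \<in> space (gauss B). cov_excess n m d b < \<epsilon> * (real m)\<^sup>2 / real d} \<le> sqrt (6912 * sqrt \<epsilon>)"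
proof -
  interpret prob_space "gauss B" by (rule prob_space_gauss)
  define P where "P = prob {b \<in> space (gauss B). cov_excess n m d b < \<epsilon> * (real m)\<^sup>2 / real d}"
  have d: "0 < real d" "0 < real m" using m by auto
  have one: "P \<le> 72 * (sqrt \<epsilon> * real m)"
    using cov_excess_small_ball_one_column[OF m, of "sqrt \<epsilon> * real m" n] e d
    by (simp add: P_def B_def power_mult_distrib)
  have many: "P \<le> 96 / real m"
  proof (cases "m = 1")
    case True
    have "P \<le> 1" unfolding P_def by (rule prob_le_1)
    then show ?thesis using True by simp
  next
    case False
    define l where "l = m div 2"
    have l: "1 \<le> l" "2 * l \<le> m" "m \<le> 3 * l" using False m by (auto simp: l_def)
    have ml: "real m \<le> 3 * real l" using l(3) by linarith
    have "\<epsilon> * (real m)\<^sup>2 / real d \<le> (real l)\<^sup>2 / (2 * real d)"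
    proof -
      have "\<epsilon> * (real m)\<^sup>2 \<le> 1 / 18 * (3 * real l)\<^sup>2" using e ml by (intro mult_mono power_mono) auto
      also have "\<dots> = (real l)\<^sup>2 / 2" by (simp add: power_mult_distrib)
      finally have "\<epsilon> * (real m)\<^sup>2 / real d \<le> (real l)\<^sup>2 / 2 / real d" by (rule divide_right_mono) simp
      then show ?thesis by simp
    qed
    then have "P \<le> 32 / real l" unfolding P_def B_def using l m by (intro cov_excess_small_ball_many_columns) auto
    also have "\<dots> \<le> 96 / real m" using ml l d by (simp add: field_simps)
    finally show ?thesis .
  qed
  have "P * P \<le> 72 * (sqrt \<epsilon> * real m) * (96 / real m)"
    using one many e d by (intro mult_mono) (auto simp: P_def)
  also have "\<dots> = 6912 * sqrt \<epsilon>" using d by simp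
  finally have "P\<^sup>2 \<le> 6912 * sqrt \<epsilon>" by (simp add: power2_eq_square)
  then show ?thesis unfolding P_def[symmetric] by (rule real_le_rsqrt)
qed

text \<open>
  The test set consists of the matrices whose statistic exceeds half of the conditional mean
  \<open>h\<^sup>2 W\<close> at the excess \<open>W = \<epsilon> m\<^sup>2 / d\<close>.
\<close>

lemma tv_dist_masked_ge:
  fixes n m d h :: nat and \<epsilon> :: real
  assumes h: "1 \<le> h" "2 * h \<le> n" and m: "1 \<le> m" "1 \<le> d" and e: "0 < \<epsilon>" "\<epsilon> \<le> 1 / 18"
  defines "\<eta> \<equiv> real d / (real h * real m)"
  shows "1 - (sqrt (6912 * sqrt \<epsilon>) + 16 * ((2 * (\<eta> / \<epsilon>) + 2 / real h) + (2 * (\<eta> / \<epsilon>) + 2 / real h)\<^sup>2) + 16 * (\<eta> / \<epsilon>)\<^sup>2)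
     \<le> tv_dist (masked_wishart (n + m) (complete_bipartite n m) d) (masked_goe (n + m) (complete_bipartite n m))"
proof -
  let ?P = "masked_wishart (n + m) (complete_bipartite n m) d"
  let ?Q = "masked_goe (n + m) (complete_bipartite n m)"
  define K where "K = {1..n} \<times> {1..m}"
  define W where "W = \<epsilon> * (real m)\<^sup>2 / real d"
  define \<tau> where "\<tau> = (real h)\<^sup>2 * W / 2"
  define f where "f = (\<lambda>Y :: nat \<times> nat \<Rightarrow> real. row_stat h m (\<lambda>p. Y (fst p, n + snd p)))"
  define T where "T = {Y \<in> space (mat_space (n + m)). \<tau> < f Y}"
  have pos: "0 < real h" "0 < real m" "0 < real d" using h m by auto
  have W: "0 < W" using e pos by (simp add: W_def)
  have \<tau>: "0 < \<tau>" using W pos by (simp add: \<tau>_def)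
  have "f \<in> borel_measurable (mat_space (n + m))" unfolding f_def row_stat_def by measurable
  then have T: "T \<in> sets (mat_space (n + m))" unfolding T_def by measurable
  interpret X: prob_space "gauss (idx n m d)" by (rule prob_space_gauss)
  interpret K: prob_space "gauss K" by (rule prob_space_gauss)
  have femb: "f (embed n m y) = row_stat h m y" for y
    unfolding f_def using h by (intro row_stat_cong) (auto simp: embed_def)
  have emb: "embed n m \<in> measurable (gauss K) (mat_space (n + m))"
    unfolding measurable_gauss K_def by (rule embed_measurable)
  have gr: "(\<lambda>X. embed n m (gram_block n m d X)) \<in> measurable (gauss (idx n m d)) (mat_space (n + m))"
    unfolding measurable_gauss by (rule measurable_compose[OF gram_block_measurable embed_measurable])
  have st: "(\<lambda>X. row_stat h m (gram_block n m d X)) \<in> borel_measurable (gauss (idx n m d))"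
    unfolding measurable_gauss by (rule measurable_compose[OF gram_block_measurable row_stat_measurable])
  have "measure ?P T = X.prob ((\<lambda>X. embed n m (gram_block n m d X)) -` T \<inter> space (gauss (idx n m d)))"
    unfolding masked_wishart_eq by (rule measure_distr[OF gr T])
  also have "(\<lambda>X. embed n m (gram_block n m d X)) -` T \<inter> space (gauss (idx n m d))
      = space (gauss (idx n m d)) - {X \<in> space (gauss (idx n m d)). row_stat h m (gram_block n m d X) \<le> \<tau>}"
    using measurable_space[OF gr] by (auto simp: T_def femb)
  also have "X.prob \<dots> = 1 - X.prob {X \<in> space (gauss (idx n m d)). row_stat h m (gram_block n m d X) \<le> \<tau>}"
    using st by (intro X.prob_compl) measurable
  finally have P: "measure ?P T = 1 - X.prob {X \<in> space (gauss (idx n m d)). row_stat h m (gram_block n m d X) \<le> \<tau>}" .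
  have "2 * real m / (real h * W) + 2 / real h = 2 * (\<eta> / \<epsilon>) + 2 / real h"
    using pos e by (simp add: W_def \<eta>_def power2_eq_square)
  then have P': "X.prob {X \<in> space (gauss (idx n m d)). row_stat h m (gram_block n m d X) \<le> \<tau>}
      \<le> sqrt (6912 * sqrt \<epsilon>) + 16 * ((2 * (\<eta> / \<epsilon>) + 2 / real h) + (2 * (\<eta> / \<epsilon>) + 2 / real h)\<^sup>2)"
    using row_stat_gram_lower_tail[OF h m(2) W, of m] cov_excess_small_ball[OF m e, of n]
    unfolding \<tau>_def W_def by (simp only:)
  have "measure ?Q T = K.prob (embed n m -` T \<inter> space (gauss K))"
    unfolding masked_goe_eq K_def[symmetric] by (rule measure_distr[OF emb T])
  also have "\<dots> \<le> K.prob {y \<in> space (gauss K). \<tau> \<le> \<bar>row_stat h m y\<bar>}"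
    using row_stat_measurable[of h m K] by (intro K.finite_measure_mono) (auto simp: T_def femb)
  also have "\<dots> \<le> 4 * (real h)\<^sup>2 * (real m)\<^sup>2 / \<tau>\<^sup>2"
    unfolding K_def by (rule row_stat_gaussian[OF h(2) \<tau>])
  also have "\<dots> = 16 * (\<eta> / \<epsilon>)\<^sup>2"
    using pos e by (simp add: \<tau>_def W_def \<eta>_def field_simps power2_eq_square)
  finally have Q: "measure ?Q T \<le> 16 * (\<eta> / \<epsilon>)\<^sup>2" .
  have "measure ?P T - measure ?Q T \<le> tv_dist ?P ?Q"
    using tv_dist_bounds(2)[OF prob_space_masked(1)[of n m d] prob_space_masked(2)[of n m], of T] T
    by (simp add: masked_wishart_eq)
  then show ?thesis using P P' Q by linarith
qed

lemma tv_dist_masked_tendsto_1: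
  fixes m d :: "nat \<Rightarrow> nat"
  assumes m: "\<And>n. 1 \<le> n \<Longrightarrow> 1 \<le> m n \<and> m n \<le> n" and d: "\<And>n. 1 \<le> n \<Longrightarrow> 1 \<le> d n"
    and lim: "(\<lambda>n. real (d n)) \<lless> (\<lambda>n. real (n * m n))"
  shows "(\<lambda>n. tv_dist (masked_wishart (n + m n) (complete_bipartite n (m n)) (d n))
                   (masked_goe (n + m n) (complete_bipartite n (m n)))) \<longlonglongrightarrow> 1"
proof (rule tendsto_sandwich[OF _ _ _ tendsto_const])
  define h where "h = (\<lambda>n :: nat. n div 2)"
  define \<eta> where "\<eta> = (\<lambda>n. real (d n) / (real (h n) * real (m n)))"
  \<comment> \<open>Both \<open>\<epsilon>\<close> and \<open>\<eta> / \<epsilon>\<close> have to vanish; the square root makes them equal.\<close>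
  define \<epsilon> where "\<epsilon> = (\<lambda>n. sqrt (\<eta> n))"
  define \<rho> where "\<rho> = (\<lambda>n. 2 * \<epsilon> n + 2 / real (h n))"
  define bound where "bound = (\<lambda>n. 1 - (sqrt (6912 * sqrt (\<epsilon> n)) + 16 * (\<rho> n + (\<rho> n)\<^sup>2) + 16 * (\<epsilon> n)\<^sup>2))"
  have ev2: "\<forall>\<^sub>F n :: nat in sequentially. 2 \<le> n" by (rule eventually_ge_at_top)
  from lim have top: "filterlim (\<lambda>n. real (n * m n) / real (d n)) at_top sequentially"
    by (simp add: much_greater_def)
  from tendsto_mult_left[OF tendsto_inverse_0_at_top[OF top], of 3]
  have x: "(\<lambda>n. 3 * (real (d n) / real (n * m n))) \<longlonglongrightarrow> 0" by simp
  have \<eta>: "\<eta> \<longlonglongrightarrow> 0"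
  proof (rule tendsto_sandwich[OF _ _ tendsto_const x])
    show "\<forall>\<^sub>F n in sequentially. 0 \<le> \<eta> n" by (simp add: \<eta>_def)
    show "\<forall>\<^sub>F n in sequentially. \<eta> n \<le> 3 * (real (d n) / real (n * m n))"
      using ev2
    proof eventually_elim
      case (elim n)
      have mn: "1 \<le> m n" using m[of n] elim by simp
      have hn: "1 \<le> h n" "n \<le> 3 * h n" using elim by (auto simp: h_def)
      have "real n * real (m n) \<le> 3 * real (h n) * real (m n)" using hn(2) by (intro mult_right_mono) linarith+
      then have "real (d n) / (3 * real (h n) * real (m n)) \<le> real (d n) / (real n * real (m n))"
        using mn elim hn by (intro divide_left_mono) auto
      then show ?case by (simp add: \<eta>_def)
    qed
  qed
  have \<epsilon>: "\<epsilon> \<longlonglongrightarrow> 0" using tendsto_real_sqrt[OF \<eta>] by (simp add: \<epsilon>_def)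
  have hh: "(\<lambda>n. 2 / real (h n)) \<longlonglongrightarrow> 0"
  proof -
    have "filterlim h at_top sequentially"
      unfolding h_def filterlim_at_top
    proof
      fix Z :: nat
      show "\<forall>\<^sub>F n in sequentially. Z \<le> n div 2"
        using eventually_ge_at_top[of "2 * Z"] by eventually_elim linarith
    qed
    then have "filterlim (\<lambda>n. real (h n)) at_top sequentially"
      by (rule filterlim_compose[OF filterlim_real_sequentially])
    from tendsto_mult_left[OF tendsto_inverse_0_at_top[OF this], of 2] show ?thesis by (simp add: divide_inverse)
  qed
  have \<rho>: "\<rho> \<longlonglongrightarrow> 0" using tendsto_add[OF tendsto_mult_left[OF \<epsilon>, of 2] hh] by (simp add: \<rho>_def)
  have "bound \<longlonglongrightarrow> 1 - (sqrt (6912 * sqrt 0) + 16 * (0 + 0\<^sup>2) + 16 * 0\<^sup>2)"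
    unfolding bound_def by (intro tendsto_intros \<epsilon> \<rho>)
  then show "bound \<longlonglongrightarrow> 1" by simp
  have "\<forall>\<^sub>F n in sequentially. \<epsilon> n < 1 / 18" using order_tendstoD(2)[OF \<epsilon>, of "1 / 18"] by simp
  with ev2 show "\<forall>\<^sub>F n in sequentially. bound n \<le> tv_dist (masked_wishart (n + m n) (complete_bipartite n (m n)) (d n))
                   (masked_goe (n + m n) (complete_bipartite n (m n)))"
  proof eventually_elim
    case (elim n)
    have mn: "1 \<le> m n" "1 \<le> d n" using m[of n] d[of n] elim by auto
    have hn: "1 \<le> h n" "2 * h n \<le> n" using elim by (auto simp: h_def)
    have \<eta>p: "0 < \<eta> n" using mn hn by (simp add: \<eta>_def)
    then have \<epsilon>p: "0 < \<epsilon> n" by (simp add: \<epsilon>_def)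
    have "\<eta> n / \<epsilon> n = \<epsilon> n" using \<eta>p by (simp add: \<epsilon>_def real_div_sqrt)
    then show ?case
      using tv_dist_masked_ge[OF hn mn \<epsilon>p] elim(2) by (simp add: bound_def \<rho>_def \<eta>_def)
  qed
  show "\<forall>\<^sub>F n in sequentially. tv_dist (masked_wishart (n + m n) (complete_bipartite n (m n)) (d n))
                   (masked_goe (n + m n) (complete_bipartite n (m n))) \<le> 1"
    by (intro always_eventually allI tv_dist_bounds(3) prob_space_masked)
qed

theorem corollary4p3:
  fixes m d :: "nat \<Rightarrow> nat"
  assumes "\<And>n. 1 \<le> n \<Longrightarrow> 1 \<le> m n \<and> m n \<le> n"
    and "\<And>n. 1 \<le> n \<Longrightarrow> 1 \<le> d n"
  shows "((\<lambda>n. real (d n)) \<ggreater> (\<lambda>n. real (n * m n)) \<longrightarrow>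
      (\<lambda>n. tv_dist (masked_wishart (n + m n) (complete_bipartite n (m n)) (d n))
                   (masked_goe (n + m n) (complete_bipartite n (m n)))) \<longlonglongrightarrow> 0) \<and>
    ((\<lambda>n. real (d n)) \<lless> (\<lambda>n. real (n * m n)) \<longrightarrow>
      (\<lambda>n. tv_dist (masked_wishart (n + m n) (complete_bipartite n (m n)) (d n))
                   (masked_goe (n + m n) (complete_bipartite n (m n)))) \<longlonglongrightarrow> 1)"
proof (intro conjI impI)
  assume "(\<lambda>n. real (d n)) \<ggreater> (\<lambda>n. real (n * m n))"
  then show "(\<lambda>n. tv_dist (masked_wishart (n + m n) (complete_bipartite n (m n)) (d n))
                   (masked_goe (n + m n) (complete_bipartite n (m n)))) \<longlonglongrightarrow> 0"
    by (intro tv_dist_masked_tendsto_0 assms(1))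
next
  assume "(\<lambda>n. real (d n)) \<lless> (\<lambda>n. real (n * m n))"
  then show "(\<lambda>n. tv_dist (masked_wishart (n + m n) (complete_bipartite n (m n)) (d n))
                   (masked_goe (n + m n) (complete_bipartite n (m n)))) \<longlonglongrightarrow> 1"
    by (intro tv_dist_masked_tendsto_1 assms)
qed

end
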